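(* Let $d,a,a_1,\dots,a_n,b_1,\dots,b_n,c,c_1,\dots,c_n$ be positive integers with $d\mid q-1$, let $\lambda_1,\dots,\lambda_n\in\kappa^\times$, and let $S^1_{A,\lambda},S^2_{A,\lambda},S_{B,\lambda}$ be the $n$-dimensional affine hypersurfaces over $\kappa$ defined by $$S^1_{A,\lambda}:\ y^d=\Big(1-\sum_{i=1}^n\lambda_ix_i\Big)^a\prod_{i=1}^nx_i^{b_i}(1-x_i)^{c_i},$$ $$S^2_{A,\lambda}:\ y^d=\Big(\prod_{i=1}^n(x_i-\lambda_i)^{b_i}\Big)\Big(\prod_{i=1}^nx_i^{c_i}\Big)\Big(1-\sum_{i=1}^nx_i\Big)^a,$$ $$S_{B,\lambda}:\ y^d=\Big(\prod_{i=1}^n(1-\lambda_ix_i)^{a_i}\Big)\Big(\prod_{i=1}^nx_i^{b_i}\Big)\Big(1-\sum_{i=1}^nx_i\Big)^c,$$ with $\mu_d$ acting by multiplication on $y$. For $m\in\mathbb{Z}/d\mathbb{Z}$ and $r\ge1$ define functions over $\kappa_r$ by $$f_r(\lambda)=F_A^{(n)}\left({\overline{\varphi_{d,r}}^{ma};\varphi_{d,r}^{mb_1},\dots,\varphi_{d,r}^{mb_n}\atop\varphi_{d,r}^{m(b_1+c_1)},\dots,\varphi_{d,r}^{m(b_n+c_n)}};\lambda_1,\dots,\lambda_n\right),$$ $$g_r(\lambda)=F_A^{(n)}\left({\overline{\varphi_{d,r}}^{m(a+\sum_{i=1}^n(b_i+c_i))};\overline{\varphi_{d,r}}^{mb_1},\dots,\overline{\varphi_{d,r}}^{mb_n}\atop\overline{\varphi_{d,r}}^{m(b_1+c_1)},\dots,\overline{\varphi_{d,r}}^{m(b_n+c_n)}};\lambda_1,\dots,\lambda_n\right),$$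 $$h_r(\lambda)=F_B^{(n)}\left({\overline{\varphi_{d,r}}^{ma_1},\dots,\overline{\varphi_{d,r}}^{ma_n};\varphi_{d,r}^{mb_1},\dots,\varphi_{d,r}^{mb_n}\atop\varphi_{d,r}^{m(b_1+\cdots+b_n+c)}};\lambda_1,\dots,\lambda_n\right).$$ (i) Suppose that $\gcd(d,a)=\gcd(d,c_i)=1$ for all $i$. Then $$L(S^1_{A,\lambda},\chi^m;t)=\begin{cases}\dfrac{1}{1-q^nt}&(m=0),\\ \exp\Big(\sum_{r=1}^\infty\Big(\prod_{i=1}^n\big(-\big(j(\varphi_d^{mb_i},\varphi_d^{mc_i})^r\big)\big)\Big)f_r(\lambda)\dfrac{t^r}{r}\Big)&(m\neq0).\end{cases}$$ (ii) Suppose that $\gcd(d,a)=\gcd(d,b_i)=1$ for all $i$. Then $$L(S^2_{A,\lambda},\chi^m;t)=\begin{cases}\dfrac{1}{1-q^nt}&(m=0),\\ \exp\Big(\sum_{r=1}^\infty(-1)^nJ_A^r\cdot g_r(\lambda)\dfrac{t^r}{r}\Big)&(m\neq0),\end{cases}$$ where $J_A=j\big(\varphi_d^{ma},\varphi_d^{m(b_1+c_1)},\dots,\varphi_d^{m(b_n+c_n)}\big)$. (iii) Suppose that $\gcd(d,a_i)=\gcd(d,c)=1$ for all $i$. Then $$L(S_{B,\lambda},\chi^m;t)=\begin{cases}\dfrac{1}{1-q^nt}&(m=0),\\ \exp\Big(\sum_{r=1}^\infty(-1)^nJ_B^r\cdot h_r(\lambda)\dfrac{t^r}{r}\Big)&(m\neq0),\end{cases}$$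 where $J_B=j\big(\varphi_d^{mb_1},\dots,\varphi_d^{mb_n},\varphi_d^{mc}\big)$.
   Context: $\kappa$ is a finite field with $q$ elements of characteristic $p$. $\widehat{\kappa^\times}=\mathrm{Hom}(\kappa^\times,\overline{\mathbb{Q}}^\times)$ is the group of multiplicative characters, $\varepsilon$ the trivial character, $\overline{\eta}=\eta^{-1}$; every $\eta\in\widehat{\kappa^\times}$ (including $\varepsilon$) is extended to $\kappa$ by $\eta(0)=0$. $\delta(\eta)=1$ if $\eta=\varepsilon$ and $0$ otherwise. Fix a non-trivial additive character $\psi\in\mathrm{Hom}(\kappa,\overline{\mathbb{Q}}^\times)$. Put $$g(\eta)=-\sum_{x\in\kappa^\times}\psi(x)\eta(x),\quad g^\circ(\eta)=q^{\delta(\eta)}g(\eta),\quad j(\eta_1,\dots,\eta_k)=(-1)^{k-1}\sum_{x_i\in\kappa^\times,\ x_1+\cdots+x_k=1}\ \prod_{i=1}^k\eta_i(x_i)\ (k\ge 2),$$ $$(\alpha)_\nu=\frac{g(\alpha\nu)}{g(\alpha)},\qquad(\alpha)_\nu^\circ=\frac{g^\circ(\alpha\nu)}{g^\circ(\alpha)},$$ $$F_A^{(n)}\left({\alpha;\beta_1,\dots,\beta_n\atop\gamma_1,\dots,\gamma_n};\lambda_1,\dots,\lambda_n\right)=\frac{1}{(1-q)^n}\sum_{\nu_1,\dots,\nu_n\in\widehat{\kappa^\times}}\frac{(\alpha)_{\nu_1\cdots\nu_n}(\beta_1)_{\nu_1}\cdots(\beta_n)_{\nu_n}}{(\gamma_1)^\circ_{\nu_1}\cdots(\gamma_n)^\circ_{\nu_n}(\varepsilon)^\circ_{\nu_1}\cdots(\varepsilon)^\circ_{\nu_n}}\nu_1(\lambda_1)\cdots\nu_n(\lambda_n),$$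 $$F_B^{(n)}\left({\alpha_1,\dots,\alpha_n;\beta_1,\dots,\beta_n\atop\gamma};\lambda_1,\dots,\lambda_n\right)=\frac{1}{(1-q)^n}\sum_{\nu_1,\dots,\nu_n\in\widehat{\kappa^\times}}\frac{(\alpha_1)_{\nu_1}\cdots(\alpha_n)_{\nu_n}(\beta_1)_{\nu_1}\cdots(\beta_n)_{\nu_n}}{(\gamma)^\circ_{\nu_1\cdots\nu_n}(\varepsilon)^\circ_{\nu_1}\cdots(\varepsilon)^\circ_{\nu_n}}\nu_1(\lambda_1)\cdots\nu_n(\lambda_n).$$ $\kappa_r\subset\overline{\kappa}$ is the degree $r$ extension of $\kappa$; functions over $\kappa_r$ are defined by the same formulas with $\kappa,q$ replaced by $\kappa_r,q^r$ and with any non-trivial additive character of $\kappa_r$ (the values of $F_A^{(n)},F_B^{(n)}$ do not depend on this choice). $\mu_d\subset\kappa^\times$ is the group of $d$th roots of unity. Fix a generator $\varphi$ of $\widehat{\kappa^\times}$ and put $\varphi_d=\varphi^{(q-1)/d}$, $\chi=\varphi|_{\mu_d}$ (so $\widehat{\mu_d}=\{\chi^m\mid m\in\mathbb{Z}/d\mathbb{Z}\}$) and $\varphi_{d,r}=\varphi_d\circ N_{\kappa_r/\kappa}\in\widehat{\kappa_r^\times}$, where $N_{\kappa_r/\kappa}$ is the norm map. For a variety $V$ over $\kappa$ with an action over $\kappa$ of a finite abelian group $G$, with $F$ the $q$-Frobenius on $V(\overline{\kappa})$, and for $\theta\in\mathrm{Hom}(G,\overline{\mathbb{Q}}^\times)$,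 $$N_r(V;\theta)=\frac{1}{\#G}\sum_{g\in G}\theta(g)\,\#\{x\in V(\overline{\kappa})\mid F^r(x)=g(x)\},\qquad L(V,\theta;t)=\exp\Big(\sum_{r=1}^\infty\frac{N_r(V;\theta)}{r}t^r\Big)\in\overline{\mathbb{Q}}[[t]].$$ *)

theory Defs
  imports
    "HOL-Algebra.Algebraic_Closure_Type"
    "HOL-Library.FuncSet"
    "HOL-Library.Cardinality"
    "HOL-Computational_Algebra.Formal_Power_Series"
begin

type_synonym qbar = "rat alg_closure"

section \<open>Characters, Gauss sums and Jacobi sums\<close>

text \<open>
  All definitions of this section take a finite field as an explicit carrier set \<open>K\<close> inside an
  ambient field type, so that the same formulas serve the base field (\<open>K = UNIV\<close>) and its
  finite extensions inside an algebraic closure. The order \<open>q\<close> of the field is \<open>card K\<close>.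

  A multiplicative character is represented by its extension by zero. It is also zero outside
  \<open>K\<close>, so that distinct functions in \<open>mult_chars K\<close> are distinct characters of the unit group.
\<close>

definition mult_chars :: "'k::field set \<Rightarrow> ('k \<Rightarrow> qbar) set" where
  "mult_chars K = {\<eta>. (\<forall>x\<in>K - {0}. \<forall>y\<in>K - {0}. \<eta> (x * y) = \<eta> x * \<eta> y) \<and>
                       (\<forall>x\<in>K - {0}. \<eta> x \<noteq> 0) \<and> (\<forall>x. x \<notin> K - {0} \<longrightarrow> \<eta> x = 0)}"

definition triv_char :: "'k::field set \<Rightarrow> 'k \<Rightarrow> qbar" where
  "triv_char K = (\<lambda>x. if x \<in> K - {0} then 1 else 0)"

definition char_prod :: "'k::field set \<Rightarrow> 'i set \<Rightarrow> ('i \<Rightarrow> 'k \<Rightarrow> qbar) \<Rightarrow> 'k \<Rightarrow> qbar" where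
  "char_prod K I \<nu> = (\<lambda>x. triv_char K x * (\<Prod>i\<in>I. \<nu> i x))"

definition char_mult :: "('k \<Rightarrow> qbar) \<Rightarrow> ('k \<Rightarrow> qbar) \<Rightarrow> 'k \<Rightarrow> qbar" where
  "char_mult \<eta> \<theta> = (\<lambda>x. \<eta> x * \<theta> x)"

text \<open>
  The case distinction keeps the value zero off the unit group when \<open>k = 0\<close>, so that the zeroth
  power is the trivial character; the power with exponent \<open>-1\<close> is the inverse character.
\<close>

definition char_pow :: "('k \<Rightarrow> qbar) \<Rightarrow> int \<Rightarrow> 'k \<Rightarrow> qbar" where
  "char_pow \<eta> k = (\<lambda>x. if \<eta> x = 0 then 0 else \<eta> x powi k)"

definition generates_mult_chars :: "'k::field set \<Rightarrow> ('k \<Rightarrow> qbar) \<Rightarrow> bool" where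
  "generates_mult_chars K \<phi> \<longleftrightarrow> \<phi> \<in> mult_chars K \<and> (\<forall>\<eta>\<in>mult_chars K. \<exists>k. \<eta> = char_pow \<phi> k)"

definition nontrivial_add_char :: "'k::field set \<Rightarrow> ('k \<Rightarrow> qbar) \<Rightarrow> bool" where
  "nontrivial_add_char K \<psi> \<longleftrightarrow>
     (\<forall>x\<in>K. \<forall>y\<in>K. \<psi> (x + y) = \<psi> x * \<psi> y) \<and> (\<forall>x\<in>K. \<psi> x \<noteq> 0) \<and> (\<exists>x\<in>K. \<psi> x \<noteq> 1)"

definition gauss :: "'k::field set \<Rightarrow> ('k \<Rightarrow> qbar) \<Rightarrow> ('k \<Rightarrow> qbar) \<Rightarrow> qbar" where
  "gauss K \<psi> \<eta> = - (\<Sum>x\<in>K - {0}. \<psi> x * \<eta> x)"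

definition char_delta :: "'k::field set \<Rightarrow> ('k \<Rightarrow> qbar) \<Rightarrow> nat" where
  "char_delta K \<eta> = (if \<eta> = triv_char K then 1 else 0)"

definition gauss_circ :: "'k::field set \<Rightarrow> ('k \<Rightarrow> qbar) \<Rightarrow> ('k \<Rightarrow> qbar) \<Rightarrow> qbar" where
  "gauss_circ K \<psi> \<eta> = of_nat (card K) ^ char_delta K \<eta> * gauss K \<psi> \<eta>"

text \<open>The Jacobi sum of the family of characters \<open>\<eta> i\<close>, \<open>i \<in> I\<close>, for a finite nonempty \<open>I\<close>.\<close>

definition jacobi :: "'k::field set \<Rightarrow> 'i set \<Rightarrow> ('i \<Rightarrow> 'k \<Rightarrow> qbar) \<Rightarrow> qbar" where
  "jacobi K I \<eta> = (- 1) ^ (card I - 1) *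
     (\<Sum>x \<in> {x \<in> I \<rightarrow>\<^sub>E K - {0}. (\<Sum>i\<in>I. x i) = 1}. \<Prod>i\<in>I. \<eta> i (x i))"

definition jacobi2 :: "'k::field set \<Rightarrow> ('k \<Rightarrow> qbar) \<Rightarrow> ('k \<Rightarrow> qbar) \<Rightarrow> qbar" where
  "jacobi2 K \<eta> \<theta> = jacobi K {0, 1::nat} (\<lambda>i. if i = 0 then \<eta> else \<theta>)"

section \<open>Lauricella functions over finite fields\<close>

definition poch :: "'k::field set \<Rightarrow> ('k \<Rightarrow> qbar) \<Rightarrow> ('k \<Rightarrow> qbar) \<Rightarrow> ('k \<Rightarrow> qbar) \<Rightarrow> qbar" where
  "poch K \<psi> \<alpha> \<nu> = gauss K \<psi> (char_mult \<alpha> \<nu>) / gauss K \<psi> \<alpha>"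

definition poch_circ :: "'k::field set \<Rightarrow> ('k \<Rightarrow> qbar) \<Rightarrow> ('k \<Rightarrow> qbar) \<Rightarrow> ('k \<Rightarrow> qbar) \<Rightarrow> qbar" where
  "poch_circ K \<psi> \<alpha> \<nu> = gauss_circ K \<psi> (char_mult \<alpha> \<nu>) / gauss_circ K \<psi> \<alpha>"

definition lauricella_A ::
  "'k::field set \<Rightarrow> ('k \<Rightarrow> qbar) \<Rightarrow> nat \<Rightarrow> ('k \<Rightarrow> qbar) \<Rightarrow> (nat \<Rightarrow> 'k \<Rightarrow> qbar) \<Rightarrow>
   (nat \<Rightarrow> 'k \<Rightarrow> qbar) \<Rightarrow> (nat \<Rightarrow> 'k) \<Rightarrow> qbar" where
  "lauricella_A K \<psi> n \<alpha> \<beta> \<gamma> l =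
     1 / (1 - of_nat (card K)) ^ n *
     (\<Sum>\<nu> \<in> {1..n} \<rightarrow>\<^sub>E mult_chars K.
        poch K \<psi> \<alpha> (char_prod K {1..n} \<nu>) * (\<Prod>i=1..n. poch K \<psi> (\<beta> i) (\<nu> i)) /
        ((\<Prod>i=1..n. poch_circ K \<psi> (\<gamma> i) (\<nu> i)) *
         (\<Prod>i=1..n. poch_circ K \<psi> (triv_char K) (\<nu> i))) *
        (\<Prod>i=1..n. \<nu> i (l i)))"

definition lauricella_B ::
  "'k::field set \<Rightarrow> ('k \<Rightarrow> qbar) \<Rightarrow> nat \<Rightarrow> (nat \<Rightarrow> 'k \<Rightarrow> qbar) \<Rightarrow> (nat \<Rightarrow> 'k \<Rightarrow> qbar) \<Rightarrow>
   ('k \<Rightarrow> qbar) \<Rightarrow> (nat \<Rightarrow> 'k) \<Rightarrow> qbar" where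
  "lauricella_B K \<psi> n \<alpha> \<beta> \<gamma> l =
     1 / (1 - of_nat (card K)) ^ n *
     (\<Sum>\<nu> \<in> {1..n} \<rightarrow>\<^sub>E mult_chars K.
        (\<Prod>i=1..n. poch K \<psi> (\<alpha> i) (\<nu> i)) * (\<Prod>i=1..n. poch K \<psi> (\<beta> i) (\<nu> i)) /
        (poch_circ K \<psi> \<gamma> (char_prod K {1..n} \<nu>) *
         (\<Prod>i=1..n. poch_circ K \<psi> (triv_char K) (\<nu> i))) *
        (\<Prod>i=1..n. \<nu> i (l i)))"

section \<open>Finite extensions of the base field\<close>

text \<open>
  The base field is the finite type \<open>'a\<close> and its algebraic closure is \<open>'a alg_closure\<close>. The degree
  \<open>r\<close> extension is the fixed field of the \<open>r\<close>-th power of the Frobenius, i.e. the splitting field of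
  \<open>X ^ (q ^ r) - X\<close>.
\<close>

definition ext_field :: "nat \<Rightarrow> 'a::finite_field alg_closure set" where
  "ext_field r = {x. x ^ (CARD('a) ^ r) = x}"

lemma card_ext_field:
  assumes "r > 0"
  shows "card (ext_field r :: 'a::finite_field alg_closure set) = CARD('a) ^ r"
proof -
  define N where "N = CARD('a) ^ r"
  define p :: "'a alg_closure poly" where "p = monom 1 N - monom 1 1"
  have "card {0, 1 :: 'a} \<le> CARD('a)"
    by (rule card_mono) auto
  hence N: "N > 1"
    using assms unfolding N_def by (intro one_less_power) auto
  have "(\<Sum>x\<in>(UNIV :: 'a set). x + 1) = (\<Sum>x\<in>UNIV. x)"
    by (rule sum.reindex_bij_witness[of _ "\<lambda>x. x - 1" "\<lambda>x. x + 1"]) auto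
  hence "of_nat CARD('a) = (0 :: 'a)"
    by (simp add: sum.distrib)
  hence "of_nat CARD('a) = (0 :: 'a alg_closure)"
    by (metis to_ac_0 to_ac_of_nat)
  hence N0: "of_nat N = (0 :: 'a alg_closure)"
    using assms by (simp add: N_def)
  have deg: "degree p = N"
    using N degree_add_eq_left[of "- monom 1 1" "monom (1 :: 'a alg_closure) N"]
    by (simp add: p_def degree_monom_eq)
  hence p0: "p \<noteq> 0"
    using N by auto
  have dp: "pderiv p = - 1"
    by (simp add: p_def pderiv_diff pderiv_monom N0 monom_0 one_pCons)
  have sq: "order a p \<le> 1" for a
  proof (rule ccontr)
    assume "\<not> order a p \<le> 1"
    hence "[:- a, 1:] ^ 2 dvd p"
      by (metis order_1 dvd_trans le_imp_power_dvd not_less_eq_eq numeral_2_eq_2 One_nat_def)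
    then obtain s where "p = [:- a, 1:] * ([:- a, 1:] * s)"
      by (metis dvd_def power2_eq_square mult.assoc)
    hence "poly (pderiv p) a = 0"
      by (simp add: pderiv_mult del: mult_pCons_left)
    thus False by (simp add: dp)
  qed
  obtain A where A: "size A = degree p" "p = smult (lead_coeff p) (\<Prod>x\<in>#A. [:- x, 1:])"
    using alg_closed_imp_factorization[OF p0] by blast
  have "proots p = proots (\<Prod>x\<in>#A. [:- x, 1:])"
    using A(2) p0 by (metis leading_coeff_0_iff proots_smult)
  also have "\<dots> = A"
  proof (induction A)
    case (add a A)
    have "(\<Prod>x\<in>#A. [:- x, 1:]) \<noteq> 0"
      by (auto simp: prod_mset_zero_iff)
    hence "proots ([:- a, 1:] * (\<Prod>x\<in>#A. [:- x, 1:])) = {#a#} + A"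
      by (subst proots_mult) (auto simp: add.IH)
    thus ?case by simp
  qed auto
  finally have A': "proots p = A" .
  have "size A = (\<Sum>x\<in>set_mset A. count A x)"
    by (simp add: size_multiset_overloaded_eq)
  also have "\<dots> = (\<Sum>x\<in>set_mset A. 1)"
  proof (rule sum.cong)
    fix x assume "x \<in> set_mset A"
    hence "count A x > 0" by simp
    thus "count A x = 1" using sq[of x] p0 A' by (metis count_proots less_one nless_le linorder_not_less)
  qed auto
  also have "\<dots> = card {x. poly p x = 0}"
    using p0 A' by (metis card_eq_sum set_count_proots)
  also have "{x. poly p x = 0} = ext_field r"
    by (auto simp: p_def ext_field_def poly_monom N_def)
  finally show ?thesis
    using A(1) deg by (simp add: N_def)
qed

text \<open>The norm to the base field, as the product of the Galois conjugates.\<close>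

definition ext_norm :: "nat \<Rightarrow> 'a::finite_field alg_closure \<Rightarrow> 'a" where
  "ext_norm r x = of_ac (\<Prod>i<r. x ^ (CARD('a) ^ i))"

definition lift_char :: "nat \<Rightarrow> ('a::finite_field \<Rightarrow> qbar) \<Rightarrow> 'a alg_closure \<Rightarrow> qbar" where
  "lift_char r \<eta> = (\<lambda>x. if x \<in> ext_field r then \<eta> (ext_norm r x) else 0)"

section \<open>Artin L-functions\<close>

text \<open>
  A variety with an action of a finite abelian group is given by its set \<open>V\<close> of points over the
  algebraic closure, the Frobenius \<open>F\<close> on it, and the action \<open>act\<close> of the finite set \<open>G\<close>.
\<close>

definition twisted_count ::
  "'g set \<Rightarrow> ('g \<Rightarrow> 'v \<Rightarrow> 'v) \<Rightarrow> 'v set \<Rightarrow> ('v \<Rightarrow> 'v) \<Rightarrow> ('g \<Rightarrow> qbar) \<Rightarrow> nat \<Rightarrow> qbar" where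
  "twisted_count G act V F \<theta> r =
     1 / of_nat (card G) * (\<Sum>g\<in>G. \<theta> g * of_nat (card {x \<in> V. (F ^^ r) x = act g x}))"

text \<open>The formal power series \<open>exp (\<Sum>r\<ge>1. c r * t ^ r / r)\<close>.\<close>

definition exp_series :: "(nat \<Rightarrow> qbar) \<Rightarrow> qbar fps" where
  "exp_series c = fps_exp 1 oo Abs_fps (\<lambda>r. if r = 0 then 0 else c r / of_nat r)"

definition artin_L ::
  "'g set \<Rightarrow> ('g \<Rightarrow> 'v \<Rightarrow> 'v) \<Rightarrow> 'v set \<Rightarrow> ('v \<Rightarrow> 'v) \<Rightarrow> ('g \<Rightarrow> qbar) \<Rightarrow> qbar fps" where
  "artin_L G act V F \<theta> = exp_series (twisted_count G act V F \<theta>)"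

section \<open>The hypersurfaces\<close>

text \<open>Points of affine \<open>(n + 1)\<close>-space with coordinates \<open>x 1, \<dots>, x n\<close> and \<open>y\<close>.\<close>

type_synonym 'a point = "(nat \<Rightarrow> 'a alg_closure) \<times> 'a alg_closure"

definition affine_space :: "nat \<Rightarrow> 'a::field point set" where
  "affine_space n = ({1..n} \<rightarrow>\<^sub>E UNIV) \<times> UNIV"

definition frobenius :: "nat \<Rightarrow> 'a::finite_field point \<Rightarrow> 'a point" where
  "frobenius n = (\<lambda>(x, y). (\<lambda>i\<in>{1..n}. x i ^ CARD('a), y ^ CARD('a)))"

definition mu :: "nat \<Rightarrow> 'a::field set" where
  "mu d = {\<zeta>. \<zeta> ^ d = 1}"

definition mu_act :: "'a::field \<Rightarrow> 'a point \<Rightarrow> 'a point" where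
  "mu_act \<zeta> = (\<lambda>(x, y). (x, to_ac \<zeta> * y))"

definition S1_A :: "nat \<Rightarrow> nat \<Rightarrow> nat \<Rightarrow> (nat \<Rightarrow> nat) \<Rightarrow> (nat \<Rightarrow> nat) \<Rightarrow> (nat \<Rightarrow> 'a::field) \<Rightarrow> 'a point set" where
  "S1_A n d a b c l = {(x, y) \<in> affine_space n.
     y ^ d = (1 - (\<Sum>i=1..n. to_ac (l i) * x i)) ^ a * (\<Prod>i=1..n. x i ^ b i * (1 - x i) ^ c i)}"

definition S2_A :: "nat \<Rightarrow> nat \<Rightarrow> nat \<Rightarrow> (nat \<Rightarrow> nat) \<Rightarrow> (nat \<Rightarrow> nat) \<Rightarrow> (nat \<Rightarrow> 'a::field) \<Rightarrow> 'a point set" where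
  "S2_A n d a b c l = {(x, y) \<in> affine_space n.
     y ^ d = (\<Prod>i=1..n. (x i - to_ac (l i)) ^ b i) * (\<Prod>i=1..n. x i ^ c i) *
             (1 - (\<Sum>i=1..n. x i)) ^ a}"

definition S_B :: "nat \<Rightarrow> nat \<Rightarrow> (nat \<Rightarrow> nat) \<Rightarrow> (nat \<Rightarrow> nat) \<Rightarrow> nat \<Rightarrow> (nat \<Rightarrow> 'a::field) \<Rightarrow> 'a point set" where
  "S_B n d a b c l = {(x, y) \<in> affine_space n.
     y ^ d = (\<Prod>i=1..n. (1 - to_ac (l i) * x i) ^ a i) * (\<Prod>i=1..n. x i ^ b i) *
             (1 - (\<Sum>i=1..n. x i)) ^ c}"

text \<open>
  The L-function of a hypersurface \<open>S\<close> in affine \<open>(n + 1)\<close>-space with \<open>mu d\<close> acting on \<open>y\<close>,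
  for the \<open>m\<close>-th power of the restriction of \<open>\<phi>\<close> to \<open>mu d\<close>.
\<close>

definition L_mu ::
  "nat \<Rightarrow> nat \<Rightarrow> 'a::finite_field point set \<Rightarrow> ('a \<Rightarrow> qbar) \<Rightarrow> int \<Rightarrow> qbar fps" where
  "L_mu n d S \<phi> m = artin_L (mu d) mu_act S (frobenius n) (char_pow (restrict \<phi> (mu d)) m)"

end

theory Submission
  imports Defs "HOL-Algebra.Sylow"
begin

text \<open>
  Write \<open>q = CARD('a)\<close>, fix \<open>r\<close>, let \<open>K\<close> be the extension of degree \<open>r\<close> and \<open>Q = q ^ r\<close>. All three
  hypersurfaces have an equation \<open>y ^ d = P x\<close>. Over a point \<open>x\<close> of \<open>K ^ n\<close> with \<open>P x \<noteq> 0\<close> the \<open>r\<close>-th power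
  of the Frobenius multiplies every \<open>y\<close> by the same root of unity, \<open>P x ^ ((Q - 1) / d)\<close>, which is a
  power of the norm of \<open>P x\<close>; where \<open>P x = 0\<close> all of \<open>mu d\<close> contributes equally. Hence the
  \<open>\<chi>\<close>-part of the point count is the character sum of \<open>\<eta> (P x)\<close> over \<open>K ^ n\<close>, where \<open>\<eta>\<close> is the
  \<open>m\<close>-th power of the character \<open>\<phi>d\<close> composed with the norm, and for \<open>d dvd m\<close> it is the number \<open>Q ^ n\<close>
  of points of \<open>K ^ n\<close> (\<open>L_mu_superelliptic\<close>).

  The character sums are evaluated over a fixed \<open>K\<close> by Fourier analysis on the group \<open>(K - {0}) ^ n\<close>.
  The Fourier coefficients of \<open>\<alpha> (1 - (x 1 + \<dots> + x n))\<close> are Jacobi sums, Jacobi sums are quotients of Gauss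
  sums unless all characters involved are trivial, and with the reflection formula for Gauss sums
  this becomes a binomial series in the Pochhammer symbols (\<open>binomial_expansion\<close>). Expanding
  \<open>(1 - \<Sum> l i * x i) ^ a\<close> for \<open>S1_A\<close>, or the factors \<open>(1 - l i / x i) ^ b i\<close> for \<open>S2_A\<close>
  and \<open>(1 - l i * x i) ^ a i\<close> for \<open>S_B\<close>, leaves a Jacobi sum in \<open>x\<close> for every tuple \<open>\<nu>\<close> of
  characters. Its dependence on \<open>\<nu>\<close> is again a quotient of Pochhammer symbols, and the summands of the
  Lauricella function appear (\<open>sum_eq_lauricella_A\<close>, \<open>sum_eq_lauricella_A_reciprocal\<close>,
  \<open>sum_eq_lauricella_B\<close>). The coprimality assumptions make exactly the characters non-trivial for which
  these formulas require it.

  The factor in front is a Jacobi sum over \<open>K\<close>. It is the \<open>r\<close>-th power of the Jacobi sum over the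
  base field (\<open>jacobi_lift\<close>) by the Hasse-Davenport relation for Gauss sums (\<open>gauss_lift\<close>). The latter is
  the comparison of the coefficients in the logarithmic derivative of the L-series of the
  multiplicative function \<open>f \<mapsto> \<psi> (sum of the roots) * \<eta> (product of the roots)\<close> on monic polynomials: the
  Euler product side gives the Gauss sums of the extensions, while the sum over all polynomials of
  a given degree vanishes in degrees at least 2, so that the L-series is linear.
\<close>

section \<open>Roots in algebraically closed fields and finite subfields\<close>

lemma size_proots_alg_closed:
  fixes p :: "'k::alg_closed_field poly"
  shows "size (proots p) = degree p"
proof (cases "p = 0")
  case False
  obtain A where A: "size A = degree p" "p = smult (lead_coeff p) (\<Prod>x\<in>#A. [:- x, 1:])"
    using alg_closed_imp_factorization[OF False] by blast
  have "proots p = proots (\<Prod>x\<in>#A. [:- x, 1:])"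
    using A(2) False by (metis leading_coeff_0_iff proots_smult)
  also have "\<dots> = A"
  proof (induction A)
    case (add a A)
    have "(\<Prod>x\<in>#A. [:- x, 1:]) \<noteq> 0"
      by (auto simp: prod_mset_zero_iff)
    hence "proots ([:- a, 1:] * (\<Prod>x\<in>#A. [:- x, 1:])) = {#a#} + A"
      by (subst proots_mult) (auto simp: add.IH)
    thus ?case by simp
  qed auto
  finally show ?thesis
    using A(1) by simp
qed auto

text \<open>
  The polynomial \<open>X ^ N - c\<close> is separable: its derivative vanishes only at 0.
\<close>

lemma card_power_eq_alg_closed:
  fixes c :: "'k::alg_closed_field"
  assumes c: "c \<noteq> 0" and N: "of_nat N \<noteq> (0 :: 'k)"
  shows "finite {x. x ^ N = c}" "card {x. x ^ N = c} = N"
proof -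
  define p where "p = monom 1 N + [:- c:]"
  have N0: "N > 0"
    using N by (cases N) auto
  have deg: "degree p = N"
    using N0 degree_add_eq_left[of "[:- c:]" "monom 1 N"] by (simp add: p_def degree_monom_eq)
  have p0: "p \<noteq> 0"
    using deg N0 by auto
  have roots: "{x. poly p x = 0} = {x. x ^ N = c}"
    by (auto simp: p_def poly_monom)
  have "finite {x. poly p x = 0}"
    using p0 by (rule poly_roots_finite)
  thus fin: "finite {x. x ^ N = c}"
    by (simp add: roots)
  have ord: "order x p = 1" if "poly p x = 0" for x
  proof -
    have x0: "x \<noteq> 0"
      using that c N0 by (auto simp: p_def poly_monom power_0_left)
    have "poly (pderiv p) x \<noteq> 0"
      using N x0 by (simp add: p_def pderiv_add pderiv_monom poly_monom pderiv_pCons)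
    moreover have "order x p \<noteq> 0"
      using that p0 by (simp add: order_root)
    moreover have "order x p \<le> 1"
    proof (rule ccontr)
      assume "\<not> order x p \<le> 1"
      hence "[:- x, 1:] ^ 2 dvd p"
        by (metis order_1 dvd_trans le_imp_power_dvd not_less_eq_eq numeral_2_eq_2 One_nat_def)
      then obtain s where "p = [:- x, 1:] * ([:- x, 1:] * s)"
        by (metis dvd_def power2_eq_square mult.assoc)
      hence "poly (pderiv p) x = 0"
        by (simp add: pderiv_mult del: mult_pCons_left)
      with \<open>poly (pderiv p) x \<noteq> 0\<close> show False ..
    qed
    ultimately show ?thesis
      by linarith
  qed
  have "N = size (proots p)"
    by (simp add: size_proots_alg_closed deg)
  also have "\<dots> = (\<Sum>x | poly p x = 0. order x p)"
    using p0 by (simp add: size_multiset_overloaded_eq)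
  also have "\<dots> = card {x. poly p x = 0}"
    using ord by simp
  finally show "card {x. x ^ N = c} = N"
    by (simp add: roots)
qed

text \<open>
  The base field itself and its extensions inside the algebraic closure are treated uniformly as
  finite subsets of a field, because the degree of an extension cannot be a parameter of a type.
\<close>

locale finite_subfield =
  fixes K :: "'k::field set"
  assumes fin [simp, intro]: "finite K"
    and one_in [simp, intro]: "1 \<in> K"
    and diff_in [simp, intro]: "x \<in> K \<Longrightarrow> y \<in> K \<Longrightarrow> x - y \<in> K"
    and mult_in [simp, intro]: "x \<in> K \<Longrightarrow> y \<in> K \<Longrightarrow> x * y \<in> K"
    and inverse_in [simp, intro]: "x \<in> K \<Longrightarrow> inverse x \<in> K"
begin

lemma zero_in [simp, intro]: "0 \<in> K"
  using diff_in[OF one_in one_in] by simp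

lemma uminus_in [simp, intro]: "x \<in> K \<Longrightarrow> - x \<in> K"
  using diff_in[of 0 x] by simp

lemma add_in [simp, intro]: "x \<in> K \<Longrightarrow> y \<in> K \<Longrightarrow> x + y \<in> K"
  using diff_in[of x "- y"] by simp

lemma divide_in [simp, intro]: "x \<in> K \<Longrightarrow> y \<in> K \<Longrightarrow> x / y \<in> K"
  using mult_in[of x "inverse y"] by (simp add: divide_inverse)

lemma power_in [simp, intro]: "x \<in> K \<Longrightarrow> x ^ k \<in> K"
  by (induction k) auto

lemma sum_in [intro]: "(\<And>i. i \<in> I \<Longrightarrow> f i \<in> K) \<Longrightarrow> sum f I \<in> K"
  by (induction I rule: infinite_finite_induct) auto

lemma prod_in [intro]: "(\<And>i. i \<in> I \<Longrightarrow> f i \<in> K) \<Longrightarrow> prod f I \<in> K"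
  by (induction I rule: infinite_finite_induct) auto

lemma fin_units [simp, intro]: "finite (K - {0})"
  by simp

lemma card_units: "card (K - {0}) = card K - 1"
  by (simp add: card_Diff_singleton)

lemma card_gt_1: "card K > 1"
proof -
  have "card {0, 1 :: 'k} \<le> card K"
    by (rule card_mono) auto
  thus ?thesis by simp
qed

lemma unit_power:
  assumes x: "x \<in> K - {0}" shows "x ^ (card K - 1) = 1"
proof -
  have "(\<Prod>y\<in>K - {0}. x * y) = (\<Prod>y\<in>K - {0}. y)"
    by (rule prod.reindex_bij_witness[of _ "\<lambda>y. y / x" "\<lambda>y. x * y"]) (use x in auto)
  also have "(\<Prod>y\<in>K - {0}. x * y) = x ^ (card K - 1) * (\<Prod>y\<in>K - {0}. y)"
    by (simp add: prod.distrib card_units)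
  finally show ?thesis by auto
qed

text \<open>
  The unit group is cyclic. The generator is used to describe characters by their single value
  on it.
\<close>

lemma ex_generator:
  "\<exists>g\<in>K - {0}. bij_betw (\<lambda>i. g ^ i) {..<card K - 1} (K - {0})"
proof -
  define R :: "'k ring" where
    "R = \<lparr>carrier = K, monoid.mult = (*), one = 1, ring.zero = 0, add = (+)\<rparr>"
  have "field R"
  proof -
    have "\<exists>y\<in>K. x + y = 0" if "x \<in> K" for x
      using that by (intro bexI[of _ "- x"]) auto
    moreover have "\<exists>y\<in>K. y * x = 1 \<and> x * y = 1" if "x \<in> K" "x \<noteq> 0" for x
      using that by (intro bexI[of _ "inverse x"]) auto
    ultimately show ?thesis
      unfolding R_def
      by unfold_locales (auto simp: algebra_simps Units_def)
  qed
  then interpret F: field R .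
  have pow: "x [^]\<^bsub>R\<^esub> i = x ^ i" for x and i :: nat
    by (induction i) (simp_all add: R_def)
  have "\<exists>a\<in>carrier (Multiplicative_Group.mult_of R). carrier (Multiplicative_Group.mult_of R) = {a [^]\<^bsub>R\<^esub> i | i :: nat. i \<in> UNIV}"
    by (rule F.finite_field_mult_group_has_gen) (simp add: R_def)
  then obtain g where g: "g \<in> K - {0}" and gen: "K - {0} = {g ^ i | i. i \<in> UNIV}"
    unfolding pow by (auto simp: R_def Multiplicative_Group.carrier_mult_of)
  \<comment> \<open>The group order bounds the exponents needed, so the surjection from them is injective.\<close>
  have pm: "g ^ i = g ^ (i mod (card K - 1))" for i
  proof -
    have "g ^ i = g ^ ((card K - 1) * (i div (card K - 1)) + i mod (card K - 1))"
      by simp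
    also have "\<dots> = g ^ (i mod (card K - 1))"
      unfolding power_add power_mult using unit_power[OF g] by simp
    finally show ?thesis .
  qed
  have "(\<lambda>i. g ^ i) ` {..<card K - 1} = K - {0}"
  proof (intro equalityI subsetI)
    fix x assume "x \<in> K - {0}"
    then obtain i where "x = g ^ i"
      using gen by blast
    thus "x \<in> (\<lambda>i. g ^ i) ` {..<card K - 1}"
      using pm[of i] card_gt_1 by (intro image_eqI[of _ _ "i mod (card K - 1)"]) auto
  qed (use g in auto)
  moreover have "inj_on (\<lambda>i. g ^ i) {..<card K - 1}"
    by (rule eq_card_imp_inj_on) (simp_all only: calculation card_units, auto)
  ultimately show ?thesis
    using g by (auto simp: bij_betw_def)
qed

section \<open>Multiplicative characters\<close>

lemma char_mult_eq: "\<eta> \<in> mult_chars K \<Longrightarrow> x \<in> K \<Longrightarrow> y \<in> K \<Longrightarrow> \<eta> (x * y) = \<eta> x * \<eta> y"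
  by (cases "x = 0"; cases "y = 0") (auto simp: mult_chars_def)

lemma char_eq_0_iff: "\<eta> \<in> mult_chars K \<Longrightarrow> \<eta> x = 0 \<longleftrightarrow> x \<notin> K - {0}"
  by (auto simp: mult_chars_def)

lemma char_0 [simp]: "\<eta> \<in> mult_chars K \<Longrightarrow> \<eta> 0 = 0"
  by (simp add: char_eq_0_iff)

lemma char_1 [simp]:
  assumes "\<eta> \<in> mult_chars K" shows "\<eta> 1 = 1"
proof -
  have "\<eta> 1 * \<eta> 1 = \<eta> 1 * 1"
    using char_mult_eq[OF assms, of 1 1] by simp
  thus ?thesis
    using char_eq_0_iff[OF assms, of 1] by (subst (asm) mult_left_cancel) auto
qed

lemma char_power: "\<eta> \<in> mult_chars K \<Longrightarrow> x \<in> K \<Longrightarrow> \<eta> (x ^ k) = \<eta> x ^ k"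
  by (induction k) (auto simp: char_mult_eq)

lemma char_prod_eq:
  "\<eta> \<in> mult_chars K \<Longrightarrow> (\<And>i. i \<in> I \<Longrightarrow> f i \<in> K) \<Longrightarrow> \<eta> (\<Prod>i\<in>I. f i) = (\<Prod>i\<in>I. \<eta> (f i))"
  by (induction I rule: infinite_finite_induct) (auto simp: char_mult_eq prod_in)

lemma char_inverse:
  assumes \<eta>: "\<eta> \<in> mult_chars K" and x: "x \<in> K"
  shows "\<eta> (inverse x) = inverse (\<eta> x)"
proof (cases "x = 0")
  case False
  have "\<eta> x * \<eta> (inverse x) = 1"
    using char_mult_eq[OF \<eta> x inverse_in[OF x]] False \<eta> by simp
  thus ?thesis
    by (metis inverse_unique)
qed (use \<eta> in simp)

lemma char_unit_power: "\<eta> \<in> mult_chars K \<Longrightarrow> x \<in> K - {0} \<Longrightarrow> \<eta> x ^ (card K - 1) = 1"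
  using char_power[of \<eta> x "card K - 1"] unit_power[of x] by simp

lemma char_eqI: "\<eta> \<in> mult_chars K \<Longrightarrow> \<theta> \<in> mult_chars K \<Longrightarrow> (\<And>x. x \<in> K - {0} \<Longrightarrow> \<eta> x = \<theta> x) \<Longrightarrow> \<eta> = \<theta>"
  by (rule ext, rename_tac x, case_tac "x \<in> K - {0}") (auto simp: mult_chars_def)

lemma triv_char_in [simp, intro]: "triv_char K \<in> mult_chars K"
  by (auto simp: mult_chars_def triv_char_def)

lemma char_mult_in [simp, intro]:
  "\<eta> \<in> mult_chars K \<Longrightarrow> \<theta> \<in> mult_chars K \<Longrightarrow> char_mult \<eta> \<theta> \<in> mult_chars K"
  by (auto simp: mult_chars_def char_mult_def)

lemma char_pow_in [simp, intro]:
  "\<eta> \<in> mult_chars K \<Longrightarrow> char_pow \<eta> k \<in> mult_chars K"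
  by (auto simp: mult_chars_def char_pow_def power_int_mult_distrib)

lemma char_prod_in [intro]:
  "(\<And>i. i \<in> I \<Longrightarrow> \<nu> i \<in> mult_chars K) \<Longrightarrow> char_prod K I \<nu> \<in> mult_chars K"
  by (cases "finite I") (auto simp: mult_chars_def char_prod_def triv_char_def prod.distrib)

lemma char_mult_triv [simp]:
  "\<eta> \<in> mult_chars K \<Longrightarrow> char_mult \<eta> (triv_char K) = \<eta>"
  "\<eta> \<in> mult_chars K \<Longrightarrow> char_mult (triv_char K) \<eta> = \<eta>"
  by (auto simp: mult_chars_def char_mult_def triv_char_def fun_eq_iff)

lemma char_mult_inverse [simp]:
  "\<eta> \<in> mult_chars K \<Longrightarrow> char_mult \<eta> (char_pow \<eta> (- 1)) = triv_char K"
  by (auto simp: mult_chars_def char_mult_def char_pow_def triv_char_def fun_eq_iff power_int_minus)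

lemma char_inverse_inverse [simp]:
  "\<eta> \<in> mult_chars K \<Longrightarrow> char_pow (char_pow \<eta> (- 1)) (- 1) = \<eta>"
  by (auto simp: char_pow_def fun_eq_iff power_int_minus)

lemma char_inverse_triv_iff [simp]:
  assumes \<eta>: "\<eta> \<in> mult_chars K"
  shows "char_pow \<eta> (- 1) = triv_char K \<longleftrightarrow> \<eta> = triv_char K"
  using char_mult_inverse[OF \<eta>] char_mult_triv(1)[OF \<eta>] char_mult_inverse[OF triv_char_in]
    char_mult_triv(2)[OF char_pow_in[OF triv_char_in, of "- 1"]] by metis

text \<open>
  Translation by a unit \<open>y\<close> with \<open>\<eta> y \<noteq> 1\<close> multiplies the sum by \<open>\<eta> y\<close>.
\<close>

lemma char_sum_eq_0:
  assumes \<eta>: "\<eta> \<in> mult_chars K" "\<eta> \<noteq> triv_char K"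
  shows "(\<Sum>x\<in>K - {0}. \<eta> x) = 0"
proof -
  obtain y where y: "y \<in> K - {0}" "\<eta> y \<noteq> 1"
    using \<eta> char_eqI[OF \<eta>(1) triv_char_in] by (auto simp: triv_char_def)
  have "(\<Sum>x\<in>K - {0}. \<eta> x) = (\<Sum>x\<in>K - {0}. \<eta> (y * x))"
    by (rule sum.reindex_bij_witness[of _ "\<lambda>x. y * x" "\<lambda>x. x / y"]) (use y in auto)
  also have "\<dots> = \<eta> y * (\<Sum>x\<in>K - {0}. \<eta> x)"
    unfolding sum_distrib_left using y by (intro sum.cong) (auto simp: char_mult_eq[OF \<eta>(1)])
  finally show ?thesis
    using y(2) by (metis mult_cancel_right mult_1)
qed

text \<open>
  A character is determined by its value at a generator, and every root of unity of order
  dividing that of the unit group occurs as a value.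
\<close>

lemma bij_betw_mult_chars:
  assumes g: "g \<in> K - {0}" "bij_betw (\<lambda>i. g ^ i) {..<card K - 1} (K - {0})"
  shows "bij_betw (\<lambda>\<eta>. \<eta> g) (mult_chars K) {\<omega>. \<omega> ^ (card K - 1) = 1}"
proof -
  let ?N = "card K - 1"
  have N: "?N > 0"
    using card_gt_1 by simp
  have ex: "\<exists>i<?N. x = g ^ i" if "x \<in> K - {0}" for x
    using that bij_betw_imp_surj_on[OF g(2)] by (metis imageE lessThan_iff)
  have pm: "h ^ i = h ^ (i mod ?N)" if "h ^ ?N = 1" for h :: "'z::field" and i
  proof -
    have "h ^ i = h ^ (?N * (i div ?N) + i mod ?N)"
      by simp
    also have "\<dots> = h ^ (i mod ?N)"
      unfolding power_add power_mult using that by simp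
    finally show ?thesis .
  qed
  have "inj_on (\<lambda>\<eta>. \<eta> g) (mult_chars K)"
  proof (rule inj_onI)
    fix \<eta> \<theta> assume *: "\<eta> \<in> mult_chars K" "\<theta> \<in> mult_chars K" "\<eta> g = \<theta> g"
    show "\<eta> = \<theta>"
    proof (rule char_eqI[OF *(1,2)])
      fix x assume "x \<in> K - {0}"
      then obtain i where "x = g ^ i"
        using ex by blast
      thus "\<eta> x = \<theta> x"
        using * g(1) by (simp add: char_power)
    qed
  qed
  moreover have "\<omega> \<in> (\<lambda>\<eta>. \<eta> g) ` mult_chars K" if \<omega>: "\<omega> ^ ?N = 1" for \<omega>
  proof -
    define ind where "ind = the_inv_into {..<?N} (\<lambda>i. g ^ i)"
    have ind: "g ^ ind x = x" if "x \<in> K - {0}" for x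
      unfolding ind_def using f_the_inv_into_f_bij_betw[OF g(2)] that by simp
    have key: "\<omega> ^ i = \<omega> ^ j" if "g ^ i = g ^ j" for i j
    proof -
      have "g ^ (i mod ?N) = g ^ (j mod ?N)"
        using that pm[OF unit_power[OF g(1)], of i] pm[OF unit_power[OF g(1)], of j] by simp
      hence "i mod ?N = j mod ?N"
        using bij_betw_imp_inj_on[OF g(2)] N by (auto dest: inj_onD)
      thus ?thesis
        using pm[OF \<omega>, of i] pm[OF \<omega>, of j] by simp
    qed
    define \<eta> where "\<eta> = (\<lambda>x. if x \<in> K - {0} then \<omega> ^ ind x else 0)"
    have "\<omega> \<noteq> 0"
      using \<omega> N by (auto simp: power_0_left)
    have "\<omega> ^ ind (x * y) = \<omega> ^ ind x * \<omega> ^ ind y" if "x \<in> K - {0}" "y \<in> K - {0}" for x y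
      unfolding power_add[symmetric]
      by (rule key) (use that ind in \<open>simp add: power_add\<close>)
    hence "\<eta> \<in> mult_chars K"
      using \<open>\<omega> \<noteq> 0\<close> by (auto simp: mult_chars_def \<eta>_def)
    moreover have "\<eta> g = \<omega>"
      using key[of "ind g" 1] ind[of g] g(1) by (simp add: \<eta>_def)
    ultimately show ?thesis
      by blast
  qed
  ultimately show ?thesis
    using g(1) char_unit_power[of _ g] by (auto simp: bij_betw_def)
qed

lemma finite_mult_chars [simp, intro]: "finite (mult_chars K)"
  and card_mult_chars: "card (mult_chars K) = card K - 1"
proof -
  obtain g where g: "g \<in> K - {0}" "bij_betw (\<lambda>i. g ^ i) {..<card K - 1} (K - {0})"
    using ex_generator by blast
  have "of_nat (card K - 1) \<noteq> (0 :: qbar)"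
    using card_gt_1 by simp
  note * = card_power_eq_alg_closed[OF one_neq_zero this]
  show "finite (mult_chars K)" "card (mult_chars K) = card K - 1"
    using * bij_betw_finite[OF bij_betw_mult_chars[OF g]] bij_betw_same_card[OF bij_betw_mult_chars[OF g]]
    by auto
qed

text \<open>
  If all characters were 1 at \<open>g ^ i\<close>, then all \<open>card K - 1\<close> roots of unity would satisfy
  \<open>\<omega> ^ i = 1\<close>, which has only \<open>i\<close> solutions.
\<close>

lemma ex_char_neq_1:
  assumes x: "x \<in> K - {0}" "x \<noteq> 1"
  shows "\<exists>\<eta>\<in>mult_chars K. \<eta> x \<noteq> 1"
proof (rule ccontr)
  assume neg: "\<not> (\<exists>\<eta>\<in>mult_chars K. \<eta> x \<noteq> 1)"
  obtain g where g: "g \<in> K - {0}" "bij_betw (\<lambda>i. g ^ i) {..<card K - 1} (K - {0})"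
    using ex_generator by blast
  obtain i where i: "i < card K - 1" "x = g ^ i"
    using x(1) bij_betw_imp_surj_on[OF g(2)] by (metis imageE lessThan_iff)
  have i0: "i > 0"
    using i x(2) by (cases i) auto
  have "of_nat (card K - 1) \<noteq> (0 :: qbar)" "of_nat i \<noteq> (0 :: qbar)"
    using card_gt_1 i0 by simp_all
  note * = card_power_eq_alg_closed[OF one_neq_zero this(1)] card_power_eq_alg_closed[OF one_neq_zero this(2)]
  have "{\<omega> :: qbar. \<omega> ^ (card K - 1) = 1} \<subseteq> {\<omega>. \<omega> ^ i = 1}"
  proof
    fix \<omega> :: qbar assume "\<omega> \<in> {\<omega>. \<omega> ^ (card K - 1) = 1}"
    then obtain \<eta> where \<eta>: "\<eta> \<in> mult_chars K" "\<omega> = \<eta> g"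
      using bij_betw_imp_surj_on[OF bij_betw_mult_chars[OF g]] by blast
    have "\<eta> x = 1"
      using neg \<eta>(1) by blast
    thus "\<omega> \<in> {\<omega>. \<omega> ^ i = 1}"
      using \<eta> g(1) by (simp add: i(2) char_power)
  qed
  hence "card K - 1 \<le> i"
    using card_mono[OF *(3)] *(2,4) by metis
  thus False
    using i(1) by simp
qed

text \<open>
  The second orthogonality relation; it is Fourier inversion on the unit group.
\<close>

lemma sum_mult_chars:
  assumes x: "x \<in> K - {0}"
  shows "(\<Sum>\<eta>\<in>mult_chars K. \<eta> x) = (if x = 1 then of_nat (card K) - 1 else 0)"
proof (cases "x = 1")
  case True
  have "(\<Sum>\<eta>\<in>mult_chars K. \<eta> x) = (\<Sum>\<eta>\<in>mult_chars K. 1)"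
    using True by (intro sum.cong) auto
  thus ?thesis
    using True card_gt_1 by (simp add: card_mult_chars of_nat_diff)
next
  case False
  then obtain \<theta> where \<theta>: "\<theta> \<in> mult_chars K" "\<theta> x \<noteq> 1"
    using ex_char_neq_1 x by blast
  have inv: "char_mult \<theta> (char_mult (char_pow \<theta> (- 1)) \<eta>) = \<eta>"
    "char_mult (char_pow \<theta> (- 1)) (char_mult \<theta> \<eta>) = \<eta>" if "\<eta> \<in> mult_chars K" for \<eta>
    using char_mult_triv(2)[OF that] char_mult_inverse[OF \<theta>(1)]
    by (auto simp: char_mult_def fun_eq_iff mult_ac)
  have "(\<Sum>\<eta>\<in>mult_chars K. \<eta> x) = (\<Sum>\<eta>\<in>mult_chars K. char_mult \<theta> \<eta> x)"
    by (rule sum.reindex_bij_witness[of _ "char_mult \<theta>" "char_mult (char_pow \<theta> (- 1))"])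
       (use \<theta> inv in auto)
  also have "\<dots> = \<theta> x * (\<Sum>\<eta>\<in>mult_chars K. \<eta> x)"
    by (simp add: char_mult_def sum_distrib_left)
  finally show ?thesis
    using \<theta>(2) False by (metis mult_cancel_right mult_1)
qed

end

section \<open>Gauss and Jacobi sums\<close>

context finite_subfield
begin

lemma char_inverse_apply: "char_pow \<eta> (- 1) x = inverse (\<eta> x)"
  by (simp add: char_pow_def power_int_minus)

lemma char_mult_apply: "char_mult \<eta> \<theta> x = \<eta> x * \<theta> x"
  by (simp add: char_mult_def)

lemma char_prod_apply: "x \<in> K - {0} \<Longrightarrow> char_prod K I \<nu> x = (\<Prod>i\<in>I. \<nu> i x)"
  by (simp add: char_prod_def triv_char_def)

lemma char_at_minus_1_sq:
  assumes "\<eta> \<in> mult_chars K" shows "\<eta> (- 1) * \<eta> (- 1) = 1"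
  using char_mult_eq[OF assms, of "- 1" "- 1"] assms by simp

lemma char_prod_inverse:
  assumes "\<And>i. i \<in> I \<Longrightarrow> \<nu> i \<in> mult_chars K"
  shows "char_prod K I (\<lambda>i. char_pow (\<nu> i) (- 1)) = char_pow (char_prod K I \<nu>) (- 1)"
proof (rule char_eqI)
  fix x assume "x \<in> K - {0}"
  thus "char_prod K I (\<lambda>i. char_pow (\<nu> i) (- 1)) x = char_pow (char_prod K I \<nu>) (- 1) x"
    by (simp only: char_prod_apply char_inverse_apply prod_inversef[symmetric] comp_def)
qed (use assms in \<open>auto intro!: char_prod_in\<close>)

lemma char_mult_inverse_distrib:
  "char_pow (char_mult \<eta> \<theta>) (- 1) = char_mult (char_pow \<eta> (- 1)) (char_pow \<theta> (- 1))"
  by (auto simp: fun_eq_iff char_inverse_apply char_mult_apply)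

end

locale finite_subfield_add_char = finite_subfield K for K :: "'k::field set" +
  fixes \<psi> :: "'k \<Rightarrow> qbar"
  assumes nontriv: "nontrivial_add_char K \<psi>"
begin

lemma add_char_add: "x \<in> K \<Longrightarrow> y \<in> K \<Longrightarrow> \<psi> (x + y) = \<psi> x * \<psi> y"
  using nontriv by (simp add: nontrivial_add_char_def)

lemma add_char_0 [simp]: "\<psi> 0 = 1"
proof -
  have "\<psi> 0 * \<psi> 0 = \<psi> 0 * 1"
    using add_char_add[of 0 0] by simp
  moreover have "\<psi> 0 \<noteq> 0"
    using nontriv by (simp add: nontrivial_add_char_def)
  ultimately show ?thesis
    by simp
qed

lemma add_char_sum:
  "(\<And>i. i \<in> I \<Longrightarrow> f i \<in> K) \<Longrightarrow> \<psi> (\<Sum>i\<in>I. f i) = (\<Prod>i\<in>I. \<psi> (f i))"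
  by (induction I rule: infinite_finite_induct) (auto simp: add_char_add sum_in)

lemma add_char_sum_eq_0: "(\<Sum>x\<in>K. \<psi> x) = 0"
proof -
  obtain y where y: "y \<in> K" "\<psi> y \<noteq> 1"
    using nontriv by (auto simp: nontrivial_add_char_def)
  have "(\<Sum>x\<in>K. \<psi> x) = (\<Sum>x\<in>K. \<psi> (y + x))"
    by (rule sum.reindex_bij_witness[of _ "\<lambda>x. y + x" "\<lambda>x. x - y"]) (use y in auto)
  also have "\<dots> = \<psi> y * (\<Sum>x\<in>K. \<psi> x)"
    unfolding sum_distrib_left using y by (intro sum.cong) (auto simp: add_char_add)
  finally show ?thesis
    using y(2) by (metis mult_cancel_right mult_1)
qed

lemma add_char_sum_units: "(\<Sum>x\<in>K - {0}. \<psi> x) = - 1"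
  using add_char_sum_eq_0 by (simp add: sum_diff1)

lemma add_char_sum_scaled:
  assumes "t \<in> K - {0}" shows "(\<Sum>x\<in>K - {0}. \<psi> (x * t)) = - 1"
proof -
  have "(\<Sum>x\<in>K - {0}. \<psi> (x * t)) = (\<Sum>x\<in>K - {0}. \<psi> x)"
    by (rule sum.reindex_bij_witness[of _ "\<lambda>x. x / t" "\<lambda>x. x * t"]) (use assms in auto)
  thus ?thesis
    by (simp add: add_char_sum_units)
qed

lemma gauss_triv [simp]: "gauss K \<psi> (triv_char K) = 1"
proof -
  have "(\<Sum>x\<in>K - {0}. \<psi> x * triv_char K x) = (\<Sum>x\<in>K - {0}. \<psi> x)"
    by (intro sum.cong) (auto simp: triv_char_def)
  thus ?thesis
    by (simp add: gauss_def add_char_sum_units)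
qed

lemma gauss_circ_triv [simp]: "gauss_circ K \<psi> (triv_char K) = of_nat (card K)"
  by (simp add: gauss_circ_def char_delta_def)

lemma gauss_circ_nontriv: "\<eta> \<noteq> triv_char K \<Longrightarrow> gauss_circ K \<psi> \<eta> = gauss K \<psi> \<eta>"
  by (simp add: gauss_circ_def char_delta_def)

text \<open>
  The substitution \<open>x = t * y\<close> turns the double sum into a sum of \<open>\<eta> t\<close> times the sum of
  \<open>\<psi> (y * (t + 1))\<close> over the units \<open>y\<close>, and the inner sum is \<open>- 1\<close> except at \<open>t = - 1\<close>.
\<close>

lemma gauss_mult_gauss_inverse:
  assumes \<eta>: "\<eta> \<in> mult_chars K" "\<eta> \<noteq> triv_char K"
  shows "gauss K \<psi> \<eta> * gauss K \<psi> (char_pow \<eta> (- 1)) = \<eta> (- 1) * of_nat (card K)"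
proof -
  let ?U = "K - {0}"
  have "gauss K \<psi> \<eta> * gauss K \<psi> (char_pow \<eta> (- 1)) =
      (\<Sum>y\<in>?U. \<Sum>x\<in>?U. \<psi> (x + y) * \<eta> (x / y))"
    unfolding gauss_def char_inverse_apply minus_mult_minus sum_product
    by (subst sum.swap, intro sum.cong refl)
       (auto simp: add_char_add char_mult_eq[OF \<eta>(1)] char_inverse[OF \<eta>(1)] divide_inverse mult_ac)
  also have "\<dots> = (\<Sum>y\<in>?U. \<Sum>t\<in>?U. \<psi> (y * (t + 1)) * \<eta> t)"
  proof (rule sum.cong[OF refl])
    fix y assume y: "y \<in> ?U"
    show "(\<Sum>x\<in>?U. \<psi> (x + y) * \<eta> (x / y)) = (\<Sum>t\<in>?U. \<psi> (y * (t + 1)) * \<eta> t)"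
      by (rule sum.reindex_bij_witness[of _ "\<lambda>t. t * y" "\<lambda>x. x / y"])
         (use y in \<open>auto simp: distrib_left\<close>)
  qed
  also have "\<dots> = (\<Sum>t\<in>?U. \<eta> t * (\<Sum>y\<in>?U. \<psi> (y * (t + 1))))"
    by (subst sum.swap) (simp add: sum_distrib_left mult_ac)
  also have "\<dots> = (\<Sum>t\<in>?U. \<eta> t * ((if t = - 1 then of_nat (card K) else 0) - 1))"
  proof (rule sum.cong[OF refl])
    fix t assume t: "t \<in> ?U"
    have "(\<Sum>y\<in>?U. \<psi> (y * (t + 1))) = (if t = - 1 then of_nat (card K) else 0) - 1"
    proof (cases "t = - 1")
      case True
      thus ?thesis
        using card_gt_1 by (simp add: card_units of_nat_diff)
    next
      case False
      hence "t + 1 \<in> ?U"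
        using t by (auto simp: eq_neg_iff_add_eq_0)
      thus ?thesis
        using False by (simp add: add_char_sum_scaled)
    qed
    thus "\<eta> t * (\<Sum>y\<in>?U. \<psi> (y * (t + 1))) = \<eta> t * ((if t = - 1 then of_nat (card K) else 0) - 1)"
      by simp
  qed
  also have "\<dots> = (\<Sum>t\<in>?U. if t = - 1 then \<eta> t * of_nat (card K) else 0) - (\<Sum>t\<in>?U. \<eta> t)"
    unfolding sum_subtractf[symmetric] by (intro sum.cong) (auto simp: algebra_simps)
  also have "\<dots> = \<eta> (- 1) * of_nat (card K)"
    using char_sum_eq_0[OF \<eta>] by (simp add: sum.delta)
  finally show ?thesis .
qed

text \<open>
  The factor \<open>card K\<close> of the modified Gauss sum at the trivial character makes the reflection
  formula hold without exception.
\<close>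

lemma gauss_mult_gauss_circ_inverse:
  assumes \<eta>: "\<eta> \<in> mult_chars K"
  shows "gauss K \<psi> \<eta> * gauss_circ K \<psi> (char_pow \<eta> (- 1)) = \<eta> (- 1) * of_nat (card K)"
proof (cases "\<eta> = triv_char K")
  case True
  hence inv: "char_pow \<eta> (- 1) = triv_char K"
    using \<eta> by simp
  have "triv_char K (- 1) = 1"
    by (simp add: triv_char_def)
  thus ?thesis
    unfolding inv unfolding True by simp
next
  case False
  thus ?thesis
    using gauss_mult_gauss_inverse[OF \<eta>] \<eta> by (simp add: gauss_circ_nontriv)
qed

lemma gauss_nonzero [simp]: "\<eta> \<in> mult_chars K \<Longrightarrow> gauss K \<psi> \<eta> \<noteq> 0"
  using gauss_mult_gauss_circ_inverse[of \<eta>] card_gt_1 by (auto simp: char_eq_0_iff)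

lemma gauss_circ_nonzero [simp]: "\<eta> \<in> mult_chars K \<Longrightarrow> gauss_circ K \<psi> \<eta> \<noteq> 0"
  using card_gt_1 by (auto simp: gauss_circ_def)

lemma gauss_inverse_eq:
  assumes \<eta>: "\<eta> \<in> mult_chars K"
  shows "gauss K \<psi> (char_pow \<eta> (- 1)) = \<eta> (- 1) * of_nat (card K) / gauss_circ K \<psi> \<eta>"
proof -
  have "inverse (\<eta> (- 1)) = \<eta> (- 1)"
    using char_at_minus_1_sq[OF \<eta>] by (metis inverse_unique)
  thus ?thesis
    using gauss_mult_gauss_circ_inverse[OF char_pow_in[OF \<eta>, of "- 1"]] \<eta>
    by (simp add: field_simps char_inverse_apply)
qed

lemma gauss_circ_inverse_eq:
  assumes \<eta>: "\<eta> \<in> mult_chars K"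
  shows "gauss_circ K \<psi> (char_pow \<eta> (- 1)) = \<eta> (- 1) * of_nat (card K) / gauss K \<psi> \<eta>"
  using gauss_mult_gauss_circ_inverse[OF \<eta>] \<eta> by (simp add: field_simps)

text \<open>
  The product of the Gauss sums is a sum over all tuples \<open>x\<close> of units, which is sorted by the value
  \<open>s\<close> of the sum of the entries. Scaling \<open>x\<close> reduces the partial sum \<open>J s\<close> for \<open>s \<noteq> 0\<close> to
  \<open>J 1\<close>, which is the Jacobi sum up to sign, and leaves \<open>J 0\<close> to be determined. If the product \<open>\<chi>\<close> of the characters is
  non-trivial, scaling also shows \<open>J 0 = 0\<close>; if \<open>\<chi>\<close> is trivial, \<open>J 0\<close> is read off from the vanishing
  of the sum of all \<open>J s\<close>, which is where some character must be non-trivial.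
\<close>

lemma jacobi_mult_gauss_circ:
  fixes I :: "'i set"
  assumes I: "finite I" "I \<noteq> {}" and \<eta>: "\<And>i. i \<in> I \<Longrightarrow> \<eta> i \<in> mult_chars K"
    and nt: "\<exists>i\<in>I. \<eta> i \<noteq> triv_char K"
  shows "jacobi K I \<eta> * gauss_circ K \<psi> (char_prod K I \<eta>) = (\<Prod>i\<in>I. gauss K \<psi> (\<eta> i))"
proof -
  let ?U = "K - {0}"
  let ?X = "I \<rightarrow>\<^sub>E ?U"
  define \<chi> where "\<chi> = char_prod K I \<eta>"
  have \<chi>: "\<chi> \<in> mult_chars K"
    unfolding \<chi>_def using \<eta> by (rule char_prod_in)
  define J where "J = (\<lambda>s. \<Sum>x\<in>{x \<in> ?X. (\<Sum>i\<in>I. x i) = s}. \<Prod>i\<in>I. \<eta> i (x i))"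
  have finX: "finite ?X"
    using I by (intro finite_PiE) auto
  have sumK: "(\<Sum>i\<in>I. x i) \<in> K" if "x \<in> ?X" for x
    using that by (intro sum_in) auto
  have scale: "J (t * s) = \<chi> t * J s" if t: "t \<in> ?U" for s t
  proof -
    have "J (t * s) = (\<Sum>x\<in>{x \<in> ?X. (\<Sum>i\<in>I. x i) = s}. \<Prod>i\<in>I. \<eta> i (t * x i))"
      unfolding J_def
    proof (rule sum.reindex_bij_witness[of _ "\<lambda>x. \<lambda>i\<in>I. t * x i" "\<lambda>x. \<lambda>i\<in>I. x i / t"], goal_cases)
      case (2 x)
      hence "(\<Sum>i\<in>I. x i / t) = s"
        using t by (simp add: sum_divide_distrib[symmetric])
      thus ?case
        using 2 t by (auto simp: PiE_iff)
    qed (use t in \<open>auto simp: PiE_iff sum_distrib_left[symmetric] extensional_def fun_eq_iff\<close>)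
    also have "\<dots> = (\<Sum>x\<in>{x \<in> ?X. (\<Sum>i\<in>I. x i) = s}. \<chi> t * (\<Prod>i\<in>I. \<eta> i (x i)))"
    proof (rule sum.cong[OF refl])
      fix x assume "x \<in> {x \<in> ?X. (\<Sum>i\<in>I. x i) = s}"
      hence "(\<Prod>i\<in>I. \<eta> i (t * x i)) = (\<Prod>i\<in>I. \<eta> i t * \<eta> i (x i))"
        using t by (intro prod.cong refl char_mult_eq \<eta>) auto
      thus "(\<Prod>i\<in>I. \<eta> i (t * x i)) = \<chi> t * (\<Prod>i\<in>I. \<eta> i (x i))"
        using t by (simp add: prod.distrib \<chi>_def char_prod_apply)
    qed
    finally show ?thesis
      by (simp add: J_def sum_distrib_left)
  qed
  have total: "(\<Sum>s\<in>K. J s * f s) = (\<Sum>x\<in>?X. (\<Prod>i\<in>I. \<eta> i (x i)) * f (\<Sum>i\<in>I. x i))" for f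
  proof -
    have "(\<Sum>s\<in>K. J s * f s) =
        (\<Sum>s\<in>K. \<Sum>x\<in>{x \<in> ?X. (\<Sum>i\<in>I. x i) = s}. (\<Prod>i\<in>I. \<eta> i (x i)) * f (\<Sum>i\<in>I. x i))"
      by (simp add: J_def sum_distrib_right)
    also have "\<dots> = (\<Sum>x\<in>?X. (\<Prod>i\<in>I. \<eta> i (x i)) * f (\<Sum>i\<in>I. x i))"
      by (rule sum.group) (use finX sumK in auto)
    finally show ?thesis .
  qed
  have split: "(\<Sum>s\<in>K. J s * f s) = J 0 * f 0 + J 1 * (\<Sum>s\<in>?U. f s * \<chi> s)" for f
  proof -
    have "(\<Sum>s\<in>K. J s * f s) = J 0 * f 0 + (\<Sum>s\<in>?U. J s * f s)"
      by (rule sum.remove) auto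
    also have "(\<Sum>s\<in>?U. J s * f s) = (\<Sum>s\<in>?U. J 1 * (f s * \<chi> s))"
    proof (rule sum.cong[OF refl])
      fix s assume "s \<in> ?U"
      from scale[OF this, of 1] show "J s * f s = J 1 * (f s * \<chi> s)"
        by simp
    qed
    finally show ?thesis
      by (simp add: sum_distrib_left)
  qed
  have prod_gauss: "(\<Prod>i\<in>I. gauss K \<psi> (\<eta> i)) = (- 1) ^ card I * (J 0 - J 1 * gauss K \<psi> \<chi>)"
  proof -
    have "(\<Prod>i\<in>I. gauss K \<psi> (\<eta> i)) = (- 1) ^ card I * (\<Prod>i\<in>I. \<Sum>x\<in>?U. \<psi> x * \<eta> i x)"
      unfolding gauss_def by (simp add: prod_uminus)
    also have "(\<Prod>i\<in>I. \<Sum>x\<in>?U. \<psi> x * \<eta> i x) = (\<Sum>x\<in>?X. \<Prod>i\<in>I. \<psi> (x i) * \<eta> i (x i))"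
      by (rule prod_sum_PiE) (use I in auto)
    also have "\<dots> = (\<Sum>x\<in>?X. (\<Prod>i\<in>I. \<eta> i (x i)) * \<psi> (\<Sum>i\<in>I. x i))"
      by (intro sum.cong refl, subst add_char_sum) (auto simp: prod.distrib)
    also have "\<dots> = J 0 - J 1 * gauss K \<psi> \<chi>"
      using split[of \<psi>] by (simp add: total gauss_def)
    finally show ?thesis .
  qed
  have jac: "jacobi K I \<eta> = - ((- 1) ^ card I * J 1)"
  proof -
    have "(- 1 :: qbar) ^ card I = - ((- 1) ^ (card I - 1))"
      using I by (cases "card I") auto
    thus ?thesis
      by (simp add: jacobi_def J_def)
  qed
  show ?thesis
  proof (cases "\<chi> = triv_char K")
    case False
    then obtain t where t: "t \<in> ?U" "\<chi> t \<noteq> 1"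
      using char_eqI[OF \<chi> triv_char_in] by (auto simp: triv_char_def)
    have "J 0 = \<chi> t * J 0"
      using scale[OF t(1), of 0] by simp
    hence "J 0 = 0"
      using t(2) by (metis mult_cancel_right mult_1)
    thus ?thesis
      using False by (simp add: prod_gauss jac gauss_circ_nontriv \<chi>_def[symmetric])
  next
    case True
    have "(\<Sum>s\<in>?U. \<chi> s) = of_nat (card K) - 1"
      using True card_gt_1 by (simp add: triv_char_def card_units of_nat_diff)
    hence "J 0 + J 1 * (of_nat (card K) - 1) = (\<Sum>x\<in>?X. \<Prod>i\<in>I. \<eta> i (x i))"
      using split[of "\<lambda>_. 1"] total[of "\<lambda>_. 1"] by simp
    also have "\<dots> = (\<Prod>i\<in>I. \<Sum>x\<in>?U. \<eta> i x)"
      by (rule prod_sum_PiE[symmetric]) (use I in auto)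
    also have "\<dots> = 0"
      using nt \<eta> char_sum_eq_0 I by (intro prod_zero) auto
    finally have J0: "J 0 = - (J 1 * (of_nat (card K) - 1))"
      by (simp add: eq_neg_iff_add_eq_0)
    show ?thesis
      unfolding prod_gauss jac \<chi>_def[symmetric] True J0 by (simp add: algebra_simps)
  qed
qed

text \<open>
  The coordinate \<open>i0\<close> is eliminated by the equation that the coordinates add up to 1. Points with a zero
  coordinate do not contribute because characters are extended by zero.
\<close>

lemma sum_eq_jacobi_insert:
  fixes I :: "'i set"
  assumes I: "finite I" "i0 \<notin> I" and \<eta>: "\<And>i. i \<in> insert i0 I \<Longrightarrow> \<eta> i \<in> mult_chars K"
  shows "(\<Sum>x\<in>I \<rightarrow>\<^sub>E K. \<eta> i0 (1 - (\<Sum>i\<in>I. x i)) * (\<Prod>i\<in>I. \<eta> i (x i))) =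
         (- 1) ^ card I * jacobi K (insert i0 I) \<eta>"
proof -
  let ?f = "\<lambda>x. \<eta> i0 (1 - (\<Sum>i\<in>I. x i)) * (\<Prod>i\<in>I. \<eta> i (x i))"
  have "(\<Sum>x\<in>I \<rightarrow>\<^sub>E K. ?f x) = (\<Sum>x\<in>{x \<in> I \<rightarrow>\<^sub>E K - {0}. 1 - (\<Sum>i\<in>I. x i) \<noteq> 0}. ?f x)"
  proof (rule sum.mono_neutral_right)
    show "finite (I \<rightarrow>\<^sub>E K)"
      using I by (intro finite_PiE) auto
    show "\<forall>x\<in>(I \<rightarrow>\<^sub>E K) - {x \<in> I \<rightarrow>\<^sub>E K - {0}. 1 - (\<Sum>i\<in>I. x i) \<noteq> 0}. ?f x = 0"
    proof
      fix x assume x: "x \<in> (I \<rightarrow>\<^sub>E K) - {x \<in> I \<rightarrow>\<^sub>E K - {0}. 1 - (\<Sum>i\<in>I. x i) \<noteq> 0}"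
      show "?f x = 0"
      proof (cases "1 - (\<Sum>i\<in>I. x i) = 0")
        case True
        thus ?thesis using \<eta> by simp
      next
        case False
        then obtain i where "i \<in> I" "x i = 0"
          using x by (auto simp: PiE_iff)
        hence "(\<Prod>i\<in>I. \<eta> i (x i)) = 0"
          using I \<eta> by (intro prod_zero bexI[of _ i]) auto
        thus ?thesis by simp
      qed
    qed
  qed (auto simp: PiE_iff extensional_def)
  also have "\<dots> = (\<Sum>x\<in>{x \<in> insert i0 I \<rightarrow>\<^sub>E K - {0}. (\<Sum>i\<in>insert i0 I. x i) = 1}.
                   \<Prod>i\<in>insert i0 I. \<eta> i (x i))"
  proof (rule sum.reindex_bij_witness[of _ "\<lambda>x. restrict x I" "\<lambda>x. x(i0 := 1 - (\<Sum>i\<in>I. x i))"], goal_cases)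
    case (1 x)
    thus ?case
      using I by (auto simp: fun_eq_iff PiE_iff extensional_def)
  next
    case (2 x)
    have *: "(\<Sum>i\<in>I. (x(i0 := c)) i) = (\<Sum>i\<in>I. x i)" for c
      using I by (intro sum.cong) auto
    have "1 - (\<Sum>i\<in>I. x i) \<in> K"
      using 2 by (intro diff_in sum_in one_in) auto
    thus ?case
      using 2 I * by (auto simp: PiE_iff extensional_def)
  next
    case (3 x)
    thus ?case
      using I by (auto simp: fun_eq_iff PiE_iff extensional_def algebra_simps)
  next
    case (4 x)
    thus ?case
      using I by (auto simp: PiE_iff algebra_simps)
  next
    case (5 x)
    have "(\<Prod>i\<in>I. \<eta> i ((x(i0 := c)) i)) = (\<Prod>i\<in>I. \<eta> i (x i))" for c
      using I by (intro prod.cong) auto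
    thus ?case
      using I by simp
  qed
  also have "\<dots> = (- 1) ^ card I * jacobi K (insert i0 I) \<eta>"
    using I by (simp add: jacobi_def power_mult_distrib[symmetric] mult.assoc[symmetric])
  finally show ?thesis .
qed

lemma char_prod_insert:
  assumes I: "finite I" "i0 \<notin> I"
  shows "char_prod K (insert i0 I) \<eta> = char_mult (\<eta> i0) (char_prod K I \<eta>)"
  using I by (auto simp: char_prod_def char_mult_def fun_eq_iff)

lemma jacobi_insert_eq:
  assumes I: "finite I" "i0 \<notin> I" and \<eta>: "\<And>i. i \<in> insert i0 I \<Longrightarrow> \<eta> i \<in> mult_chars K"
    and nt: "\<eta> i0 \<noteq> triv_char K"
  shows "jacobi K (insert i0 I) \<eta> = gauss K \<psi> (\<eta> i0) * (\<Prod>i\<in>I. gauss K \<psi> (\<eta> i)) /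
           gauss_circ K \<psi> (char_mult (\<eta> i0) (char_prod K I \<eta>))"
proof -
  have eq: "char_mult (\<eta> i0) (char_prod K I \<eta>) = char_prod K (insert i0 I) \<eta>"
    using char_prod_insert[OF I] by simp
  have "char_prod K (insert i0 I) \<eta> \<in> mult_chars K"
    using \<eta> by (intro char_prod_in)
  thus ?thesis
    using jacobi_mult_gauss_circ[of "insert i0 I" \<eta>] I \<eta> nt
    by (simp add: eq field_simps)
qed

lemma jacobi2_eq:
  assumes "\<eta> \<in> mult_chars K" "\<theta> \<in> mult_chars K" "\<theta> \<noteq> triv_char K"
  shows "jacobi2 K \<eta> \<theta> = gauss K \<psi> \<eta> * gauss K \<psi> \<theta> / gauss_circ K \<psi> (char_mult \<eta> \<theta>)"
proof -
  have "char_prod K {0::nat} (\<lambda>i. if i = 0 then \<eta> else \<theta>) = \<eta>"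
    using assms(1) by (auto simp: char_prod_def triv_char_def fun_eq_iff mult_chars_def)
  moreover have "{0, 1 :: nat} = insert 1 {0}"
    by auto
  ultimately show ?thesis
    using jacobi_insert_eq[of "{0::nat}" 1 "\<lambda>i. if i = 0 then \<eta> else \<theta>"] assms
    by (simp add: jacobi2_def mult.commute char_mult_def)
qed

lemma sum_eq_jacobi2:
  assumes "\<eta> \<in> mult_chars K" "\<theta> \<in> mult_chars K"
  shows "(\<Sum>x\<in>K. \<eta> x * \<theta> (1 - x)) = - jacobi2 K \<eta> \<theta>"
proof -
  have "{0, 1 :: nat} = insert 1 {0}"
    by auto
  moreover have "(\<Sum>x\<in>K. \<eta> x * \<theta> (1 - x)) =
      (\<Sum>x\<in>{0::nat} \<rightarrow>\<^sub>E K. \<theta> (1 - (\<Sum>i\<in>{0::nat}. x i)) * (\<Prod>i\<in>{0::nat}. \<eta> (x i)))"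
    by (rule sum.reindex_bij_witness[of _ "\<lambda>x. x 0" "\<lambda>x. \<lambda>i\<in>{0}. x"])
       (auto simp: fun_eq_iff PiE_iff extensional_def)
  ultimately show ?thesis
    using sum_eq_jacobi_insert[of "{0::nat}" 1 "\<lambda>i. if i = 0 then \<eta> else \<theta>"] assms
    by (simp add: jacobi2_def)
qed

lemma poch_circ_triv:
  "\<nu> \<in> mult_chars K \<Longrightarrow> poch_circ K \<psi> (triv_char K) \<nu> = gauss_circ K \<psi> \<nu> / of_nat (card K)"
  by (simp add: poch_circ_def)

text \<open>
  The right-hand side is a Fourier coefficient of \<open>y \<mapsto> \<alpha> (1 - \<Sum> y)\<close> and hence a Jacobi sum; the reflection
  formula moves the characters \<open>\<nu> i\<close>, which enter as inverses, to the other side of the fraction.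
\<close>

lemma binomial_coefficient:
  fixes I :: "nat set"
  assumes I: "finite I" "0 \<notin> I" and \<alpha>: "\<alpha> \<in> mult_chars K" "\<alpha> \<noteq> triv_char K"
    and \<nu>: "\<And>i. i \<in> I \<Longrightarrow> \<nu> i \<in> mult_chars K"
  shows "poch K \<psi> (char_pow \<alpha> (- 1)) (char_prod K I \<nu>) / (\<Prod>i\<in>I. poch_circ K \<psi> (triv_char K) (\<nu> i)) =
    (- 1) ^ card I * (\<Sum>y\<in>I \<rightarrow>\<^sub>E K. \<alpha> (1 - (\<Sum>i\<in>I. y i)) * (\<Prod>i\<in>I. char_pow (\<nu> i) (- 1) (y i)))"
proof -
  define \<eta> where "\<eta> = (\<lambda>i. if i = 0 then \<alpha> else char_pow (\<nu> i) (- 1))"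
  define \<beta> where "\<beta> = char_pow \<alpha> (- 1)"
  define N where "N = char_prod K I \<nu>"
  define q :: qbar where "q = of_nat (card K)"
  have \<eta>: "\<eta> i \<in> mult_chars K" if "i \<in> insert 0 I" for i
    using that \<alpha> \<nu> by (auto simp: \<eta>_def)
  have \<beta>: "\<beta> \<in> mult_chars K"
    using \<alpha> by (simp add: \<beta>_def)
  have N: "N \<in> mult_chars K"
    unfolding N_def using \<nu> by (rule char_prod_in)
  have q0: "q \<noteq> 0"
    using card_gt_1 by (auto simp: q_def)
  have \<eta>I: "\<eta> i = char_pow (\<nu> i) (- 1)" if "i \<in> I" for i
    using that I by (auto simp: \<eta>_def)
  have prodI: "char_prod K I \<eta> = char_pow N (- 1)"
    unfolding N_def using char_prod_inverse[of I \<nu>] \<nu> by (simp add: char_prod_def \<eta>I)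
  have inv: "char_mult \<alpha> (char_pow N (- 1)) = char_pow (char_mult \<beta> N) (- 1)"
    using \<alpha> by (simp add: char_mult_inverse_distrib \<beta>_def)
  have "(\<Sum>y\<in>I \<rightarrow>\<^sub>E K. \<alpha> (1 - (\<Sum>i\<in>I. y i)) * (\<Prod>i\<in>I. char_pow (\<nu> i) (- 1) (y i))) =
      (- 1) ^ card I * jacobi K (insert 0 I) \<eta>"
    using sum_eq_jacobi_insert[of I 0 \<eta>] I \<eta> by (simp add: \<eta>I, simp add: \<eta>_def)
  also have "jacobi K (insert 0 I) \<eta> = gauss K \<psi> \<alpha> * (\<Prod>i\<in>I. gauss K \<psi> (char_pow (\<nu> i) (- 1))) /
      gauss_circ K \<psi> (char_pow (char_mult \<beta> N) (- 1))"
    using jacobi_insert_eq[of I 0 \<eta>] I \<eta> \<alpha> by (simp add: \<eta>I prodI, simp add: \<eta>_def inv)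
  also have "gauss K \<psi> \<alpha> = \<beta> (- 1) * q / gauss K \<psi> \<beta>"
    using gauss_inverse_eq[OF \<beta>] \<alpha> by (simp add: q_def \<beta>_def gauss_circ_nontriv)
  also have "(\<Prod>i\<in>I. gauss K \<psi> (char_pow (\<nu> i) (- 1))) = N (- 1) / (\<Prod>i\<in>I. poch_circ K \<psi> (triv_char K) (\<nu> i))"
    by (simp add: gauss_inverse_eq poch_circ_triv \<nu> N_def char_prod_apply prod_dividef q_def prod.distrib)
  also have "gauss_circ K \<psi> (char_pow (char_mult \<beta> N) (- 1)) =
      \<beta> (- 1) * N (- 1) * q / gauss K \<psi> (char_mult \<beta> N)"
    using gauss_circ_inverse_eq[of "char_mult \<beta> N"] \<beta> N by (simp add: q_def char_mult_apply)
  also have "\<beta> (- 1) * q / gauss K \<psi> \<beta> * (N (- 1) / (\<Prod>i\<in>I. poch_circ K \<psi> (triv_char K) (\<nu> i))) /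
      (\<beta> (- 1) * N (- 1) * q / gauss K \<psi> (char_mult \<beta> N)) =
      poch K \<psi> \<beta> N / (\<Prod>i\<in>I. poch_circ K \<psi> (triv_char K) (\<nu> i))"
    using q0 \<beta> N char_eq_0_iff[OF \<beta>, of "- 1"] char_eq_0_iff[OF N, of "- 1"]
    by (simp add: poch_def)
  finally show ?thesis
    by (simp add: \<beta>_def N_def mult.assoc[symmetric] power_mult_distrib[symmetric])
qed

text \<open>
  The finite field analogue of the multinomial series of \<open>(1 - (x 1 + \<dots> + x n))\<close> raised to the power \<open>- a\<close>, with the
  inverse of \<open>\<alpha>\<close> in the role of \<open>a\<close>. It is Fourier inversion with the coefficients just computed. The index 0 has to be
  free because it serves as the additional coordinate of the Jacobi sum.
\<close>

lemma binomial_expansion: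
  fixes I :: "nat set"
  assumes I: "finite I" "0 \<notin> I" and \<alpha>: "\<alpha> \<in> mult_chars K" "\<alpha> \<noteq> triv_char K"
    and x: "\<And>i. i \<in> I \<Longrightarrow> x i \<in> K - {0}"
  shows "\<alpha> (1 - (\<Sum>i\<in>I. x i)) = 1 / (1 - of_nat (card K)) ^ card I *
    (\<Sum>\<nu>\<in>I \<rightarrow>\<^sub>E mult_chars K. poch K \<psi> (char_pow \<alpha> (- 1)) (char_prod K I \<nu>) /
      (\<Prod>i\<in>I. poch_circ K \<psi> (triv_char K) (\<nu> i)) * (\<Prod>i\<in>I. \<nu> i (x i)))"
proof -
  define q :: qbar where "q = of_nat (card K)"
  have q1: "1 - q \<noteq> 0"
    using card_gt_1 by (auto simp: q_def)
  have orth: "(\<Sum>\<nu>\<in>mult_chars K. char_pow \<nu> (- 1) y * \<nu> z) = (if y = z then q - 1 else 0)"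
    if "y \<in> K" "z \<in> K - {0}" for y z
  proof (cases "y = 0")
    case True
    thus ?thesis
      using that by (auto simp: char_inverse_apply)
  next
    case False
    have "(\<Sum>\<nu>\<in>mult_chars K. char_pow \<nu> (- 1) y * \<nu> z) = (\<Sum>\<nu>\<in>mult_chars K. \<nu> (inverse y * z))"
      using that by (intro sum.cong) (auto simp: char_inverse_apply char_mult_eq char_inverse)
    also have "\<dots> = (if inverse y * z = 1 then q - 1 else 0)"
      using sum_mult_chars[of "inverse y * z"] that False by (simp add: q_def)
    also have "inverse y * z = 1 \<longleftrightarrow> y = z"
      using False by (auto simp: field_simps)
    finally show ?thesis .
  qed
  have finK: "finite (I \<rightarrow>\<^sub>E K)"
    using I by (intro finite_PiE) auto
  define xr where "xr = restrict x I"
  have xr: "xr \<in> I \<rightarrow>\<^sub>E K"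
    using x by (auto simp: xr_def)
  have "(\<Sum>\<nu>\<in>I \<rightarrow>\<^sub>E mult_chars K. poch K \<psi> (char_pow \<alpha> (- 1)) (char_prod K I \<nu>) /
      (\<Prod>i\<in>I. poch_circ K \<psi> (triv_char K) (\<nu> i)) * (\<Prod>i\<in>I. \<nu> i (x i))) =
    (\<Sum>\<nu>\<in>I \<rightarrow>\<^sub>E mult_chars K. \<Sum>y\<in>I \<rightarrow>\<^sub>E K. (- 1) ^ card I * (\<alpha> (1 - (\<Sum>i\<in>I. y i)) *
       (\<Prod>i\<in>I. char_pow (\<nu> i) (- 1) (y i) * \<nu> i (x i))))"
  proof (rule sum.cong[OF refl])
    fix \<nu> assume "\<nu> \<in> I \<rightarrow>\<^sub>E mult_chars K"
    hence "\<nu> i \<in> mult_chars K" if "i \<in> I" for i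
      using that by auto
    from binomial_coefficient[OF I \<alpha> this]
    show "poch K \<psi> (char_pow \<alpha> (- 1)) (char_prod K I \<nu>) /
      (\<Prod>i\<in>I. poch_circ K \<psi> (triv_char K) (\<nu> i)) * (\<Prod>i\<in>I. \<nu> i (x i)) =
      (\<Sum>y\<in>I \<rightarrow>\<^sub>E K. (- 1) ^ card I * (\<alpha> (1 - (\<Sum>i\<in>I. y i)) *
       (\<Prod>i\<in>I. char_pow (\<nu> i) (- 1) (y i) * \<nu> i (x i))))"
      by (simp add: sum_distrib_left sum_distrib_right prod.distrib mult_ac)
  qed
  also have "\<dots> = (\<Sum>y\<in>I \<rightarrow>\<^sub>E K. (- 1) ^ card I * (\<alpha> (1 - (\<Sum>i\<in>I. y i)) *
      (\<Sum>\<nu>\<in>I \<rightarrow>\<^sub>E mult_chars K. \<Prod>i\<in>I. char_pow (\<nu> i) (- 1) (y i) * \<nu> i (x i))))"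
    by (subst sum.swap) (simp add: sum_distrib_left)
  also have "\<dots> = (\<Sum>y\<in>I \<rightarrow>\<^sub>E K. if y = xr then (- 1) ^ card I * (\<alpha> (1 - (\<Sum>i\<in>I. x i)) * (q - 1) ^ card I) else 0)"
  proof (rule sum.cong[OF refl])
    fix y assume y: "y \<in> I \<rightarrow>\<^sub>E K"
    have "(\<Sum>\<nu>\<in>I \<rightarrow>\<^sub>E mult_chars K. \<Prod>i\<in>I. char_pow (\<nu> i) (- 1) (y i) * \<nu> i (x i)) =
        (\<Prod>i\<in>I. \<Sum>\<nu>\<in>mult_chars K. char_pow \<nu> (- 1) (y i) * \<nu> (x i))"
      by (rule prod_sum_PiE[symmetric]) (use I in auto)
    also have "\<dots> = (\<Prod>i\<in>I. if y i = x i then q - 1 else 0)"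
      using y x by (intro prod.cong refl orth) auto
    also have "\<dots> = (if y = xr then (q - 1) ^ card I else 0)"
    proof (cases "y = xr")
      case False
      then obtain i where "i \<in> I" "y i \<noteq> x i"
        using PiE_ext[OF y xr] by (auto simp: xr_def)
      hence "(\<Prod>i\<in>I. if y i = x i then q - 1 else 0) = 0"
        using I by (intro prod_zero) auto
      thus ?thesis using False by simp
    qed (simp add: xr_def)
    finally have *: "(\<Sum>\<nu>\<in>I \<rightarrow>\<^sub>E mult_chars K. \<Prod>i\<in>I. char_pow (\<nu> i) (- 1) (y i) * \<nu> i (x i)) =
      (if y = xr then (q - 1) ^ card I else 0)" .
    show "(- 1) ^ card I * (\<alpha> (1 - (\<Sum>i\<in>I. y i)) *
        (\<Sum>\<nu>\<in>I \<rightarrow>\<^sub>E mult_chars K. \<Prod>i\<in>I. char_pow (\<nu> i) (- 1) (y i) * \<nu> i (x i))) =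
      (if y = xr then (- 1) ^ card I * (\<alpha> (1 - (\<Sum>i\<in>I. x i)) * (q - 1) ^ card I) else 0)"
      unfolding * by (simp add: xr_def)
  qed
  also have "\<dots> = (- 1) ^ card I * (\<alpha> (1 - (\<Sum>i\<in>I. x i)) * (q - 1) ^ card I)"
    using finK xr by simp
  also have "\<dots> = \<alpha> (1 - (\<Sum>i\<in>I. x i)) * (1 - q) ^ card I"
    by (simp add: mult_ac power_mult_distrib[symmetric])
  finally show ?thesis
    using q1 by (simp add: q_def field_simps)
qed

lemma binomial_expansion_1:
  assumes \<alpha>: "\<alpha> \<in> mult_chars K" "\<alpha> \<noteq> triv_char K" and x: "x \<in> K - {0}"
  shows "\<alpha> (1 - x) = 1 / (1 - of_nat (card K)) *
    (\<Sum>\<nu>\<in>mult_chars K. poch K \<psi> (char_pow \<alpha> (- 1)) \<nu> / poch_circ K \<psi> (triv_char K) \<nu> * \<nu> x)"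
proof -
  have cp: "char_prod K {1::nat} \<nu> = \<nu> 1" if "\<nu> 1 \<in> mult_chars K" for \<nu>
    using that by (auto simp: char_prod_def triv_char_def fun_eq_iff mult_chars_def)
  have "(\<Sum>\<nu>\<in>mult_chars K. poch K \<psi> (char_pow \<alpha> (- 1)) \<nu> / poch_circ K \<psi> (triv_char K) \<nu> * \<nu> x) =
    (\<Sum>\<nu>\<in>{1::nat} \<rightarrow>\<^sub>E mult_chars K. poch K \<psi> (char_pow \<alpha> (- 1)) (char_prod K {1} \<nu>) /
      (\<Prod>i\<in>{1}. poch_circ K \<psi> (triv_char K) (\<nu> i)) * (\<Prod>i\<in>{1}. \<nu> i x))"
    by (rule sum.reindex_bij_witness[of _ "\<lambda>x. x 1" "\<lambda>x. \<lambda>i\<in>{1}. x"])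
       (auto simp: fun_eq_iff PiE_iff extensional_def cp[simplified])
  thus ?thesis
    using binomial_expansion[of "{1}" \<alpha> "\<lambda>_. x"] assms by simp
qed

end

section \<open>Character sums as Lauricella functions\<close>

context finite_subfield_add_char
begin

lemma poch_inverse:
  assumes "\<eta> \<in> mult_chars K" "\<nu> \<in> mult_chars K"
  shows "poch K \<psi> \<eta> (char_pow \<nu> (- 1)) = \<nu> (- 1) / poch_circ K \<psi> (char_pow \<eta> (- 1)) \<nu>"
proof -
  define \<theta> where "\<theta> = char_pow \<eta> (- 1)"
  have \<theta>: "\<theta> \<in> mult_chars K" "\<eta> = char_pow \<theta> (- 1)"
    using assms by (simp_all add: \<theta>_def)
  have "char_mult \<eta> (char_pow \<nu> (- 1)) = char_pow (char_mult \<theta> \<nu>) (- 1)"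
    using \<theta> by (simp add: char_mult_inverse_distrib)
  thus ?thesis
    using \<theta>(1) assms(2) card_gt_1 char_eq_0_iff[OF \<theta>(1), of "- 1"]
    unfolding \<theta>_def[symmetric] poch_def poch_circ_def
    by (auto simp: \<theta>(2) gauss_inverse_eq char_mult_apply)
qed

lemma poch_circ_inverse:
  assumes "\<eta> \<in> mult_chars K" "\<nu> \<in> mult_chars K"
  shows "poch_circ K \<psi> \<eta> (char_pow \<nu> (- 1)) = \<nu> (- 1) / poch K \<psi> (char_pow \<eta> (- 1)) \<nu>"
proof -
  define \<theta> where "\<theta> = char_pow \<eta> (- 1)"
  have \<theta>: "\<theta> \<in> mult_chars K" "\<eta> = char_pow \<theta> (- 1)"
    using assms by (simp_all add: \<theta>_def)
  have "char_mult \<eta> (char_pow \<nu> (- 1)) = char_pow (char_mult \<theta> \<nu>) (- 1)"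
    using \<theta> by (simp add: char_mult_inverse_distrib)
  thus ?thesis
    using \<theta>(1) assms(2) card_gt_1 char_eq_0_iff[OF \<theta>(1), of "- 1"]
    unfolding \<theta>_def[symmetric] poch_def poch_circ_def
    by (auto simp: \<theta>(2) gauss_circ_inverse_eq char_mult_apply)
qed

lemma jacobi2_shift:
  assumes "\<beta> \<in> mult_chars K" "\<delta> \<in> mult_chars K" "\<delta> \<noteq> triv_char K" "\<nu> \<in> mult_chars K"
  shows "jacobi2 K (char_mult \<beta> \<nu>) \<delta> =
    jacobi2 K \<beta> \<delta> * poch K \<psi> \<beta> \<nu> / poch_circ K \<psi> (char_mult \<beta> \<delta>) \<nu>"
proof -
  have "char_mult (char_mult \<beta> \<nu>) \<delta> = char_mult (char_mult \<beta> \<delta>) \<nu>"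
    by (auto simp: char_mult_def fun_eq_iff mult_ac)
  thus ?thesis
    using assms by (simp add: jacobi2_eq poch_def poch_circ_def)
qed

text \<open>
  Twisting the arguments of a Jacobi sum by \<open>\<nu>\<close> multiplies it by a quotient of Pochhammer symbols; this
  is how the remaining parameters of the Lauricella functions arise.
\<close>

lemma jacobi_shift:
  fixes I :: "nat set"
  assumes I: "finite I" "0 \<notin> I" and \<gamma>: "\<gamma> \<in> mult_chars K" "\<gamma> \<noteq> triv_char K"
    and \<beta>: "\<And>i. i \<in> I \<Longrightarrow> \<beta> i \<in> mult_chars K" and \<nu>: "\<And>i. i \<in> I \<Longrightarrow> \<nu> i \<in> mult_chars K"
  shows "(\<Sum>x\<in>I \<rightarrow>\<^sub>E K. \<gamma> (1 - (\<Sum>i\<in>I. x i)) * (\<Prod>i\<in>I. \<beta> i (x i) * \<nu> i (x i))) =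
    (- 1) ^ card I * jacobi K (insert 0 I) (\<lambda>i. if i = 0 then \<gamma> else \<beta> i) *
      (\<Prod>i\<in>I. poch K \<psi> (\<beta> i) (\<nu> i)) / poch_circ K \<psi> (char_mult \<gamma> (char_prod K I \<beta>)) (char_prod K I \<nu>)"
proof -
  define \<eta> where "\<eta> = (\<lambda>i. if i = 0 then \<gamma> else \<beta> i)"
  define \<theta> where "\<theta> = (\<lambda>i. if i = 0 then \<gamma> else char_mult (\<beta> i) (\<nu> i))"
  have nz: "i \<noteq> 0" if "i \<in> I" for i
    using that I(2) by metis
  have \<eta>0: "\<eta> 0 = \<gamma>" "\<theta> 0 = \<gamma>" "\<And>i. i \<in> I \<Longrightarrow> \<eta> i = \<beta> i" "\<And>i. i \<in> I \<Longrightarrow> \<theta> i = char_mult (\<beta> i) (\<nu> i)"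
    using nz by (auto simp: \<eta>_def \<theta>_def)
  have \<eta>: "\<eta> i \<in> mult_chars K" and \<theta>: "\<theta> i \<in> mult_chars K" if "i \<in> insert 0 I" for i
    using that \<gamma> \<beta> \<nu> by (auto simp: \<eta>0)
  have cp: "char_prod K I \<eta> = char_prod K I \<beta>"
    "char_prod K I \<theta> = char_mult (char_prod K I \<beta>) (char_prod K I \<nu>)"
    by (auto simp: char_prod_def char_mult_def fun_eq_iff triv_char_def \<eta>0 prod.distrib)
  have ch: "char_prod K I \<beta> \<in> mult_chars K" "char_prod K I \<nu> \<in> mult_chars K"
    using \<beta> \<nu> by (auto intro!: char_prod_in)
  have assoc: "char_mult \<gamma> (char_mult (char_prod K I \<beta>) (char_prod K I \<nu>)) =
      char_mult (char_mult \<gamma> (char_prod K I \<beta>)) (char_prod K I \<nu>)"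
    by (auto simp: char_mult_def fun_eq_iff mult_ac)
  have "(\<Sum>x\<in>I \<rightarrow>\<^sub>E K. \<gamma> (1 - (\<Sum>i\<in>I. x i)) * (\<Prod>i\<in>I. \<beta> i (x i) * \<nu> i (x i))) =
      (- 1) ^ card I * jacobi K (insert 0 I) \<theta>"
    using sum_eq_jacobi_insert[OF I, of \<theta>] \<theta> by (simp add: \<eta>0 char_mult_apply)
  also have "jacobi K (insert 0 I) \<theta> = gauss K \<psi> \<gamma> * (\<Prod>i\<in>I. gauss K \<psi> (char_mult (\<beta> i) (\<nu> i))) /
      gauss_circ K \<psi> (char_mult (char_mult \<gamma> (char_prod K I \<beta>)) (char_prod K I \<nu>))"
    using jacobi_insert_eq[OF I, of \<theta>] \<theta> \<gamma> by (simp add: \<eta>0 cp assoc)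
  also have "\<dots> = jacobi K (insert 0 I) \<eta> * (\<Prod>i\<in>I. poch K \<psi> (\<beta> i) (\<nu> i)) /
      poch_circ K \<psi> (char_mult \<gamma> (char_prod K I \<beta>)) (char_prod K I \<nu>)"
  proof -
    have "(\<Prod>i\<in>I. gauss K \<psi> (\<beta> i)) \<noteq> 0"
      using I \<beta> by simp
    thus ?thesis
      using jacobi_insert_eq[OF I, of \<eta>] \<eta> \<gamma> ch
      by (simp add: \<eta>0 cp poch_def poch_circ_def prod_dividef)
  qed
  finally show ?thesis
    by (simp add: \<eta>_def mult.assoc)
qed

lemma prod_binomial_expansion:
  fixes I :: "nat set"
  assumes I: "finite I" and \<delta>: "\<And>i. i \<in> I \<Longrightarrow> \<delta> i \<in> mult_chars K" "\<And>i. i \<in> I \<Longrightarrow> \<delta> i \<noteq> triv_char K"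
    and z: "\<And>i. i \<in> I \<Longrightarrow> z i \<in> K - {0}"
  shows "(\<Prod>i\<in>I. \<delta> i (1 - z i)) = 1 / (1 - of_nat (card K)) ^ card I *
    (\<Sum>\<nu>\<in>I \<rightarrow>\<^sub>E mult_chars K. (\<Prod>i\<in>I. poch K \<psi> (char_pow (\<delta> i) (- 1)) (\<nu> i)) /
      (\<Prod>i\<in>I. poch_circ K \<psi> (triv_char K) (\<nu> i)) * (\<Prod>i\<in>I. \<nu> i (z i)))"
proof -
  have "(\<Prod>i\<in>I. \<delta> i (1 - z i)) = (\<Prod>i\<in>I. 1 / (1 - of_nat (card K)) *
    (\<Sum>\<nu>\<in>mult_chars K. poch K \<psi> (char_pow (\<delta> i) (- 1)) \<nu> / poch_circ K \<psi> (triv_char K) \<nu> * \<nu> (z i)))"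
    using \<delta> z by (intro prod.cong refl binomial_expansion_1) auto
  also have "\<dots> = 1 / (1 - of_nat (card K)) ^ card I * (\<Prod>i\<in>I.
    (\<Sum>\<nu>\<in>mult_chars K. poch K \<psi> (char_pow (\<delta> i) (- 1)) \<nu> / poch_circ K \<psi> (triv_char K) \<nu> * \<nu> (z i)))"
    by (simp add: prod.distrib prod_dividef)
  also have "(\<Prod>i\<in>I.
    (\<Sum>\<nu>\<in>mult_chars K. poch K \<psi> (char_pow (\<delta> i) (- 1)) \<nu> / poch_circ K \<psi> (triv_char K) \<nu> * \<nu> (z i))) =
    (\<Sum>\<nu>\<in>I \<rightarrow>\<^sub>E mult_chars K. \<Prod>i\<in>I. poch K \<psi> (char_pow (\<delta> i) (- 1)) (\<nu> i) / poch_circ K \<psi> (triv_char K) (\<nu> i) * \<nu> i (z i))"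
    by (rule prod_sum_PiE) (use I in auto)
  finally show ?thesis
    by (simp add: prod.distrib prod_dividef)
qed

text \<open>
  Only the first factor is expanded; afterwards the sum over \<open>x\<close> is a product of \<open>n\<close> binary
  Jacobi sums.
\<close>

proposition sum_eq_lauricella_A:
  assumes \<alpha>: "\<alpha> \<in> mult_chars K" "\<alpha> \<noteq> triv_char K"
    and \<beta>: "\<And>i. i \<in> {1..n} \<Longrightarrow> \<beta> i \<in> mult_chars K"
    and \<delta>: "\<And>i. i \<in> {1..n} \<Longrightarrow> \<delta> i \<in> mult_chars K" "\<And>i. i \<in> {1..n} \<Longrightarrow> \<delta> i \<noteq> triv_char K"
    and l: "\<And>i. i \<in> {1..n} \<Longrightarrow> l i \<in> K - {0}"
  shows "(\<Sum>x\<in>{1..n} \<rightarrow>\<^sub>E K. \<alpha> (1 - (\<Sum>i=1..n. l i * x i)) * (\<Prod>i=1..n. \<beta> i (x i) * \<delta> i (1 - x i))) =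
    (\<Prod>i=1..n. - jacobi2 K (\<beta> i) (\<delta> i)) *
      lauricella_A K \<psi> n (char_pow \<alpha> (- 1)) \<beta> (\<lambda>i. char_mult (\<beta> i) (\<delta> i)) l"
proof -
  let ?I = "{1..n}"
  let ?C = "\<lambda>\<nu>. poch K \<psi> (char_pow \<alpha> (- 1)) (char_prod K ?I \<nu>) /
      (\<Prod>i\<in>?I. poch_circ K \<psi> (triv_char K) (\<nu> i))"
  let ?q = "1 / (1 - of_nat (card K)) ^ n :: qbar"
  have I: "finite ?I" "0 \<notin> ?I"
    by auto
  have "(\<Sum>x\<in>?I \<rightarrow>\<^sub>E K. \<alpha> (1 - (\<Sum>i\<in>?I. l i * x i)) * (\<Prod>i\<in>?I. \<beta> i (x i) * \<delta> i (1 - x i))) =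
    (\<Sum>x\<in>?I \<rightarrow>\<^sub>E K. \<Sum>\<nu>\<in>?I \<rightarrow>\<^sub>E mult_chars K. ?q * (?C \<nu> * (\<Prod>i\<in>?I. \<nu> i (l i)) *
      (\<Prod>i\<in>?I. char_mult (\<beta> i) (\<nu> i) (x i) * \<delta> i (1 - x i))))"
  proof (rule sum.cong[OF refl])
    fix x assume x: "x \<in> ?I \<rightarrow>\<^sub>E K"
    have \<nu>: "(\<Prod>i\<in>?I. \<nu> i (l i * x i)) = (\<Prod>i\<in>?I. \<nu> i (l i) * \<nu> i (x i))"
      if "\<nu> \<in> ?I \<rightarrow>\<^sub>E mult_chars K" for \<nu>
      using that l x by (intro prod.cong refl char_mult_eq) auto
    show "\<alpha> (1 - (\<Sum>i\<in>?I. l i * x i)) * (\<Prod>i\<in>?I. \<beta> i (x i) * \<delta> i (1 - x i)) =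
      (\<Sum>\<nu>\<in>?I \<rightarrow>\<^sub>E mult_chars K. ?q * (?C \<nu> * (\<Prod>i\<in>?I. \<nu> i (l i)) *
        (\<Prod>i\<in>?I. char_mult (\<beta> i) (\<nu> i) (x i) * \<delta> i (1 - x i))))"
    proof (cases "\<forall>i\<in>?I. x i \<noteq> 0")
      case True
      have unit: "l i * x i \<in> K - {0}" if "i \<in> ?I" for i
        using True l[OF that] PiE_mem[OF x that] that by simp
      have "\<alpha> (1 - (\<Sum>i\<in>?I. l i * x i)) = ?q *
        (\<Sum>\<nu>\<in>?I \<rightarrow>\<^sub>E mult_chars K. ?C \<nu> * (\<Prod>i\<in>?I. \<nu> i (l i) * \<nu> i (x i)))"
        using binomial_expansion[OF I \<alpha> unit] \<nu> by (simp cong: sum.cong)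
      thus ?thesis
        by (simp add: sum_distrib_left sum_distrib_right prod.distrib char_mult_apply mult_ac)
    next
      case False
      then obtain j where j: "j \<in> ?I" "x j = 0"
        by auto
      have "(\<Prod>i\<in>?I. \<beta> i (x i) * \<delta> i (1 - x i)) = 0"
        using j \<beta> by (intro prod_zero bexI[of _ j]) auto
      moreover have "(\<Prod>i\<in>?I. char_mult (\<beta> i) (\<nu> i) (x i) * \<delta> i (1 - x i)) = 0" for \<nu>
        using j \<beta> by (intro prod_zero bexI[of _ j]) (auto simp: char_mult_apply)
      ultimately show ?thesis
        by (simp only: mult_zero_right mult_zero_left sum.neutral_const)
    qed
  qed
  also have "\<dots> = ?q * (\<Sum>\<nu>\<in>?I \<rightarrow>\<^sub>E mult_chars K. ?C \<nu> * (\<Prod>i\<in>?I. \<nu> i (l i)) *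
      (\<Sum>x\<in>?I \<rightarrow>\<^sub>E K. \<Prod>i\<in>?I. char_mult (\<beta> i) (\<nu> i) (x i) * \<delta> i (1 - x i)))"
    by (subst sum.swap) (simp add: sum_distrib_left)
  also have "\<dots> = ?q * (\<Sum>\<nu>\<in>?I \<rightarrow>\<^sub>E mult_chars K. ?C \<nu> * (\<Prod>i\<in>?I. \<nu> i (l i)) *
      ((\<Prod>i\<in>?I. - jacobi2 K (\<beta> i) (\<delta> i)) * ((\<Prod>i\<in>?I. poch K \<psi> (\<beta> i) (\<nu> i)) /
        (\<Prod>i\<in>?I. poch_circ K \<psi> (char_mult (\<beta> i) (\<delta> i)) (\<nu> i)))))"
  proof (intro arg_cong2[of _ _ _ _ "(*)"] sum.cong refl)
    fix \<nu> assume \<nu>: "\<nu> \<in> ?I \<rightarrow>\<^sub>E mult_chars K"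
    have "(\<Sum>x\<in>?I \<rightarrow>\<^sub>E K. \<Prod>i\<in>?I. char_mult (\<beta> i) (\<nu> i) (x i) * \<delta> i (1 - x i)) =
        (\<Prod>i\<in>?I. \<Sum>x\<in>K. char_mult (\<beta> i) (\<nu> i) x * \<delta> i (1 - x))"
      by (rule prod_sum_PiE[symmetric]) auto
    also have "\<dots> = (\<Prod>i\<in>?I. - jacobi2 K (\<beta> i) (\<delta> i) * (poch K \<psi> (\<beta> i) (\<nu> i) /
        poch_circ K \<psi> (char_mult (\<beta> i) (\<delta> i)) (\<nu> i)))"
    proof (rule prod.cong[OF refl])
      fix i assume "i \<in> ?I"
      moreover from this have "\<nu> i \<in> mult_chars K"
        using \<nu> by auto
      ultimately show "(\<Sum>x\<in>K. char_mult (\<beta> i) (\<nu> i) x * \<delta> i (1 - x)) =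
        - jacobi2 K (\<beta> i) (\<delta> i) * (poch K \<psi> (\<beta> i) (\<nu> i) / poch_circ K \<psi> (char_mult (\<beta> i) (\<delta> i)) (\<nu> i))"
        using \<beta> \<delta> by (simp add: sum_eq_jacobi2 jacobi2_shift)
    qed
    finally show "(\<Sum>x\<in>?I \<rightarrow>\<^sub>E K. \<Prod>i\<in>?I. char_mult (\<beta> i) (\<nu> i) (x i) * \<delta> i (1 - x i)) =
      (\<Prod>i\<in>?I. - jacobi2 K (\<beta> i) (\<delta> i)) * ((\<Prod>i\<in>?I. poch K \<psi> (\<beta> i) (\<nu> i)) /
        (\<Prod>i\<in>?I. poch_circ K \<psi> (char_mult (\<beta> i) (\<delta> i)) (\<nu> i)))"
      by (simp only: prod.distrib prod_dividef)
  qed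
  also have "\<dots> = (\<Prod>i=1..n. - jacobi2 K (\<beta> i) (\<delta> i)) *
      lauricella_A K \<psi> n (char_pow \<alpha> (- 1)) \<beta> (\<lambda>i. char_mult (\<beta> i) (\<delta> i)) l"
    unfolding lauricella_A_def sum_distrib_left by (intro sum.cong refl) (simp add: mult_ac)
  finally show ?thesis .
qed

text \<open>
  The factors \<open>\<alpha> i (1 - l i * x i)\<close> are expanded one by one, and the sum over \<open>x\<close> that remains
  is a single Jacobi sum in \<open>n + 1\<close> characters.
\<close>

proposition sum_eq_lauricella_B:
  assumes \<alpha>: "\<And>i. i \<in> {1..n} \<Longrightarrow> \<alpha> i \<in> mult_chars K" "\<And>i. i \<in> {1..n} \<Longrightarrow> \<alpha> i \<noteq> triv_char K"
    and \<beta>: "\<And>i. i \<in> {1..n} \<Longrightarrow> \<beta> i \<in> mult_chars K"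
    and \<gamma>: "\<gamma> \<in> mult_chars K" "\<gamma> \<noteq> triv_char K"
    and l: "\<And>i. i \<in> {1..n} \<Longrightarrow> l i \<in> K - {0}"
  shows "(\<Sum>x\<in>{1..n} \<rightarrow>\<^sub>E K. (\<Prod>i=1..n. \<alpha> i (1 - l i * x i)) * (\<Prod>i=1..n. \<beta> i (x i)) * \<gamma> (1 - (\<Sum>i=1..n. x i))) =
    (- 1) ^ n * jacobi K {0..n} (\<lambda>i. if i = 0 then \<gamma> else \<beta> i) *
      lauricella_B K \<psi> n (\<lambda>i. char_pow (\<alpha> i) (- 1)) \<beta> (char_mult \<gamma> (char_prod K {1..n} \<beta>)) l"
proof -
  let ?I = "{1..n}"
  let ?C = "\<lambda>\<nu>. (\<Prod>i\<in>?I. poch K \<psi> (char_pow (\<alpha> i) (- 1)) (\<nu> i)) /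
      (\<Prod>i\<in>?I. poch_circ K \<psi> (triv_char K) (\<nu> i))"
  let ?q = "1 / (1 - of_nat (card K)) ^ n :: qbar"
  have I: "finite ?I" "0 \<notin> ?I" "insert 0 ?I = {0..n}"
    by auto
  have "(\<Sum>x\<in>?I \<rightarrow>\<^sub>E K. (\<Prod>i\<in>?I. \<alpha> i (1 - l i * x i)) * (\<Prod>i\<in>?I. \<beta> i (x i)) * \<gamma> (1 - (\<Sum>i\<in>?I. x i))) =
    (\<Sum>x\<in>?I \<rightarrow>\<^sub>E K. \<Sum>\<nu>\<in>?I \<rightarrow>\<^sub>E mult_chars K. ?q * (?C \<nu> * (\<Prod>i\<in>?I. \<nu> i (l i)) *
      (\<gamma> (1 - (\<Sum>i\<in>?I. x i)) * (\<Prod>i\<in>?I. \<beta> i (x i) * \<nu> i (x i)))))"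
  proof (rule sum.cong[OF refl])
    fix x assume x: "x \<in> ?I \<rightarrow>\<^sub>E K"
    have \<nu>: "(\<Prod>i\<in>?I. \<nu> i (l i * x i)) = (\<Prod>i\<in>?I. \<nu> i (l i) * \<nu> i (x i))"
      if "\<nu> \<in> ?I \<rightarrow>\<^sub>E mult_chars K" for \<nu>
      using that l x by (intro prod.cong refl char_mult_eq) auto
    show "(\<Prod>i\<in>?I. \<alpha> i (1 - l i * x i)) * (\<Prod>i\<in>?I. \<beta> i (x i)) * \<gamma> (1 - (\<Sum>i\<in>?I. x i)) =
      (\<Sum>\<nu>\<in>?I \<rightarrow>\<^sub>E mult_chars K. ?q * (?C \<nu> * (\<Prod>i\<in>?I. \<nu> i (l i)) *
        (\<gamma> (1 - (\<Sum>i\<in>?I. x i)) * (\<Prod>i\<in>?I. \<beta> i (x i) * \<nu> i (x i)))))"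
    proof (cases "\<forall>i\<in>?I. x i \<noteq> 0")
      case True
      have unit: "l i * x i \<in> K - {0}" if "i \<in> ?I" for i
        using True l[OF that] PiE_mem[OF x that] that by simp
      have "(\<Prod>i\<in>?I. \<alpha> i (1 - l i * x i)) = ?q *
        (\<Sum>\<nu>\<in>?I \<rightarrow>\<^sub>E mult_chars K. ?C \<nu> * (\<Prod>i\<in>?I. \<nu> i (l i) * \<nu> i (x i)))"
        using prod_binomial_expansion[OF I(1) \<alpha>, where z = "\<lambda>i. l i * x i"] unit \<nu>
        by (simp cong: sum.cong)
      thus ?thesis
        by (simp add: sum_distrib_left sum_distrib_right prod.distrib mult_ac)
    next
      case False
      then obtain j where j: "j \<in> ?I" "x j = 0"
        by auto
      have "(\<Prod>i\<in>?I. \<beta> i (x i)) = 0"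
        using j \<beta> by (intro prod_zero bexI[of _ j]) auto
      moreover have "(\<Prod>i\<in>?I. \<beta> i (x i) * \<nu> i (x i)) = 0" for \<nu>
        using j \<beta> by (intro prod_zero bexI[of _ j]) auto
      ultimately show ?thesis
        by (simp only: mult_zero_right mult_zero_left sum.neutral_const)
    qed
  qed
  also have "\<dots> = ?q * (\<Sum>\<nu>\<in>?I \<rightarrow>\<^sub>E mult_chars K. ?C \<nu> * (\<Prod>i\<in>?I. \<nu> i (l i)) *
      (\<Sum>x\<in>?I \<rightarrow>\<^sub>E K. \<gamma> (1 - (\<Sum>i\<in>?I. x i)) * (\<Prod>i\<in>?I. \<beta> i (x i) * \<nu> i (x i))))"
    by (subst sum.swap) (simp add: sum_distrib_left)
  also have "\<dots> = ?q * (\<Sum>\<nu>\<in>?I \<rightarrow>\<^sub>E mult_chars K. ?C \<nu> * (\<Prod>i\<in>?I. \<nu> i (l i)) *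
      ((- 1) ^ n * jacobi K {0..n} (\<lambda>i. if i = 0 then \<gamma> else \<beta> i) *
      (\<Prod>i\<in>?I. poch K \<psi> (\<beta> i) (\<nu> i)) / poch_circ K \<psi> (char_mult \<gamma> (char_prod K ?I \<beta>)) (char_prod K ?I \<nu>)))"
  proof (intro arg_cong2[of _ _ _ _ "(*)"] sum.cong refl)
    fix \<nu> assume \<nu>: "\<nu> \<in> ?I \<rightarrow>\<^sub>E mult_chars K"
    hence \<nu>': "\<nu> i \<in> mult_chars K" if "i \<in> ?I" for i
      using that by auto
    show "(\<Sum>x\<in>?I \<rightarrow>\<^sub>E K. \<gamma> (1 - (\<Sum>i\<in>?I. x i)) * (\<Prod>i\<in>?I. \<beta> i (x i) * \<nu> i (x i))) =
      ((- 1) ^ n * jacobi K {0..n} (\<lambda>i. if i = 0 then \<gamma> else \<beta> i) *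
      (\<Prod>i\<in>?I. poch K \<psi> (\<beta> i) (\<nu> i)) / poch_circ K \<psi> (char_mult \<gamma> (char_prod K ?I \<beta>)) (char_prod K ?I \<nu>))"
      using jacobi_shift[OF I(1,2) \<gamma> \<beta> \<nu>'] unfolding I(3) by simp
  qed
  also have "\<dots> = (- 1) ^ n * jacobi K {0..n} (\<lambda>i. if i = 0 then \<gamma> else \<beta> i) *
      lauricella_B K \<psi> n (\<lambda>i. char_pow (\<alpha> i) (- 1)) \<beta> (char_mult \<gamma> (char_prod K {1..n} \<beta>)) l"
    unfolding lauricella_B_def sum_distrib_left by (intro sum.cong refl) (simp add: mult_ac)
  finally show ?thesis .
qed

text \<open>
  Here \<open>\<beta> i (x i - l i) = \<beta> i (x i) * \<beta> i (1 - l i / x i)\<close> is expanded in \<open>l i / x i\<close>. The inverses of the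
  \<open>\<nu> i\<close> appear in the Jacobi sum, so that the reflection formula interchanges numerator and denominator
  and a function of type A results, with all parameters inverted; the signs \<open>\<nu> i (- 1)\<close> cancel.
\<close>

proposition sum_eq_lauricella_A_reciprocal:
  assumes \<alpha>: "\<alpha> \<in> mult_chars K" "\<alpha> \<noteq> triv_char K"
    and \<beta>: "\<And>i. i \<in> {1..n} \<Longrightarrow> \<beta> i \<in> mult_chars K" "\<And>i. i \<in> {1..n} \<Longrightarrow> \<beta> i \<noteq> triv_char K"
    and \<gamma>: "\<And>i. i \<in> {1..n} \<Longrightarrow> \<gamma> i \<in> mult_chars K"
    and l: "\<And>i. i \<in> {1..n} \<Longrightarrow> l i \<in> K - {0}"
  shows "(\<Sum>x\<in>{1..n} \<rightarrow>\<^sub>E K. (\<Prod>i=1..n. \<beta> i (x i - l i)) * (\<Prod>i=1..n. \<gamma> i (x i)) * \<alpha> (1 - (\<Sum>i=1..n. x i))) =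
    (- 1) ^ n * jacobi K {0..n} (\<lambda>i. if i = 0 then \<alpha> else char_mult (\<beta> i) (\<gamma> i)) *
      lauricella_A K \<psi> n (char_pow (char_mult \<alpha> (char_prod K {1..n} (\<lambda>i. char_mult (\<beta> i) (\<gamma> i)))) (- 1))
        (\<lambda>i. char_pow (\<beta> i) (- 1)) (\<lambda>i. char_pow (char_mult (\<beta> i) (\<gamma> i)) (- 1)) l"
proof -
  let ?I = "{1..n}"
  let ?C = "\<lambda>\<nu>. (\<Prod>i\<in>?I. poch K \<psi> (char_pow (\<beta> i) (- 1)) (\<nu> i)) /
      (\<Prod>i\<in>?I. poch_circ K \<psi> (triv_char K) (\<nu> i))"
  let ?q = "1 / (1 - of_nat (card K)) ^ n :: qbar"
  let ?inv = "\<lambda>\<nu> i. char_pow (\<nu> i) (- 1)"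
  define \<theta> where "\<theta> = (\<lambda>i. char_mult (\<beta> i) (\<gamma> i))"
  define \<chi> where "\<chi> = char_mult \<alpha> (char_prod K ?I \<theta>)"
  have I: "finite ?I" "0 \<notin> ?I" "insert 0 ?I = {0..n}"
    by auto
  have \<theta>: "\<theta> i \<in> mult_chars K" if "i \<in> ?I" for i
    using that \<beta> \<gamma> by (simp add: \<theta>_def)
  have \<chi>: "\<chi> \<in> mult_chars K"
    using \<theta> \<alpha> by (auto simp: \<chi>_def intro!: char_prod_in)
  have "(\<Sum>x\<in>?I \<rightarrow>\<^sub>E K. (\<Prod>i\<in>?I. \<beta> i (x i - l i)) * (\<Prod>i\<in>?I. \<gamma> i (x i)) * \<alpha> (1 - (\<Sum>i\<in>?I. x i))) =
    (\<Sum>x\<in>?I \<rightarrow>\<^sub>E K. \<Sum>\<nu>\<in>?I \<rightarrow>\<^sub>E mult_chars K. ?q * (?C \<nu> * (\<Prod>i\<in>?I. \<nu> i (l i)) *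
      (\<alpha> (1 - (\<Sum>i\<in>?I. x i)) * (\<Prod>i\<in>?I. \<theta> i (x i) * ?inv \<nu> i (x i)))))"
  proof (rule sum.cong[OF refl])
    fix x assume x: "x \<in> ?I \<rightarrow>\<^sub>E K"
    have \<nu>: "(\<Prod>i\<in>?I. \<nu> i (l i / x i)) = (\<Prod>i\<in>?I. \<nu> i (l i) * ?inv \<nu> i (x i))"
      if \<nu>: "\<nu> \<in> ?I \<rightarrow>\<^sub>E mult_chars K" for \<nu>
    proof (rule prod.cong[OF refl])
      fix i assume "i \<in> ?I"
      hence "\<nu> i \<in> mult_chars K" "l i \<in> K" "x i \<in> K"
        using \<nu> l x by auto
      thus "\<nu> i (l i / x i) = \<nu> i (l i) * ?inv \<nu> i (x i)"
        by (simp add: char_mult_eq char_inverse divide_inverse char_inverse_apply)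
    qed
    show "(\<Prod>i\<in>?I. \<beta> i (x i - l i)) * (\<Prod>i\<in>?I. \<gamma> i (x i)) * \<alpha> (1 - (\<Sum>i\<in>?I. x i)) =
      (\<Sum>\<nu>\<in>?I \<rightarrow>\<^sub>E mult_chars K. ?q * (?C \<nu> * (\<Prod>i\<in>?I. \<nu> i (l i)) *
        (\<alpha> (1 - (\<Sum>i\<in>?I. x i)) * (\<Prod>i\<in>?I. \<theta> i (x i) * ?inv \<nu> i (x i)))))"
    proof (cases "\<forall>i\<in>?I. x i \<noteq> 0")
      case True
      have unit: "l i / x i \<in> K - {0}" if "i \<in> ?I" for i
        using True l[OF that] PiE_mem[OF x that] that by simp
      have "(\<Prod>i\<in>?I. \<beta> i (x i - l i)) = (\<Prod>i\<in>?I. \<beta> i (x i) * \<beta> i (1 - l i / x i))"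
      proof (rule prod.cong[OF refl])
        fix i assume i: "i \<in> ?I"
        hence "x i - l i = x i * (1 - l i / x i)"
          using True by (simp add: field_simps)
        moreover have "x i \<in> K" "l i \<in> K"
          using i x l by auto
        ultimately show "\<beta> i (x i - l i) = \<beta> i (x i) * \<beta> i (1 - l i / x i)"
          using \<beta>(1)[OF i] by (simp add: char_mult_eq)
      qed
      also have "\<dots> = (\<Prod>i\<in>?I. \<beta> i (x i)) * (?q *
        (\<Sum>\<nu>\<in>?I \<rightarrow>\<^sub>E mult_chars K. ?C \<nu> * (\<Prod>i\<in>?I. \<nu> i (l i) * ?inv \<nu> i (x i))))"
        using prod_binomial_expansion[OF I(1) \<beta>, where z = "\<lambda>i. l i / x i"] unit \<nu>
        by (simp add: prod.distrib cong: sum.cong)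
      finally show ?thesis
        by (simp add: sum_distrib_left sum_distrib_right prod.distrib \<theta>_def char_mult_apply mult_ac)
    next
      case False
      then obtain j where j: "j \<in> ?I" "x j = 0"
        by auto
      have "(\<Prod>i\<in>?I. \<gamma> i (x i)) = 0"
        using j \<gamma> by (intro prod_zero bexI[of _ j]) auto
      moreover have "(\<Prod>i\<in>?I. \<theta> i (x i) * ?inv \<nu> i (x i)) = 0" for \<nu>
        using j \<theta> by (intro prod_zero bexI[of _ j]) auto
      ultimately show ?thesis
        by (simp only: mult_zero_right mult_zero_left sum.neutral_const)
    qed
  qed
  also have "\<dots> = ?q * (\<Sum>\<nu>\<in>?I \<rightarrow>\<^sub>E mult_chars K. ?C \<nu> * (\<Prod>i\<in>?I. \<nu> i (l i)) *
      (\<Sum>x\<in>?I \<rightarrow>\<^sub>E K. \<alpha> (1 - (\<Sum>i\<in>?I. x i)) * (\<Prod>i\<in>?I. \<theta> i (x i) * ?inv \<nu> i (x i))))"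
    by (subst sum.swap) (simp add: sum_distrib_left)
  also have "\<dots> = ?q * (\<Sum>\<nu>\<in>?I \<rightarrow>\<^sub>E mult_chars K. ?C \<nu> * (\<Prod>i\<in>?I. \<nu> i (l i)) *
      ((- 1) ^ n * jacobi K {0..n} (\<lambda>i. if i = 0 then \<alpha> else \<theta> i) *
       (poch K \<psi> (char_pow \<chi> (- 1)) (char_prod K ?I \<nu>) /
        (\<Prod>i\<in>?I. poch_circ K \<psi> (char_pow (\<theta> i) (- 1)) (\<nu> i)))))"
  proof (intro arg_cong2[of _ _ _ _ "(*)"] sum.cong refl)
    fix \<nu> assume \<nu>: "\<nu> \<in> ?I \<rightarrow>\<^sub>E mult_chars K"
    hence \<nu>': "\<nu> i \<in> mult_chars K" if "i \<in> ?I" for i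
      using that by auto
    define N where "N = char_prod K ?I \<nu>"
    have N: "N \<in> mult_chars K"
      unfolding N_def using \<nu>' by (rule char_prod_in)
    have "(\<Prod>i\<in>?I. poch K \<psi> (\<theta> i) (?inv \<nu> i)) =
        N (- 1) / (\<Prod>i\<in>?I. poch_circ K \<psi> (char_pow (\<theta> i) (- 1)) (\<nu> i))"
      using \<theta> \<nu>' by (simp add: poch_inverse prod_dividef N_def char_prod_apply)
    moreover have "poch_circ K \<psi> \<chi> (char_prod K ?I (?inv \<nu>)) = N (- 1) / poch K \<psi> (char_pow \<chi> (- 1)) N"
      unfolding N_def using poch_circ_inverse[OF \<chi> N] char_prod_inverse[of ?I \<nu>] \<nu>' by (simp add: N_def)
    moreover have "N (- 1) \<noteq> 0"
      using N by (simp add: char_eq_0_iff)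
    moreover have "(\<Sum>x\<in>?I \<rightarrow>\<^sub>E K. \<alpha> (1 - (\<Sum>i\<in>?I. x i)) * (\<Prod>i\<in>?I. \<theta> i (x i) * ?inv \<nu> i (x i))) =
      (- 1) ^ n * jacobi K {0..n} (\<lambda>i. if i = 0 then \<alpha> else \<theta> i) *
      (\<Prod>i\<in>?I. poch K \<psi> (\<theta> i) (?inv \<nu> i)) / poch_circ K \<psi> \<chi> (char_prod K ?I (?inv \<nu>))"
      using jacobi_shift[OF I(1,2) \<alpha> \<theta>, where \<nu> = "?inv \<nu>"] \<nu>' unfolding I(3) \<chi>_def by simp
    ultimately show "(\<Sum>x\<in>?I \<rightarrow>\<^sub>E K. \<alpha> (1 - (\<Sum>i\<in>?I. x i)) * (\<Prod>i\<in>?I. \<theta> i (x i) * ?inv \<nu> i (x i))) =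
      (- 1) ^ n * jacobi K {0..n} (\<lambda>i. if i = 0 then \<alpha> else \<theta> i) *
       (poch K \<psi> (char_pow \<chi> (- 1)) (char_prod K ?I \<nu>) /
        (\<Prod>i\<in>?I. poch_circ K \<psi> (char_pow (\<theta> i) (- 1)) (\<nu> i)))"
      unfolding N_def[symmetric] by simp
  qed
  also have "\<dots> = (- 1) ^ n * jacobi K {0..n} (\<lambda>i. if i = 0 then \<alpha> else \<theta> i) *
      lauricella_A K \<psi> n (char_pow \<chi> (- 1)) (\<lambda>i. char_pow (\<beta> i) (- 1)) (\<lambda>i. char_pow (\<theta> i) (- 1)) l"
    unfolding lauricella_A_def sum_distrib_left by (intro sum.cong refl) (simp add: mult_ac)
  finally show ?thesis
    unfolding \<chi>_def \<theta>_def .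
qed

end

section \<open>Finite extensions: Frobenius, norm and trace\<close>

text \<open>
  A Sylow subgroup of the additive group for a prime \<open>l\<close> contains a non-zero element killed by \<open>l\<close>,
  which forces \<open>l\<close> to be the characteristic.
\<close>

lemma card_finite_field_eq_CHAR_power:
  "\<exists>k. CARD('a::finite_field) = CHAR('a) ^ k"
proof -
  define G :: "'a monoid" where "G = \<lparr>carrier = UNIV, monoid.mult = (+), one = 0\<rparr>"
  have "group G"
    unfolding G_def by (rule groupI) (auto simp: add.assoc intro: exI[of _ "- x" for x])
  then interpret G: group G .
  have pow: "x [^]\<^bsub>G\<^esub> i = of_nat i * x" for x and i :: nat
    by (induction i) (simp_all add: G_def algebra_simps)
  have only: "l = CHAR('a)" if l: "prime l" "l dvd CARD('a)" for l
  proof -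
    obtain m where "CARD('a) = l ^ 1 * m"
      using l(2) by auto
    hence "\<exists>H. subgroup H G \<and> card H = l ^ 1"
      by (intro sylow_thm[OF l(1) \<open>group G\<close>, of 1 m]) (auto simp: Coset.order_def G_def)
    then obtain H where H: "subgroup H G" "card H = l"
      by auto
    interpret H: group "G\<lparr>carrier := H\<rparr>"
      using H(1) by (rule subgroup.subgroup_is_group) fact
    have "\<exists>x\<in>H. x \<noteq> 0"
    proof (rule ccontr)
      assume "\<not> (\<exists>x\<in>H. x \<noteq> 0)"
      hence "H \<subseteq> {0}" by auto
      hence "card H \<le> 1" using card_mono[of "{0}" H] by simp
      thus False using H(2) l(1) by (simp add: prime_nat_iff)
    qed
    then obtain x where x: "x \<in> H" "x \<noteq> 0"
      by blast
    have "x [^]\<^bsub>G\<lparr>carrier := H\<rparr>\<^esub> Coset.order (G\<lparr>carrier := H\<rparr>) = \<one>\<^bsub>G\<lparr>carrier := H\<rparr>\<^esub>"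
      by (rule H.pow_order_eq_1) (use x in simp)
    hence "of_nat l * x = 0"
      by (simp add: Coset.order_def H(2) G.nat_pow_consistent[symmetric] pow, simp add: G_def)
    hence "of_nat l = (0 :: 'a)"
      using x(2) by simp
    hence "CHAR('a) dvd l"
      by (simp add: of_nat_eq_0_iff_char_dvd)
    hence "CHAR('a) = 1 \<or> CHAR('a) = l"
      using l(1) unfolding prime_nat_iff by blast
    thus ?thesis
      by simp
  qed
  have eq: "CARD('a) = (\<Prod>p\<in>prime_factors CARD('a). p ^ multiplicity p CARD('a))"
    by (rule prime_factorization_nat) simp
  have "prime_factors CARD('a) \<subseteq> {CHAR('a)}"
    using only by (auto simp: in_prime_factors_iff)
  hence "prime_factors CARD('a) = {} \<or> prime_factors CARD('a) = {CHAR('a)}"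
    by blast
  thus ?thesis
  proof
    assume A: "prime_factors CARD('a) = {}"
    have "CARD('a) = CHAR('a) ^ 0"
      using eq[unfolded A] by (simp only: prod.empty power_0)
    thus ?thesis ..
  next
    assume A: "prime_factors CARD('a) = {CHAR('a)}"
    have "CARD('a) = CHAR('a) ^ multiplicity CHAR('a) CARD('a)"
      by (rule trans[OF eq[unfolded A]]) simp
    thus ?thesis ..
  qed
qed

lemma frobenius_add:
  fixes x y :: "'a::finite_field alg_closure"
  shows "(x + y) ^ (CARD('a) ^ r) = x ^ (CARD('a) ^ r) + y ^ (CARD('a) ^ r)"
proof -
  obtain k where "CARD('a) = CHAR('a) ^ k"
    using card_finite_field_eq_CHAR_power by blast
  hence "CARD('a) ^ r = CHAR('a alg_closure) ^ (k * r)"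
    by (simp add: power_mult)
  thus ?thesis
    by (intro freshmans_dream') auto
qed

lemma frobenius_sum:
  fixes f :: "'i \<Rightarrow> 'a::finite_field alg_closure"
  shows "(\<Sum>i\<in>I. f i) ^ (CARD('a) ^ r) = (\<Sum>i\<in>I. f i ^ (CARD('a) ^ r))"
  by (induction I rule: infinite_finite_induct) (auto simp: frobenius_add power_0_left)

lemma frobenius_uminus:
  fixes x :: "'a::finite_field alg_closure"
  shows "(- x) ^ (CARD('a) ^ r) = - (x ^ (CARD('a) ^ r))"
  using frobenius_add[of x "- x" r] by (simp add: power_0_left eq_neg_iff_add_eq_0 add.commute)

lemma frobenius_diff:
  fixes x y :: "'a::finite_field alg_closure"
  shows "(x - y) ^ (CARD('a) ^ r) = x ^ (CARD('a) ^ r) - y ^ (CARD('a) ^ r)"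
  using frobenius_add[of x "- y" r] by (simp add: frobenius_uminus)

lemma frobenius_inj:
  fixes x y :: "'a::finite_field alg_closure"
  shows "x ^ (CARD('a) ^ r) = y ^ (CARD('a) ^ r) \<longleftrightarrow> x = y"
  using frobenius_diff[of x y r] by auto

lemma card_finite_field_gt_1: "CARD('a::finite_field) > 1"
proof -
  have "card {0, 1 :: 'a} \<le> CARD('a)"
    by (rule card_mono) auto
  thus ?thesis by simp
qed

lemma finite_subfield_ext_field:
  assumes "r > 0"
  shows "finite_subfield (ext_field r :: 'a::finite_field alg_closure set)"
proof
  show "finite (ext_field r :: 'a alg_closure set)"
    using card_ext_field[OF assms, where 'a = 'a] by (intro card_ge_0_finite) simp
qed (auto simp: ext_field_def frobenius_diff power_mult_distrib power_inverse)

lemma finite_subfield_UNIV: "finite_subfield (UNIV :: 'a::finite_field set)"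
  by standard auto

lemma ext_field_1: "ext_field 1 = range (to_ac :: 'a::finite_field \<Rightarrow> _)"
proof -
  have "finite (ext_field 1 :: 'a alg_closure set)"
    using finite_subfield.fin[OF finite_subfield_ext_field[of 1, where 'a = 'a]] by simp
  moreover have "range (to_ac :: 'a \<Rightarrow> _) \<subseteq> ext_field 1"
    by (auto simp: ext_field_def to_ac_power[symmetric] finite_field_power_card_eq_same simp del: to_ac_power)
  moreover have "card (range (to_ac :: 'a \<Rightarrow> _)) = card (ext_field 1 :: 'a alg_closure set)"
    using card_ext_field[of 1, where 'a = 'a] by (simp add: card_image inj_to_ac)
  ultimately show ?thesis
    using card_subset_eq by metis
qed

lemma to_ac_in_ext_field [simp]: "to_ac (x :: 'a::finite_field) \<in> ext_field r"
proof -
  have "x ^ CARD('a) ^ r = x"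
    by (rule finite_field_power_card_power_eq_same) simp
  thus ?thesis
    by (simp add: ext_field_def flip: to_ac_power)
qed

lemma in_range_to_ac_iff:
  "x \<in> range (to_ac :: 'a::finite_field \<Rightarrow> _) \<longleftrightarrow> x ^ CARD('a) = x"
  using ext_field_1[where 'a = 'a] by (auto simp: ext_field_def)

lemma ext_field_power_period:
  assumes "x \<in> ext_field r" shows "x ^ CARD('a) ^ (r + i) = (x :: 'a::finite_field alg_closure) ^ CARD('a) ^ i"
proof -
  have "x ^ CARD('a) ^ (r + i) = (x ^ CARD('a) ^ r) ^ CARD('a) ^ i"
    by (simp add: power_add power_mult)
  thus ?thesis
    using assms by (simp add: ext_field_def)
qed

definition ext_trace :: "nat \<Rightarrow> 'a::finite_field alg_closure \<Rightarrow> 'a" where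
  "ext_trace r x = of_ac (\<Sum>i<r. x ^ CARD('a) ^ i)"


lemma to_ac_ext_norm:
  assumes x: "x \<in> ext_field r" and r: "r > 0"
  shows "to_ac (ext_norm r x) = (\<Prod>i<r. (x :: 'a::finite_field alg_closure) ^ CARD('a) ^ i)"
proof -
  obtain s where s: "r = Suc s"
    using r by (cases r) auto
  have "(\<Prod>i<r. x ^ CARD('a) ^ i) ^ CARD('a) = (\<Prod>i<r. x ^ CARD('a) ^ Suc i)"
    by (simp add: prod_power_distrib power_mult[symmetric] mult.commute)
  also have "\<dots> = (\<Prod>i<s. x ^ CARD('a) ^ Suc i) * x"
    using x by (simp add: s ext_field_def)
  also have "\<dots> = (\<Prod>i<r. x ^ CARD('a) ^ i)"
    unfolding s prod.lessThan_Suc_shift by simp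
  finally show ?thesis
    unfolding ext_norm_def by (intro to_ac_of_ac) (simp add: in_range_to_ac_iff)
qed

lemma to_ac_ext_trace:
  assumes x: "x \<in> ext_field r" and r: "r > 0"
  shows "to_ac (ext_trace r x) = (\<Sum>i<r. (x :: 'a::finite_field alg_closure) ^ CARD('a) ^ i)"
proof -
  obtain s where s: "r = Suc s"
    using r by (cases r) auto
  have "(\<Sum>i<r. x ^ CARD('a) ^ i) ^ CARD('a) = (\<Sum>i<r. x ^ CARD('a) ^ Suc i)"
    using frobenius_sum[of "\<lambda>i. x ^ CARD('a) ^ i" "{..<r}" 1]
    by (simp add: power_mult[symmetric] mult.commute)
  also have "\<dots> = (\<Sum>i<s. x ^ CARD('a) ^ Suc i) + x"
    using x by (simp add: s ext_field_def)
  also have "\<dots> = (\<Sum>i<r. x ^ CARD('a) ^ i)"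
    unfolding s sum.lessThan_Suc_shift by simp
  finally show ?thesis
    unfolding ext_trace_def by (intro to_ac_of_ac) (simp add: in_range_to_ac_iff)
qed

lemma ext_norm_mult:
  assumes "x \<in> ext_field r" "y \<in> ext_field r" and r: "r > 0"
  shows "ext_norm r (x * y) = ext_norm r x * ext_norm r (y :: 'a::finite_field alg_closure)"
proof -
  interpret finite_subfield "ext_field r :: 'a alg_closure set"
    using r by (rule finite_subfield_ext_field)
  have "to_ac (ext_norm r (x * y)) = to_ac (ext_norm r x * ext_norm r y)"
    using assms by (simp add: to_ac_ext_norm prod.distrib power_mult_distrib)
  thus ?thesis
    by (simp only: to_ac_eq_iff)
qed

lemma ext_trace_add:
  assumes "x \<in> ext_field r" "y \<in> ext_field r" and r: "r > 0"
  shows "ext_trace r (x + y) = ext_trace r x + ext_trace r (y :: 'a::finite_field alg_closure)"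
proof -
  interpret finite_subfield "ext_field r :: 'a alg_closure set"
    using r by (rule finite_subfield_ext_field)
  have "to_ac (ext_trace r (x + y)) = to_ac (ext_trace r x + ext_trace r y)"
    using assms by (simp add: to_ac_ext_trace sum.distrib frobenius_add)
  thus ?thesis
    by (simp only: to_ac_eq_iff)
qed

lemma ext_norm_eq_0_iff:
  assumes "x \<in> ext_field r" and r: "r > 0"
  shows "ext_norm r x = (0 :: 'a::finite_field) \<longleftrightarrow> x = 0"
proof -
  have "ext_norm r x = 0 \<longleftrightarrow> to_ac (ext_norm r x) = 0"
    by simp
  also have "\<dots> \<longleftrightarrow> x = 0"
    unfolding to_ac_ext_norm[OF assms] using r by auto
  finally show ?thesis .
qed

lemma sum_powers_times_pred:
  fixes q :: nat assumes "q > 0" shows "(\<Sum>i<r. q ^ i) * (q - 1) = q ^ r - 1"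
proof -
  have "int ((\<Sum>i<r. q ^ i) * (q - 1)) = int (q ^ r - 1)"
    using power_diff_1_eq[of "int q" r] assms by (simp add: of_nat_diff mult.commute)
  thus ?thesis by (simp only: of_nat_eq_iff)
qed

text \<open>
  On the extension the norm is the power with exponent \<open>s = 1 + q + \<dots> + q ^ (r - 1)\<close>. Any \<open>s\<close>-th root of
  \<open>y\<close> in the algebraic closure already lies in the extension because \<open>s * (q - 1) = q ^ r - 1\<close>.
\<close>

lemma ext_norm_surj:
  fixes y :: "'a::finite_field"
  assumes y: "y \<noteq> 0" and r: "r > 0"
  shows "\<exists>x\<in>ext_field r - {0}. ext_norm r x = y"
proof -
  let ?q = "CARD('a)"
  define s where "s = (\<Sum>i<r. ?q ^ i)"
  have s0: "s > 0"
    unfolding s_def using r by (intro sum_pos) auto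
  define p where "p = monom 1 s + [:- to_ac y:]"
  have "degree p = s"
    using s0 degree_add_eq_left[of "[:- to_ac y:]" "monom 1 s"] by (simp add: p_def degree_monom_eq)
  then obtain x where "poly p x = 0"
    using alg_closed_imp_poly_has_root[of p] s0 by auto
  hence x: "x ^ s = to_ac y"
    by (simp add: p_def poly_monom)
  have x0: "x \<noteq> 0"
    using x y s0 by (auto simp: power_0_left)
  have "x ^ (?q ^ r - 1) = (x ^ s) ^ (?q - 1)"
    unfolding s_def by (subst sum_powers_times_pred[symmetric]) (auto simp: power_mult)
  also have "\<dots> = 1"
    using finite_subfield.unit_power[OF finite_subfield_UNIV, of y] y x by (simp flip: to_ac_power)
  finally have "x ^ (?q ^ r - 1) = 1" .
  hence xK: "x \<in> ext_field r"
    using power_minus_mult[of "?q ^ r" x] by (simp add: ext_field_def)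
  have "to_ac (ext_norm r x) = to_ac y"
    using x by (simp add: to_ac_ext_norm[OF xK r] s_def power_sum)
  thus ?thesis
    using xK x0 by auto
qed

text \<open>
  A root \<open>x\<close> of the polynomial \<open>X + X ^ q + \<dots> + X ^ (q ^ (r - 1)) - y\<close> lies in the extension: subtracting the
  equation from its image under the Frobenius leaves \<open>x ^ (q ^ r) - x = 0\<close>.
\<close>

lemma ext_trace_surj:
  fixes y :: "'a::finite_field"
  assumes r: "r > 0"
  shows "\<exists>x\<in>ext_field r. ext_trace r x = y"
proof -
  let ?q = "CARD('a)"
  define p where "p = (\<Sum>i<r. monom 1 (?q ^ i)) + [:- to_ac y:]"
  have "coeff p 1 = (\<Sum>i<r. if i = 0 then 1 else 0)"
    unfolding p_def coeff_add coeff_sum using card_finite_field_gt_1[where 'a = 'a]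
    by (auto intro!: sum.cong)
  also have "\<dots> = 1"
    using r by simp
  finally have "degree p > 0"
    by (metis One_nat_def le_degree less_le_trans zero_less_Suc zero_neq_one)
  then obtain x where "poly p x = 0"
    using alg_closed_imp_poly_has_root[of p] by auto
  hence x: "(\<Sum>i<r. x ^ ?q ^ i) = to_ac y"
    by (simp add: p_def poly_monom poly_sum)
  have "(\<Sum>i<r. x ^ ?q ^ Suc i) = (\<Sum>i<r. x ^ ?q ^ i) ^ ?q"
    using frobenius_sum[of "\<lambda>i. x ^ ?q ^ i" "{..<r}" 1]
    by (simp add: power_mult[symmetric] mult.commute)
  also have "\<dots> = (\<Sum>i<r. x ^ ?q ^ i)"
    unfolding x using in_range_to_ac_iff[of "to_ac y"] by simp
  finally have "(\<Sum>i<r. x ^ ?q ^ Suc i - x ^ ?q ^ i) = 0"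
    by (simp add: sum_subtractf)
  hence "x ^ ?q ^ r - x = 0"
    by (subst (asm) sum_lessThan_telescope) simp
  hence xK: "x \<in> ext_field r"
    by (simp add: ext_field_def)
  have "to_ac (ext_trace r x) = to_ac y"
    by (simp add: to_ac_ext_trace[OF xK r] x)
  thus ?thesis
    using xK by auto
qed

lemma lift_char_in:
  assumes \<eta>: "\<eta> \<in> mult_chars (UNIV :: 'a::finite_field set)" and r: "r > 0"
  shows "lift_char r \<eta> \<in> mult_chars (ext_field r)"
proof -
  interpret finite_subfield "ext_field r :: 'a alg_closure set"
    using r by (rule finite_subfield_ext_field)
  interpret U: finite_subfield "UNIV :: 'a set"
    by (rule finite_subfield_UNIV)
  show ?thesis
    unfolding mult_chars_def
  proof (intro CollectI conjI ballI allI impI)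
    fix x y :: "'a alg_closure" assume "x \<in> ext_field r - {0}" "y \<in> ext_field r - {0}"
    thus "lift_char r \<eta> (x * y) = lift_char r \<eta> x * lift_char r \<eta> y"
      using U.char_mult_eq[OF \<eta>] r by (simp add: lift_char_def ext_norm_mult)
  qed (use U.char_eq_0_iff[OF \<eta>] r in \<open>auto simp: lift_char_def ext_norm_eq_0_iff\<close>)
qed

lemma lift_char_pow: "lift_char r (char_pow \<eta> k) = char_pow (lift_char r \<eta>) k"
  by (auto simp: lift_char_def char_pow_def fun_eq_iff)

lemma lift_char_eq_triv_iff:
  assumes \<eta>: "\<eta> \<in> mult_chars (UNIV :: 'a::finite_field set)" and r: "r > 0"
  shows "lift_char r \<eta> = triv_char (ext_field r) \<longleftrightarrow> \<eta> = triv_char UNIV"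
proof
  assume L: "lift_char r \<eta> = triv_char (ext_field r)"
  interpret U: finite_subfield "UNIV :: 'a set"
    by (rule finite_subfield_UNIV)
  show "\<eta> = triv_char UNIV"
  proof (rule U.char_eqI[OF \<eta>])
    fix y :: 'a assume "y \<in> UNIV - {0}"
    then obtain x where x: "x \<in> ext_field r - {0}" "ext_norm r x = y"
      using ext_norm_surj[of y r] r by auto
    have "lift_char r \<eta> x = 1"
      using x(1) by (simp add: L triv_char_def)
    thus "\<eta> y = triv_char UNIV y"
      using x \<open>y \<in> UNIV - {0}\<close> by (simp add: lift_char_def triv_char_def)
  qed auto
next
  assume "\<eta> = triv_char UNIV"
  thus "lift_char r \<eta> = triv_char (ext_field r)"
    using r by (auto simp: lift_char_def triv_char_def fun_eq_iff ext_norm_eq_0_iff)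
qed

lemma lift_char_prod:
  assumes r: "r > 0"
  shows "lift_char r (char_prod (UNIV :: 'a::finite_field set) I \<eta>) = char_prod (ext_field r) I (\<lambda>i. lift_char r (\<eta> i))"
  using r by (auto simp: lift_char_def char_prod_def triv_char_def fun_eq_iff ext_norm_eq_0_iff)

lemma trace_add_char:
  assumes \<psi>: "nontrivial_add_char (UNIV :: 'a::finite_field set) \<psi>" and r: "r > 0"
  shows "nontrivial_add_char (ext_field r) (\<lambda>x. \<psi> (ext_trace r x))"
proof -
  obtain y where y: "\<psi> y \<noteq> 1"
    using \<psi> by (auto simp: nontrivial_add_char_def)
  obtain x where "x \<in> ext_field r" "ext_trace r x = y"
    using ext_trace_surj[OF r] by blast
  thus ?thesis
    using \<psi> y r by (auto simp: nontrivial_add_char_def ext_trace_add intro!: bexI[of _ x])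
qed

section \<open>The Hasse-Davenport relation\<close>

text \<open>
  Monic polynomials over the closure are handled through their multisets of roots, so that neither
  irreducible factors nor minimal polynomials are needed.
\<close>

definition root_prod :: "'k::comm_ring_1 multiset \<Rightarrow> 'k poly" where
  "root_prod A = (\<Prod>x\<in>#A. [:- x, 1:])"

lemma root_prod_add_mset [simp]: "root_prod (add_mset x A) = [:- x, 1:] * root_prod A"
  and root_prod_empty [simp]: "root_prod {#} = 1"
  and root_prod_plus: "root_prod (A + B) = root_prod A * root_prod B"
  by (simp_all add: root_prod_def)

lemma lead_coeff_root_prod: "lead_coeff (root_prod (A :: 'k::idom multiset)) = 1"
  and degree_root_prod [simp]: "degree (root_prod A) = size A"
proof -
  have "lead_coeff (root_prod A) = 1 \<and> degree (root_prod A) = size A"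
  proof (induction A)
    case (add x A)
    hence "root_prod A \<noteq> 0"
      by auto
    hence "degree ([:- x, 1:] * root_prod A) = Suc (size A)"
      using add by (subst degree_mult_eq) auto
    moreover have "lead_coeff ([:- x, 1:] * root_prod A) = 1"
      unfolding lead_coeff_mult using add.IH[THEN conjunct1] by simp
    ultimately show ?case
      by (simp only: root_prod_add_mset size_add_mset)
  qed simp
  thus "lead_coeff (root_prod A) = 1" "degree (root_prod A) = size A"
    by auto
qed

lemma coeff_root_prod_size [simp]: "coeff (root_prod (A :: 'k::idom multiset)) (size A) = 1"
  using lead_coeff_root_prod[of A] by simp

lemma root_prod_nonzero [simp]: "root_prod (A :: 'k::idom multiset) \<noteq> 0"
  using lead_coeff_root_prod[of A] by (metis leading_coeff_0_iff zero_neq_one)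

lemma proots_root_prod [simp]: "proots (root_prod (A :: 'k::idom multiset)) = A"
  by (induction A) (simp_all add: proots_mult del: mult_pCons_left)

lemma monic_eq_root_prod:
  fixes f :: "'k::alg_closed_field poly"
  assumes "lead_coeff f = 1" shows "f = root_prod (proots f)"
proof -
  have "f \<noteq> 0"
    using assms by auto
  then obtain A where A: "f = smult (lead_coeff f) (\<Prod>x\<in>#A. [:- x, 1:])"
    using alg_closed_imp_factorization by blast
  hence "f = root_prod A"
    using assms by (simp add: root_prod_def)
  thus ?thesis
    by simp
qed

lemma root_prod_dvd_iff: "root_prod A dvd root_prod B \<longleftrightarrow> A \<subseteq># (B :: 'k::idom multiset)"
proof
  assume "root_prod A dvd root_prod B"
  then obtain s where s: "root_prod B = root_prod A * s"
    by (elim dvdE)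
  hence "root_prod A * s \<noteq> 0"
    using root_prod_nonzero[of B] by simp
  hence "B = A + proots s"
    using arg_cong[OF s, of proots] by (simp add: proots_mult)
  thus "A \<subseteq># B" by simp
next
  assume "A \<subseteq># B"
  then obtain R where "B = A + R"
    by (auto simp: subset_mset.le_iff_add)
  thus "root_prod A dvd root_prod B"
    by (simp add: root_prod_plus)
qed

lemma coeff_0_root_prod: "coeff (root_prod (A :: 'k::idom multiset)) 0 = (- 1) ^ size A * \<Prod>\<^sub># A"
  by (induction A) (simp_all add: coeff_mult)

lemma coeff_subleading_root_prod:
  "A \<noteq> {#} \<Longrightarrow> coeff (root_prod (A :: 'k::idom multiset)) (size A - 1) = - \<Sum>\<^sub># A"
proof (induction A)
  case (add x A)
  have lc: "coeff (root_prod A) (size A) = 1"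
    using lead_coeff_root_prod[of A] by simp
  show ?case
  proof (cases "A = {#}")
    case False
    then obtain k where k: "size A = Suc k"
      by (cases "size A") auto
    have "coeff (root_prod A) k = - \<Sum>\<^sub># A"
      using add.IH[OF False] k by simp
    thus ?thesis
      using lc k by simp
  qed simp
qed simp

definition frob_poly :: "'a::finite_field alg_closure poly \<Rightarrow> 'a alg_closure poly" where
  "frob_poly f = map_poly (\<lambda>z. z ^ CARD('a)) f"

lemma coeff_frob_poly: "coeff (frob_poly f) i = coeff (f :: 'a::finite_field alg_closure poly) i ^ CARD('a)"
  unfolding frob_poly_def by (subst coeff_map_poly) (auto simp: power_0_left)

lemma frob_poly_1 [simp]: "frob_poly 1 = 1"
  by (auto simp: poly_eq_iff coeff_frob_poly power_0_left)

lemma frob_poly_mult: "frob_poly (f * h) = frob_poly f * frob_poly h"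
proof (rule poly_eqI)
  fix n
  show "coeff (frob_poly (f * h)) n = coeff (frob_poly f * frob_poly h) n"
    unfolding coeff_frob_poly coeff_mult
    using frobenius_sum[of "\<lambda>i. coeff f i * coeff h (n - i)" "{..n}" 1]
    by (simp add: power_mult_distrib)
qed

lemma frob_poly_root_prod:
  "frob_poly (root_prod A) = root_prod (image_mset (\<lambda>z :: 'a::finite_field alg_closure. z ^ CARD('a)) A)"
proof (induction A)
  case (add x A)
  have "frob_poly [:- x, 1:] = [:- (x ^ CARD('a)), 1:]"
    using frobenius_uminus[of x 1] by (auto simp: frob_poly_def map_poly_pCons)
  thus ?case
    using add by (simp add: frob_poly_mult del: mult_pCons_left)
qed simp

text \<open>
  Being defined over the base field means being fixed by the Frobenius.
\<close>

lemma frob_poly_eq_iff: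
  "frob_poly (f :: 'a::finite_field alg_closure poly) = f \<longleftrightarrow> (\<forall>i. coeff f i \<in> range to_ac)"
  unfolding poly_eq_iff coeff_frob_poly in_range_to_ac_iff ..

definition monic_over_base :: "nat \<Rightarrow> 'a::finite_field alg_closure poly set" where
  "monic_over_base n = {f. degree f = n \<and> coeff f n = 1 \<and> frob_poly f = f}"

lemma finite_monic_over_base: "finite (monic_over_base n :: 'a::finite_field alg_closure poly set)"
proof (rule finite_subset)
  let ?L = "{xs :: 'a alg_closure list. set xs \<subseteq> range to_ac \<and> length xs \<le> Suc n}"
  show "monic_over_base n \<subseteq> Poly ` ?L"
  proof
    fix f :: "'a alg_closure poly" assume f: "f \<in> monic_over_base n"
    hence "f \<noteq> 0"
      by (auto simp: monic_over_base_def)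
    hence "length (coeffs f) = Suc n"
      using f by (simp add: length_coeffs_degree monic_over_base_def)
    moreover have "set (coeffs f) \<subseteq> range to_ac"
      using f \<open>f \<noteq> 0\<close> by (auto simp: monic_over_base_def frob_poly_eq_iff coeffs_def)
    ultimately show "f \<in> Poly ` ?L"
      by (intro image_eqI[of _ _ "coeffs f"]) auto
  qed
  show "finite (Poly ` ?L)"
    by (intro finite_imageI finite_lists_length_le) auto
qed

lemma monic_over_base_roots:
  fixes f :: "'a::finite_field alg_closure poly"
  assumes f: "f \<in> monic_over_base n"
  shows "f = root_prod (proots f)" "size (proots f) = n"
    and "image_mset (\<lambda>z. z ^ CARD('a)) (proots f) = proots f"
    and "\<Sum>\<^sub># (proots f) \<in> range to_ac" "\<Prod>\<^sub># (proots f) \<in> range to_ac"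
proof -
  show eq: "f = root_prod (proots f)"
    using f by (intro monic_eq_root_prod) (simp add: monic_over_base_def)
  show size: "size (proots f) = n"
    using f by (simp add: size_proots_alg_closed monic_over_base_def)
  have "root_prod (image_mset (\<lambda>z. z ^ CARD('a)) (proots f)) = root_prod (proots f)"
    using f eq frob_poly_root_prod[of "proots f"] by (simp add: monic_over_base_def)
  from arg_cong[OF this, of proots] show inv: "image_mset (\<lambda>z. z ^ CARD('a)) (proots f) = proots f"
    by simp
  have s: "\<Sum>\<^sub># A ^ CARD('a) = \<Sum>\<^sub># (image_mset (\<lambda>z. z ^ CARD('a)) A)" for A :: "'a alg_closure multiset"
    by (induction A) (use frobenius_add[where r = 1 and 'a = 'a] in \<open>auto simp: power_0_left\<close>)
  have p: "\<Prod>\<^sub># A ^ CARD('a) = \<Prod>\<^sub># (image_mset (\<lambda>z. z ^ CARD('a)) A)" for A :: "'a alg_closure multiset"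
    by (induction A) (auto simp: power_mult_distrib)
  show "\<Sum>\<^sub># (proots f) \<in> range to_ac" "\<Prod>\<^sub># (proots f) \<in> range to_ac"
    unfolding in_range_to_ac_iff s p inv by simp_all
qed

text \<open>
  The completely multiplicative function whose L-series is studied. In terms of coefficients the two
  arguments are, up to sign, the subleading and the constant coefficient.
\<close>

definition poly_char :: "('a::finite_field \<Rightarrow> qbar) \<Rightarrow> ('a \<Rightarrow> qbar) \<Rightarrow> 'a alg_closure poly \<Rightarrow> qbar" where
  "poly_char \<psi> \<eta> f = \<psi> (of_ac (\<Sum>\<^sub># (proots f))) * \<eta> (of_ac (\<Prod>\<^sub># (proots f)))"

text \<open>
  The characteristic polynomial of \<open>x\<close> over the base field for \<open>x\<close> in the extension of degree \<open>k\<close>; it is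
  a power of the minimal polynomial. As \<open>x\<close> varies, these are the prime powers of degree \<open>k\<close>.
\<close>

definition conj_poly :: "nat \<Rightarrow> 'a::finite_field alg_closure \<Rightarrow> 'a alg_closure poly" where
  "conj_poly k x = root_prod (image_mset (\<lambda>i. x ^ CARD('a) ^ i) (mset_set {..<k}))"

lemma conj_poly_add:
  assumes x: "x \<in> ext_field a"
  shows "conj_poly (a + b) x = conj_poly a x * conj_poly b (x :: 'a::finite_field alg_closure)"
proof (induction b)
  case (Suc b)
  have step: "conj_poly (Suc k) x = [:- (x ^ CARD('a) ^ k), 1:] * conj_poly k x" for k
    by (simp add: conj_poly_def lessThan_Suc)
  show ?case
    using Suc ext_field_power_period[OF x, of b] by (simp add: step del: mult_pCons_left)
qed (simp add: conj_poly_def)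

lemma conj_poly_in:
  fixes x :: "'a::finite_field alg_closure"
  assumes x: "x \<in> ext_field k" and k: "k > 0"
  shows "conj_poly k x \<in> monic_over_base k"
proof -
  obtain s where s: "k = Suc s"
    using k by (cases k) auto
  have "image_mset (\<lambda>z. z ^ CARD('a)) (image_mset (\<lambda>i. x ^ CARD('a) ^ i) (mset_set {..<k})) =
      image_mset (\<lambda>i. x ^ CARD('a) ^ Suc i) (mset_set {..<k})"
    by (simp add: multiset.map_comp comp_def power_mult[symmetric] mult.commute)
  also have "\<dots> = add_mset x (image_mset (\<lambda>i. x ^ CARD('a) ^ Suc i) (mset_set {..<s}))"
    using x by (simp add: s lessThan_Suc ext_field_def)
  also have "image_mset (\<lambda>i. x ^ CARD('a) ^ Suc i) (mset_set {..<s}) =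
      image_mset (\<lambda>i. x ^ CARD('a) ^ i) (mset_set (Suc ` {..<s}))"
    by (subst image_mset_mset_set[symmetric]) (auto simp: multiset.map_comp comp_def)
  also have "add_mset x \<dots> = image_mset (\<lambda>i. x ^ CARD('a) ^ i) (mset_set {..<k})"
    unfolding s lessThan_Suc_eq_insert_0 by simp
  finally show ?thesis
    using coeff_root_prod_size[of "image_mset (\<lambda>i. x ^ CARD('a) ^ i) (mset_set {..<k})"]
    by (auto simp: monic_over_base_def conj_poly_def frob_poly_root_prod)
qed

lemma poly_char_conj_poly: "poly_char \<psi> \<eta> (conj_poly k x) = \<psi> (ext_trace k x) * \<eta> (ext_norm k x)"
  by (simp add: poly_char_def conj_poly_def ext_trace_def ext_norm_def sum_unfold_sum_mset prod_unfold_prod_mset)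

text \<open>
  If \<open>x\<close> generates the extension of degree \<open>e\<close>, the admissible \<open>k\<close> are the multiples \<open>e * j\<close>, and the
  characteristic polynomial is the \<open>j\<close>-th power of the polynomial with the \<open>e\<close> distinct conjugates as roots. Since \<open>f\<close> is
  fixed by the Frobenius, all conjugates are roots of \<open>f\<close> with the multiplicity of \<open>x\<close>, so this power divides
  \<open>f\<close> if and only if \<open>j\<close> is at most that multiplicity.
\<close>

lemma card_conj_poly_dvd:
  fixes f :: "'a::finite_field alg_closure poly"
  assumes f: "f \<in> monic_over_base n" and x: "x \<in># proots f"
  shows "card {k \<in> {1..n}. x \<in> ext_field k \<and> conj_poly k x dvd f} = count (proots f) x"
proof -
  let ?q = "CARD('a)"
  define A where "A = proots f"
  define g where "g = (\<lambda>i. x ^ ?q ^ i)"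
  note roots = monic_over_base_roots[OF f, folded A_def]
  have inj: "inj (\<lambda>z :: 'a alg_closure. z ^ ?q)"
    using frobenius_inj[where r = 1 and 'a = 'a] by (auto simp: inj_def)
  have count_frob: "count A (z ^ ?q) = count A z" for z
  proof -
    have "count (image_mset (\<lambda>z. z ^ ?q) B) (z ^ ?q) = count B z" for B
      by (induction B) (auto dest: injD[OF inj])
    from this[of A] show ?thesis
      using roots(3) by simp
  qed
  have g_Suc: "g (Suc i) = g i ^ ?q" for i
    by (simp add: g_def power_mult[symmetric] mult.commute)
  have count_g: "count A (g i) = count A x" for i
    by (induction i) (simp_all only: g_Suc count_frob, simp add: g_def)
  \<comment> \<open>The conjugates are roots of f, so the sequence of Frobenius iterates repeats and x has a finite period.\<close>
  have "\<not> inj_on g UNIV"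
  proof
    assume "inj_on g UNIV"
    moreover have "range g \<subseteq> set_mset A"
      using count_g x by (auto simp: A_def simp flip: count_greater_zero_iff)
    ultimately show False
      using finite_subset[of "range g" "set_mset A"] finite_imageD by fastforce
  qed
  then obtain i j where "i \<noteq> j" "g i = g j"
    by (auto simp: inj_on_def)
  then obtain i j where ij: "i < j" "g i = g j"
    by (metis linorder_neqE_nat)
  have per: "x \<in> ext_field (j - i)" if "i < j" "g i = g j" for i j
  proof -
    have "g (j - i) ^ ?q ^ i = x ^ ?q ^ i"
      using that by (simp add: g_def power_mult[symmetric] power_add[symmetric])
    thus ?thesis
      by (simp add: frobenius_inj ext_field_def g_def)
  qed
  define e where "e = (LEAST k. k > 0 \<and> x \<in> ext_field k)"
  have "\<exists>k. k > 0 \<and> x \<in> ext_field k"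
    using per[OF ij] ij(1) by (intro exI[of _ "j - i"]) auto
  hence e: "e > 0" "x \<in> ext_field e"
    unfolding e_def by (rule LeastI_ex[THEN conjunct1], rule LeastI_ex[THEN conjunct2])
  have least: "e \<le> k" if "k > 0" "x \<in> ext_field k" for k
    unfolding e_def using that by (intro Least_le) auto
  have mult_e: "x \<in> ext_field (e * j)" for j
  proof (induction j)
    case (Suc j)
    thus ?case
      using ext_field_power_period[OF e(2), of "e * j"] by (simp add: ext_field_def)
  qed (simp add: ext_field_def)
  have dvd: "e dvd k" if "x \<in> ext_field k" for k
  proof -
    have "x ^ ?q ^ (e * (k div e) + k mod e) = x ^ ?q ^ (k mod e)"
      by (rule ext_field_power_period[OF mult_e])
    hence "x \<in> ext_field (k mod e)"
      using that by (simp add: ext_field_def)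
    thus ?thesis
      using least[of "k mod e"] mod_less_divisor[OF e(1), of k] by (auto simp: dvd_eq_mod_eq_0)
  qed
  have inj_g: "inj_on g {..<e}"
  proof (rule linorder_inj_onI)
    fix i j assume "i < j" "i \<in> {..<e}" "j \<in> {..<e}"
    thus "g i \<noteq> g j"
      using per[of i j] least[of "j - i"] by fastforce
  qed auto
  define S where "S = g ` {..<e}"
  have conj_e: "conj_poly e x = root_prod (mset_set S)"
    unfolding conj_poly_def S_def using inj_g by (simp add: image_mset_mset_set g_def)
  have conj_mult: "conj_poly (e * j) x = root_prod (repeat_mset j (mset_set S))" for j
    by (induction j) (simp_all add: conj_poly_add[OF e(2)] conj_e root_prod_plus, simp add: conj_poly_def)
  have dvd_iff: "conj_poly (e * j) x dvd f \<longleftrightarrow> j \<le> count A x" for j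
  proof -
    have "conj_poly (e * j) x dvd f \<longleftrightarrow> repeat_mset j (mset_set S) \<subseteq># A"
      using roots(1) by (simp add: conj_mult root_prod_dvd_iff)
    also have "\<dots> \<longleftrightarrow> j \<le> count A x"
    proof
      have "x \<in> S"
        unfolding S_def using e(1) by (intro image_eqI[of _ _ 0]) (auto simp: g_def)
      hence "count (mset_set S) x = 1"
        by (simp add: S_def)
      moreover assume "repeat_mset j (mset_set S) \<subseteq># A"
      ultimately show "j \<le> count A x"
        using mset_subset_eq_count[of "repeat_mset j (mset_set S)" A x] by simp
    next
      assume j: "j \<le> count A x"
      show "repeat_mset j (mset_set S) \<subseteq># A"
      proof (rule mset_subset_eqI)
        fix y
        show "count (repeat_mset j (mset_set S)) y \<le> count A y"
          using j count_g by (cases "y \<in> S") (auto simp: S_def)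
      qed
    qed
    finally show ?thesis .
  qed
  have "{k \<in> {1..n}. x \<in> ext_field k \<and> conj_poly k x dvd f} = (\<lambda>j. e * j) ` {1..count A x}"
  proof (intro equalityI subsetI)
    fix k assume k: "k \<in> {k \<in> {1..n}. x \<in> ext_field k \<and> conj_poly k x dvd f}"
    then obtain j where "k = e * j"
      using dvd[of k] by (auto elim: dvdE)
    thus "k \<in> (\<lambda>j. e * j) ` {1..count A x}"
      using k dvd_iff[of j] by (intro image_eqI[of _ _ j]) (auto simp: Suc_le_eq)
  next
    fix k assume "k \<in> (\<lambda>j. e * j) ` {1..count A x}"
    then obtain j where "k = e * j" "j \<in> {1..count A x}"
      by blast
    hence j: "k = e * j" "1 \<le> j" "j \<le> count A x"
      by auto
    have d: "conj_poly k x dvd f"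
      using j dvd_iff by simp
    have "f \<noteq> 0"
      using f by (auto simp: monic_over_base_def)
    hence "degree (conj_poly k x) \<le> degree f"
      using d by (intro dvd_imp_degree_le)
    hence "k \<le> n"
      using f by (simp add: monic_over_base_def conj_poly_def)
    thus "k \<in> {k \<in> {1..n}. x \<in> ext_field k \<and> conj_poly k x dvd f}"
      using d j e(1) mult_e by auto
  qed
  moreover have "inj_on (\<lambda>j. e * j) {1..count A x}"
    using e(1) by (auto simp: inj_on_def)
  ultimately show ?thesis
    by (simp add: card_image A_def)
qed

text \<open>
  The analogue for polynomials of \<open>log n = \<Sum> \<Lambda> k\<close>, summed over the divisors \<open>k\<close> of \<open>n\<close>: it encodes
  unique factorization in the form needed for a logarithmic derivative.
\<close>

lemma degree_eq_sum_card_conj_poly: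
  fixes f :: "'a::finite_field alg_closure poly"
  assumes f: "f \<in> monic_over_base n"
  shows "n = (\<Sum>k=1..n. card {x \<in> ext_field k. conj_poly k x dvd f})"
proof -
  let ?R = "set_mset (proots f)"
  have f0: "f \<noteq> 0"
    using f by (auto simp: monic_over_base_def)
  have sub: "x \<in> ?R" if "conj_poly k x dvd f" "k \<ge> 1" for x k
  proof -
    have "x \<in># image_mset (\<lambda>i. x ^ CARD('a) ^ i) (mset_set {..<k})"
      using that(2) by (auto intro!: image_eqI[of _ _ 0])
    hence "x \<in># proots (conj_poly k x)"
      by (simp only: conj_poly_def proots_root_prod)
    moreover have "conj_poly k x \<noteq> 0"
      by (simp add: conj_poly_def)
    ultimately have "poly (conj_poly k x) x = 0"
      by simp
    thus ?thesis
      using that(1) f0 by (auto elim!: dvdE)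
  qed
  have "n = (\<Sum>x\<in>?R. count (proots f) x)"
    using monic_over_base_roots(2)[OF f] by (simp add: size_multiset_overloaded_eq)
  also have "\<dots> = (\<Sum>x\<in>?R. card {k \<in> {1..n}. x \<in> ext_field k \<and> conj_poly k x dvd f})"
    using card_conj_poly_dvd[OF f] by simp
  also have "\<dots> = (\<Sum>x\<in>?R. \<Sum>k=1..n. if x \<in> ext_field k \<and> conj_poly k x dvd f then 1 else 0)"
    by (simp add: sum.inter_filter[symmetric])
  also have "\<dots> = (\<Sum>k=1..n. \<Sum>x\<in>?R. if x \<in> ext_field k \<and> conj_poly k x dvd f then 1 else 0)"
    by (rule sum.swap)
  also have "\<dots> = (\<Sum>k=1..n. card {x \<in> ext_field k. conj_poly k x dvd f})"
  proof (rule sum.cong[OF refl])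
    fix k assume "k \<in> {1..n}"
    hence "{x \<in> ext_field k. conj_poly k x dvd f} = {x \<in> ?R. x \<in> ext_field k \<and> conj_poly k x dvd f}"
      using sub[of k] by auto
    thus "(\<Sum>x\<in>?R. if x \<in> ext_field k \<and> conj_poly k x dvd f then 1 else 0) =
        card {x \<in> ext_field k. conj_poly k x dvd f}"
      by (simp add: sum.inter_filter[symmetric])
  qed
  finally show ?thesis .
qed

lemma monic_over_base_mult:
  "f \<in> monic_over_base m \<Longrightarrow> h \<in> monic_over_base n \<Longrightarrow> f * h \<in> monic_over_base (m + n)"
  using coeff_mult_degree_sum[of f h]
  by (cases "f = 0 \<or> h = 0") (auto simp: monic_over_base_def frob_poly_mult degree_mult_eq)

lemma monic_over_base_cofactor:
  assumes "f \<in> monic_over_base m" "f * h \<in> monic_over_base n"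
  shows "h \<in> monic_over_base (n - m)"
proof -
  have nz: "f \<noteq> 0" "h \<noteq> 0"
    using assms by (auto simp: monic_over_base_def)
  have "f * frob_poly h = f * h"
    using assms frob_poly_mult[of f h] by (simp add: monic_over_base_def)
  moreover have "degree h = n - m" "lead_coeff h = 1"
    using assms nz coeff_mult_degree_sum[of f h] by (auto simp: monic_over_base_def degree_mult_eq)
  ultimately show ?thesis
    using nz by (simp add: monic_over_base_def)
qed

locale hasse_davenport =
  fixes \<psi> \<eta> :: "'a::finite_field \<Rightarrow> qbar"
  assumes \<psi>: "nontrivial_add_char UNIV \<psi>" and \<eta>: "\<eta> \<in> mult_chars UNIV"
begin

sublocale finite_subfield_add_char "UNIV :: 'a set" \<psi>
  by (intro finite_subfield_add_char.intro finite_subfield_UNIV finite_subfield_add_char_axioms.intro \<psi>)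

lemma poly_char_mult:
  assumes f: "f \<in> monic_over_base m" and h: "h \<in> monic_over_base n"
  shows "poly_char \<psi> \<eta> (f * h) = poly_char \<psi> \<eta> f * poly_char \<psi> \<eta> h"
proof -
  have "f * h \<noteq> 0"
    using f h by (auto simp: monic_over_base_def)
  moreover obtain s t u v where "\<Sum>\<^sub># (proots f) = to_ac s" "\<Prod>\<^sub># (proots f) = to_ac t"
     "\<Sum>\<^sub># (proots h) = to_ac u" "\<Prod>\<^sub># (proots h) = to_ac v"
    using monic_over_base_roots(4,5)[OF f] monic_over_base_roots(4,5)[OF h] by (auto elim!: rangeE)
  ultimately show ?thesis
    using add_char_add[of s u] char_mult_eq[OF \<eta>, of t v]
    by (simp add: poly_char_def proots_mult flip: to_ac_add to_ac_mult)
qed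

definition monic_char_sum :: "nat \<Rightarrow> qbar" where
  "monic_char_sum n = (\<Sum>f\<in>monic_over_base n. poly_char \<psi> \<eta> f)"

definition ext_char_sum :: "nat \<Rightarrow> qbar" where
  "ext_char_sum k = (\<Sum>x\<in>ext_field k. poly_char \<psi> \<eta> (conj_poly k x))"

text \<open>
  The identity \<open>T * A' = M * A\<close> for the L-series \<open>A\<close> and its logarithmic derivative \<open>M\<close>, coefficient by
  coefficient: the degree is replaced by a count of prime powers dividing \<open>f\<close>, and \<open>f\<close> is divided by them.
\<close>

lemma monic_char_sum_recurrence:
  "of_nat n * monic_char_sum n = (\<Sum>k=1..n. ext_char_sum k * monic_char_sum (n - k))"
proof -
  have fin: "finite (ext_field k :: 'a alg_closure set)" if "k \<ge> 1" for k
    using that finite_subfield.fin[OF finite_subfield_ext_field[of k, where 'a = 'a]] by simp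
  have "of_nat n * monic_char_sum n = (\<Sum>f\<in>monic_over_base n. poly_char \<psi> \<eta> f * of_nat n)"
    by (simp add: monic_char_sum_def sum_distrib_left mult.commute)
  also have "\<dots> = (\<Sum>f\<in>monic_over_base n. poly_char \<psi> \<eta> f * of_nat (\<Sum>k=1..n. card {x \<in> ext_field k. conj_poly k x dvd f}))"
    using degree_eq_sum_card_conj_poly by (intro sum.cong refl arg_cong2[of _ _ _ _ "(*)"] arg_cong[of _ _ of_nat])
  also have "\<dots> = (\<Sum>f\<in>monic_over_base n. \<Sum>k=1..n. \<Sum>x\<in>ext_field k. if conj_poly k x dvd f then poly_char \<psi> \<eta> f else 0)"
  proof (rule sum.cong[OF refl])
    fix f :: "'a alg_closure poly"
    have "of_nat (card {x \<in> ext_field k. conj_poly k x dvd f}) =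
        (\<Sum>x\<in>ext_field k. if conj_poly k x dvd f then 1 else 0 :: qbar)" if "k \<in> {1..n}" for k
      using that fin[of k] by (simp add: sum.inter_filter[symmetric])
    thus "poly_char \<psi> \<eta> f * of_nat (\<Sum>k=1..n. card {x \<in> ext_field k. conj_poly k x dvd f}) =
       (\<Sum>k=1..n. \<Sum>x\<in>ext_field k. if conj_poly k x dvd f then poly_char \<psi> \<eta> f else 0)"
      by (auto simp: sum_distrib_left intro!: sum.cong)
  qed
  also have "\<dots> = (\<Sum>k=1..n. \<Sum>x\<in>ext_field k. \<Sum>f\<in>monic_over_base n. if conj_poly k x dvd f then poly_char \<psi> \<eta> f else 0)"
    by (subst sum.swap, intro sum.cong refl, subst sum.swap) auto
  also have "\<dots> = (\<Sum>k=1..n. \<Sum>x\<in>ext_field k. poly_char \<psi> \<eta> (conj_poly k x) * monic_char_sum (n - k))"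
  proof (intro sum.cong refl)
    fix k and x :: "'a alg_closure" assume k: "k \<in> {1..n}" and x: "x \<in> ext_field k"
    let ?c = "conj_poly k x"
    have c: "?c \<in> monic_over_base k" "?c \<noteq> 0"
      using conj_poly_in[OF x] k by (auto simp: conj_poly_def)
    have "(\<Sum>f\<in>monic_over_base n. if ?c dvd f then poly_char \<psi> \<eta> f else 0) =
        (\<Sum>f\<in>{f \<in> monic_over_base n. ?c dvd f}. poly_char \<psi> \<eta> f)"
      by (simp add: sum.inter_filter finite_monic_over_base)
    also have "\<dots> = (\<Sum>h\<in>monic_over_base (n - k). poly_char \<psi> \<eta> (?c * h))"
    proof (rule sum.reindex_bij_witness[of _ "\<lambda>h. ?c * h" "\<lambda>f. f div ?c"])
      show "?c * h \<in> {f \<in> monic_over_base n. ?c dvd f}" if "h \<in> monic_over_base (n - k)" for h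
        using monic_over_base_mult[OF c(1) that] k by simp
      show "f div ?c \<in> monic_over_base (n - k)" if "f \<in> {f \<in> monic_over_base n. ?c dvd f}" for f
        using monic_over_base_cofactor[OF c(1), of "f div ?c" n] that by simp
    qed (use c in auto)
    also have "\<dots> = poly_char \<psi> \<eta> ?c * monic_char_sum (n - k)"
      using poly_char_mult[OF c(1)] by (simp add: monic_char_sum_def sum_distrib_left)
    finally show "(\<Sum>f\<in>monic_over_base n. if ?c dvd f then poly_char \<psi> \<eta> f else 0) =
      poly_char \<psi> \<eta> ?c * monic_char_sum (n - k)" .
  qed
  finally show ?thesis
    by (simp add: ext_char_sum_def sum_distrib_right)
qed

lemma monic_char_sum_0: "monic_char_sum 0 = 1"
proof -
  have "monic_over_base 0 = {1 :: 'a alg_closure poly}"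
    by (auto simp: monic_over_base_def elim!: degree_eq_zeroE)
  thus ?thesis
    using \<eta> by (simp add: monic_char_sum_def poly_char_def)
qed

lemma monic_char_sum_1: "monic_char_sum 1 = - gauss UNIV \<psi> \<eta>"
proof -
  have "monic_char_sum 1 = (\<Sum>a\<in>UNIV. \<psi> a * \<eta> a)"
    unfolding monic_char_sum_def
  proof (rule sum.reindex_bij_witness[of _ "\<lambda>a. [:- to_ac a, 1:]" "\<lambda>f. of_ac (- coeff f 0)"])
    fix f :: "'a alg_closure poly" assume f: "f \<in> monic_over_base 1"
    hence "f = [:coeff f 0, 1:]"
      by (intro poly_eqI) (auto simp: monic_over_base_def coeff_pCons coeff_eq_0 split: nat.splits)
    then obtain c where c: "f = [:c, 1:]" ..
    have "c \<in> range to_ac"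
      using f frob_poly_eq_iff[of f] by (auto simp: monic_over_base_def c dest: spec[of _ 0])
    then obtain a where a: "c = to_ac a"
      by auto
    show "[:- to_ac (of_ac (- coeff f 0)), 1:] = f"
      by (simp add: c a flip: to_ac_minus)
    show "\<psi> (of_ac (- coeff f 0)) * \<eta> (of_ac (- coeff f 0)) = poly_char \<psi> \<eta> f"
      by (simp add: poly_char_def c)
  next
    fix a :: 'a
    show "[:- to_ac a, 1:] \<in> monic_over_base 1"
      using in_range_to_ac_iff[of "- to_ac a"]
      by (auto simp: monic_over_base_def frob_poly_def map_poly_pCons simp flip: to_ac_minus)
  qed auto
  also have "\<dots> = (\<Sum>a\<in>UNIV - {0}. \<psi> a * \<eta> a)"
    using \<eta> by (simp add: sum_diff1)
  finally show ?thesis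
    by (simp add: gauss_def)
qed

text \<open>
  Adding \<open>- u * X ^ (n - 1)\<close> permutes the monic polynomials of degree \<open>n\<close>. It changes the sum of the roots by \<open>u\<close>
  and, as \<open>n - 1 > 0\<close>, does not change their product, so the sum is multiplied by \<open>\<psi> u\<close>.
\<close>

lemma monic_char_sum_eq_0:
  assumes n: "n \<ge> 2" shows "monic_char_sum n = 0"
proof -
  obtain u where u: "\<psi> u \<noteq> 1"
    using \<psi> by (auto simp: nontrivial_add_char_def)
  have val: "poly_char \<psi> \<eta> f = \<psi> (of_ac (- coeff f (n - 1))) * \<eta> (of_ac ((- 1) ^ n * coeff f 0))"
    if f: "f \<in> monic_over_base n" for f
  proof -
    note r = monic_over_base_roots[OF f]
    have "proots f \<noteq> {#}"
      using r(2) n by auto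
    hence "coeff f (n - 1) = - \<Sum>\<^sub># (proots f)"
      using coeff_subleading_root_prod[of "proots f"] r(1,2) by simp
    moreover have "(- 1) ^ n * coeff f 0 = \<Prod>\<^sub># (proots f)"
      using coeff_0_root_prod[of "proots f"] r(1,2)
      by (simp add: mult.assoc[symmetric] power_mult_distrib[symmetric])
    ultimately show ?thesis
      by (simp add: poly_char_def)
  qed
  \<comment> \<open>The translation by a multiple of the subleading monomial.\<close>
  define T where "T = (\<lambda>v (f :: 'a alg_closure poly). f + monom (to_ac v) (n - 1))"
  have T: "T v f \<in> monic_over_base n" if f: "f \<in> monic_over_base n" for v f
  proof -
    have deg: "degree (monom (to_ac v) (n - 1)) < degree f"
      using f n degree_monom_le[of "to_ac v" "n - 1"] by (simp add: monic_over_base_def)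
    have "coeff (T v f) i \<in> range to_ac" for i
    proof -
      obtain w where "coeff f i = to_ac w"
        using f by (auto simp: monic_over_base_def frob_poly_eq_iff)
      thus ?thesis
        by (auto simp: T_def simp flip: to_ac_add)
    qed
    moreover have "degree (T v f) = n" "coeff (T v f) n = 1"
      using f deg n by (auto simp: T_def monic_over_base_def degree_add_eq_left)
    ultimately show ?thesis
      by (simp add: monic_over_base_def frob_poly_eq_iff)
  qed
  have TT: "T u (T (- u) f) = f" "T (- u) (T u f) = f" for f
    by (simp_all add: T_def add_monom add.assoc)
  have "monic_char_sum n = (\<Sum>f\<in>monic_over_base n. poly_char \<psi> \<eta> (T (- u) f))"
    unfolding monic_char_sum_def
    by (rule sum.reindex_bij_witness[of _ "T (- u)" "T u"])
       (use T TT in auto)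
  also have "\<dots> = (\<Sum>f\<in>monic_over_base n. \<psi> u * poly_char \<psi> \<eta> f)"
  proof (rule sum.cong[OF refl])
    fix f :: "'a alg_closure poly" assume f: "f \<in> monic_over_base n"
    obtain s where s: "coeff f (n - 1) = to_ac s"
      using f frob_poly_eq_iff[of f] by (auto simp: monic_over_base_def)
    have "coeff (T (- u) f) (n - 1) = to_ac (s - u)" "coeff (T (- u) f) 0 = coeff f 0"
      using n by (simp_all add: T_def s[simplified])
    thus "poly_char \<psi> \<eta> (T (- u) f) = \<psi> u * poly_char \<psi> \<eta> f"
      using add_char_add[of u "- s"] by (simp add: val[OF T[OF f]] val[OF f] s[simplified] flip: to_ac_minus to_ac_diff)
  qed
  also have "\<dots> = \<psi> u * monic_char_sum n"
    by (simp add: monic_char_sum_def sum_distrib_left)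
  finally show ?thesis
    using u by (metis mult_cancel_right mult_1)
qed

text \<open>
  Only the terms \<open>k = n - 1\<close> and \<open>k = n\<close> of the recurrence survive in degree \<open>n \<ge> 2\<close>.
\<close>

lemma ext_char_sum_eq: "n \<ge> 1 \<Longrightarrow> ext_char_sum n = - (gauss UNIV \<psi> \<eta> ^ n)"
proof (induction n rule: dec_induct)
  case base
  show ?case
    using monic_char_sum_recurrence[of 1] by (simp add: monic_char_sum_0 monic_char_sum_1[simplified])
next
  case (step n)
  have "(\<Sum>k=1..Suc n. ext_char_sum k * monic_char_sum (Suc n - k)) =
      (\<Sum>k\<in>{n, Suc n}. ext_char_sum k * monic_char_sum (Suc n - k))"
    using step.hyps by (intro sum.mono_neutral_right) (auto intro!: monic_char_sum_eq_0)
  moreover have "monic_char_sum (Suc n) = 0"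
    using step.hyps by (intro monic_char_sum_eq_0) auto
  ultimately have "ext_char_sum (Suc n) = - (ext_char_sum n * monic_char_sum 1)"
    using monic_char_sum_recurrence[of "Suc n"]
    by (simp add: monic_char_sum_0 eq_neg_iff_add_eq_0 add.commute del: of_nat_Suc)
  thus ?case
    using step.IH monic_char_sum_1 by (simp add: mult.commute)
qed

text \<open>
  The Hasse-Davenport relation. The sign in the definition of the Gauss sum makes it a plain power.
\<close>

proposition gauss_lift:
  assumes r: "r \<ge> 1"
  shows "gauss (ext_field r) (\<lambda>x. \<psi> (ext_trace r x)) (lift_char r \<eta>) = gauss UNIV \<psi> \<eta> ^ r"
proof -
  interpret E: finite_subfield "ext_field r :: 'a alg_closure set"
    using r by (intro finite_subfield_ext_field) auto
  have "lift_char r \<eta> 0 = 0"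
    using lift_char_in[OF \<eta>, of r] r by simp
  hence "gauss (ext_field r) (\<lambda>x. \<psi> (ext_trace r x)) (lift_char r \<eta>) = - ext_char_sum r"
    unfolding gauss_def ext_char_sum_def poly_char_conj_poly
    by (simp add: sum_diff1) (simp add: lift_char_def)
  thus ?thesis
    using ext_char_sum_eq[OF r] by simp
qed

end

text \<open>
  Jacobi sums do not involve an additive character, so the trace of one over the base field may be
  used to write them as quotients of Gauss sums over the extension.
\<close>

proposition jacobi_lift:
  fixes \<eta> :: "'i \<Rightarrow> 'a::finite_field \<Rightarrow> qbar"
  assumes \<psi>: "nontrivial_add_char (UNIV :: 'a set) \<psi>" and r: "r \<ge> 1"
    and I: "finite I" "I \<noteq> {}" and \<eta>: "\<And>i. i \<in> I \<Longrightarrow> \<eta> i \<in> mult_chars UNIV"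
    and nt: "\<exists>i\<in>I. \<eta> i \<noteq> triv_char UNIV"
  shows "jacobi (ext_field r) I (\<lambda>i. lift_char r (\<eta> i)) = jacobi UNIV I \<eta> ^ r"
proof -
  let ?\<psi> = "\<lambda>x. \<psi> (ext_trace r x)"
  have r0: "r > 0"
    using r by simp
  interpret U: finite_subfield_add_char "UNIV :: 'a set" \<psi>
    by (intro finite_subfield_add_char.intro finite_subfield_UNIV finite_subfield_add_char_axioms.intro \<psi>)
  interpret E: finite_subfield_add_char "ext_field r :: 'a alg_closure set" ?\<psi>
    by (intro finite_subfield_add_char.intro finite_subfield_ext_field r0
        finite_subfield_add_char_axioms.intro trace_add_char \<psi>)
  have gl: "gauss (ext_field r) ?\<psi> (lift_char r \<theta>) = gauss UNIV \<psi> \<theta> ^ r"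
    if "\<theta> \<in> mult_chars UNIV" for \<theta>
    using hasse_davenport.gauss_lift[OF hasse_davenport.intro[OF \<psi> that] r] .
  define \<chi> where "\<chi> = char_prod UNIV I \<eta>"
  have \<chi>: "\<chi> \<in> mult_chars UNIV"
    unfolding \<chi>_def using \<eta> by (rule U.char_prod_in)
  have gcl: "gauss_circ (ext_field r) ?\<psi> (lift_char r \<chi>) = gauss_circ UNIV \<psi> \<chi> ^ r"
    using lift_char_eq_triv_iff[OF \<chi> r0] r0
    by (simp add: gauss_circ_def char_delta_def gl[OF \<chi>] power_mult_distrib card_ext_field)
  have "jacobi (ext_field r) I (\<lambda>i. lift_char r (\<eta> i)) * gauss_circ UNIV \<psi> \<chi> ^ r =
      (\<Prod>i\<in>I. gauss (ext_field r) ?\<psi> (lift_char r (\<eta> i)))"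
    using E.jacobi_mult_gauss_circ[OF I, of "\<lambda>i. lift_char r (\<eta> i)"] \<eta> nt r0
    by (simp add: lift_char_in lift_char_eq_triv_iff lift_char_prod[OF r0, symmetric] \<chi>_def[symmetric] gcl)
  also have "\<dots> = (\<Prod>i\<in>I. gauss UNIV \<psi> (\<eta> i)) ^ r"
    using gl \<eta> by (simp add: prod_power_distrib)
  also have "(\<Prod>i\<in>I. gauss UNIV \<psi> (\<eta> i)) = jacobi UNIV I \<eta> * gauss_circ UNIV \<psi> \<chi>"
    unfolding \<chi>_def using U.jacobi_mult_gauss_circ[OF I \<eta> nt] by simp
  finally show ?thesis
    using U.gauss_circ_nonzero[OF \<chi>] by (simp add: power_mult_distrib)
qed

section \<open>Point counts on superelliptic hypersurfaces\<close>

lemma exp_series_cong: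
  assumes "\<And>r. r \<ge> 1 \<Longrightarrow> u r = v r" shows "exp_series u = exp_series v"
proof -
  have "Abs_fps (\<lambda>r. if r = 0 then 0 else u r / of_nat r) = Abs_fps (\<lambda>r. if r = 0 then 0 else v r / of_nat r)"
    using assms by (auto simp: fps_eq_iff)
  thus ?thesis
    by (simp add: exp_series_def)
qed

text \<open>
  Both \<open>exp_series\<close> of the powers of \<open>a\<close> and the geometric series satisfy the differential equation
  \<open>E' * (1 - a * X) = a * E\<close> with constant coefficient 1.
\<close>

lemma exp_series_geometric: "exp_series (\<lambda>r. a ^ r) = 1 / (1 - fps_const a * fps_X)"
proof -
  define u :: "qbar fps" where "u = Abs_fps (\<lambda>r. if r = 0 then 0 else a ^ r / of_nat r)"
  define D :: "qbar fps" where "D = 1 - fps_const a * fps_X"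
  define E where "E = fps_exp 1 oo u"
  have D0: "D $ 0 = 1"
    by (simp add: D_def)
  have dD: "fps_deriv D = - fps_const a"
    by (simp add: D_def)
  have u0: "u $ 0 = 0"
    by (simp add: u_def)
  have du: "fps_deriv u = fps_const a * Abs_fps (\<lambda>r. a ^ r)"
    by (auto simp: fps_eq_iff u_def simp del: of_nat_Suc)
  have "Abs_fps (\<lambda>r. a ^ r) * D = 1"
  proof (rule fps_ext)
    fix k
    show "(Abs_fps (\<lambda>r. a ^ r) * D) $ k = (1 :: qbar fps) $ k"
      by (cases k) (simp_all add: D_def right_diff_distrib mult.assoc[symmetric] mult.commute[of _ "fps_const a"])
  qed
  hence duD: "fps_deriv u * D = fps_const a"
    by (simp add: du mult.assoc)
  have "fps_deriv E = E * fps_deriv u"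
    unfolding E_def by (subst fps_compose_deriv) (simp_all add: u0)
  hence "fps_deriv (E * D) = E * (fps_deriv u * D) + E * fps_deriv D"
    by (simp add: mult_ac)
  also have "\<dots> = 0"
    unfolding duD dD by (simp del: fps_const_neg)
  finally have "E * D = fps_const ((E * D) $ 0)"
    by (simp only: fps_deriv_eq_0_iff)
  also have "(E * D) $ 0 = 1"
    by (simp add: D0 E_def)
  finally have "E * D = 1"
    by simp
  hence "E = 1 / D"
    using D0 by (metis fps_divide_unit fps_inverse_unique mult.commute mult_1 zero_neq_one)
  thus ?thesis
    by (simp add: exp_series_def E_def u_def D_def)
qed

lemma of_nat_card_finite_field: "of_nat CARD('a::finite_field) = (0 :: 'a)"
proof -
  obtain k where k: "CARD('a) = CHAR('a) ^ k"
    using card_finite_field_eq_CHAR_power by blast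
  hence "k > 0"
    using card_finite_field_gt_1[where 'a = 'a] by (cases k) auto
  thus ?thesis
    using k by (simp add: power_0_left)
qed

context
  fixes d :: nat
  assumes d: "d > 0" and dvd: "d dvd CARD('a::finite_field) - 1"
begin

lemma of_nat_index_nonzero: "of_nat d \<noteq> (0 :: 'a alg_closure)"
proof
  assume "of_nat d = (0 :: 'a alg_closure)"
  moreover obtain k where "CARD('a) - 1 = d * k"
    using dvd by blast
  ultimately have "of_nat (CARD('a) - 1) = (0 :: 'a alg_closure)"
    by (simp only: of_nat_mult mult_zero_left)
  hence "of_nat (CARD('a) - 1) = (0 :: 'a)"
    by (metis to_ac_eq_0_iff to_ac_of_nat)
  thus False
    using card_finite_field_gt_1[where 'a = 'a] of_nat_card_finite_field[where 'a = 'a]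
    by (simp add: of_nat_diff)
qed

lemma card_mu: "card (mu d :: 'a set) = d"
proof -
  have "to_ac ` (mu d :: 'a set) = {z. z ^ d = 1}"
  proof (intro equalityI subsetI)
    fix z :: "'a alg_closure" assume "z \<in> {z. z ^ d = 1}"
    hence z: "z ^ d = 1" by simp
    hence "z ^ (CARD('a) - 1) = 1"
      using dvd by (auto elim!: dvdE simp: power_mult)
    hence "z ^ CARD('a) = z"
      using power_minus_mult[of "CARD('a)" z] by simp
    then obtain w where "z = to_ac w"
      using in_range_to_ac_iff[of z] by auto
    thus "z \<in> to_ac ` mu d"
      using z by (auto simp: mu_def simp flip: to_ac_power)
  qed (auto simp: mu_def simp flip: to_ac_power)
  hence "card (to_ac ` (mu d :: 'a set)) = d"
    using card_power_eq_alg_closed(2)[OF one_neq_zero of_nat_index_nonzero] by simp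
  thus ?thesis
    by (subst (asm) card_image) (auto intro: inj_on_subset[OF inj_to_ac])
qed

text \<open>
  With \<open>s = 1 + q + \<dots> + q ^ (r - 1)\<close> one has \<open>y ^ (q ^ r - 1) = (y ^ d) ^ (s * ((q - 1) / d))\<close>, and \<open>c ^ s\<close> is
  the norm of \<open>c\<close>. So the condition on \<open>y\<close> depends only on \<open>c\<close> and holds for all \<open>d\<close> roots or for none.
\<close>

lemma card_twisted_roots:
  fixes c :: "'a alg_closure" and \<zeta> :: 'a
  assumes c: "c \<in> ext_field r" "c \<noteq> 0" and r: "r > 0"
  shows "card {y. y ^ d = c \<and> y ^ (CARD('a) ^ r) = to_ac \<zeta> * y} =
    (if \<zeta> = ext_norm r c ^ ((CARD('a) - 1) div d) then d else 0)"
proof -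
  let ?q = "CARD('a)"
  define e where "e = (?q - 1) div d"
  define s where "s = (\<Sum>i<r. ?q ^ i)"
  have e: "e * d = ?q - 1"
    using dvd by (simp add: e_def)
  have qr: "?q ^ r - 1 = d * (s * e)"
  proof -
    have "s * (?q - 1) = ?q ^ r - 1"
      unfolding s_def by (rule sum_powers_times_pred) simp
    thus ?thesis
      unfolding e[symmetric] by (simp only: mult_ac)
  qed
  have cs: "c ^ (s * e) = to_ac (ext_norm r c ^ e)"
    using to_ac_ext_norm[OF c(1) r] by (simp add: power_mult s_def power_sum)
  have "y ^ (?q ^ r) = to_ac \<zeta> * y \<longleftrightarrow> \<zeta> = ext_norm r c ^ e" if y: "y ^ d = c" for y
  proof -
    have y0: "y \<noteq> 0"
      using y c d by (auto simp: power_0_left)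
    have "y ^ (?q ^ r) = y ^ (?q ^ r - 1) * y"
      by (rule power_minus_mult[symmetric]) simp
    also have "y ^ (?q ^ r - 1) = to_ac (ext_norm r c ^ e)"
      unfolding qr power_mult[of y d] y cs ..
    finally show ?thesis
      using y0 by (auto simp del: to_ac_power)
  qed
  hence "{y. y ^ d = c \<and> y ^ (?q ^ r) = to_ac \<zeta> * y} = (if \<zeta> = ext_norm r c ^ e then {y. y ^ d = c} else {})"
    by auto
  thus ?thesis
    using card_power_eq_alg_closed(2)[OF c(2) of_nat_index_nonzero] by (simp add: e_def)
qed

context
  fixes \<phi> \<phi>d :: "'a \<Rightarrow> qbar"
  assumes gen: "generates_mult_chars UNIV \<phi>"
    and phi_d: "\<phi>d = char_pow \<phi> (int ((CARD('a) - 1) div d))"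
begin

interpretation U: finite_subfield "UNIV :: 'a set"
  by (rule finite_subfield_UNIV)

lemma generator_in: "\<phi> \<in> mult_chars UNIV"
  using gen by (simp add: generates_mult_chars_def)

text \<open>
  A smaller exponent \<open>r\<close> would leave only \<open>r\<close> distinct powers of \<open>\<phi>\<close>, but there are \<open>card K - 1\<close>
  characters.
\<close>

lemma generator_pow_eq_triv_iff: "char_pow \<phi> k = triv_char UNIV \<longleftrightarrow> int (CARD('a) - 1) dvd k"
proof -
  let ?N = "int (CARD('a) - 1)"
  have nz: "\<phi> x \<noteq> 0 \<longleftrightarrow> x \<noteq> 0" for x
    using U.char_eq_0_iff[OF generator_in, of x] by auto
  have N: "?N > 0"
    using card_finite_field_gt_1[where 'a = 'a] by simp
  have per: "char_pow \<phi> k = char_pow \<phi> (k mod j)" if "char_pow \<phi> j = triv_char UNIV" for k j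
  proof
    fix x
    show "char_pow \<phi> k x = char_pow \<phi> (k mod j) x"
    proof (cases "x = 0")
      case False
      hence one: "\<phi> x powi j = 1"
        using fun_cong[OF that, of x] nz by (simp add: char_pow_def triv_char_def)
      have "\<phi> x powi k = \<phi> x powi (j * (k div j) + k mod j)"
        by simp
      also have "\<dots> = \<phi> x powi (k mod j)"
        using False nz one by (subst power_int_add) (auto simp: power_int_mult)
      finally show ?thesis
        using False nz by (simp add: char_pow_def)
    qed (use nz in \<open>simp add: char_pow_def\<close>)
  qed
  have full: "char_pow \<phi> ?N = triv_char UNIV"
    unfolding fun_eq_iff char_pow_def power_int_of_nat
    using U.char_unit_power[OF generator_in] nz by (auto simp: triv_char_def)
  show ?thesis
  proof
    assume "?N dvd k"
    hence "k mod ?N = 0"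
      by simp
    hence "char_pow \<phi> k = char_pow \<phi> 0"
      using per[OF full, of k] by simp
    thus "char_pow \<phi> k = triv_char UNIV"
      using nz by (auto simp: char_pow_def triv_char_def fun_eq_iff)
  next
    assume k: "char_pow \<phi> k = triv_char UNIV"
    define r where "r = k mod ?N"
    have r: "char_pow \<phi> r = triv_char UNIV" "0 \<le> r" "r < ?N"
      using per[OF full, of k] k N by (simp_all add: r_def)
    have "r = 0"
    proof (rule ccontr)
      assume "r \<noteq> 0"
      hence r0: "r > 0"
        using r by simp
      have "mult_chars UNIV \<subseteq> (\<lambda>j. char_pow \<phi> j) ` {0..<r}"
      proof
        fix \<eta> :: "'a \<Rightarrow> qbar" assume "\<eta> \<in> mult_chars UNIV"
        then obtain j where "\<eta> = char_pow \<phi> j"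
          using gen by (auto simp: generates_mult_chars_def)
        hence "\<eta> = char_pow \<phi> (j mod r)"
          using per[OF r(1)] by simp
        thus "\<eta> \<in> (\<lambda>j. char_pow \<phi> j) ` {0..<r}"
          using r0 by auto
      qed
      hence "card (mult_chars (UNIV :: 'a set)) \<le> card {0..<r}"
        by (metis card_image_le card_mono finite_atLeastLessThan_int finite_imageI le_trans)
      thus False
        using r by (simp add: U.card_mult_chars)
    qed
    thus "?N dvd k"
      by (simp add: r_def dvd_eq_mod_eq_0)
  qed
qed

lemma phi_d_in: "\<phi>d \<in> mult_chars UNIV"
  unfolding phi_d by (intro U.char_pow_in generator_in)

lemma phi_d_apply: "\<phi>d x = \<phi> (x ^ ((CARD('a) - 1) div d))"
proof (cases "x = 0")
  case True
  have "(CARD('a) - 1) div d > 0"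
    using dvd d card_finite_field_gt_1[where 'a = 'a] by (simp add: div_greater_zero_iff dvd_imp_le)
  thus ?thesis
    using True generator_in by (simp add: phi_d char_pow_def power_0_left)
next
  case False
  thus ?thesis
    using U.char_eq_0_iff[OF generator_in, of x]
    by (simp add: phi_d char_pow_def power_int_of_nat U.char_power[OF generator_in])
qed

lemma phi_d_pow_eq_triv_iff: "char_pow \<phi>d k = triv_char UNIV \<longleftrightarrow> int d dvd k"
proof -
  let ?e = "int ((CARD('a) - 1) div d)"
  have e: "?e * int d = int (CARD('a) - 1)"
    using dvd by (simp only: of_nat_mult[symmetric]) simp
  have "?e \<noteq> 0"
  proof
    assume "?e = 0"
    thus False
      using e card_finite_field_gt_1[where 'a = 'a] by simp
  qed
  have "char_pow \<phi>d k = char_pow \<phi> (?e * k)"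
    by (auto simp: phi_d char_pow_def fun_eq_iff power_int_mult)
  thus ?thesis
    using \<open>?e \<noteq> 0\<close> by (simp only: generator_pow_eq_triv_iff e[symmetric] dvd_mult_cancel_left) simp
qed

text \<open>
  The restriction of \<open>\<phi>\<close> to \<open>mu d\<close> has order \<open>d\<close>: the elements \<open>x ^ ((q - 1) / d)\<close> lie in \<open>mu d\<close>, and \<open>\<phi>\<close> takes
  the value \<open>\<phi>d x\<close> on them.
\<close>

lemma mu_char_sum:
  "(\<Sum>\<zeta>\<in>mu d. char_pow (restrict \<phi> (mu d)) m \<zeta>) = (if int d dvd m then of_nat d else 0)"
proof -
  have mu0: "\<zeta> \<noteq> 0" if "\<zeta> \<in> mu d" for \<zeta> :: 'a
    using that d by (auto simp: mu_def power_0_left)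
  have val: "char_pow (restrict \<phi> (mu d)) m \<zeta> = char_pow \<phi> m \<zeta>" if "\<zeta> \<in> mu d" for \<zeta>
    using that by (simp add: char_pow_def)
  have pin: "char_pow \<phi> m \<in> mult_chars UNIV"
    by (intro U.char_pow_in generator_in)
  show ?thesis
  proof (cases "int d dvd m")
    case True
    then obtain j where j: "m = int d * j"
      by (auto elim: dvdE)
    have "char_pow \<phi> m \<zeta> = 1" if "\<zeta> \<in> mu d" for \<zeta>
    proof -
      have "\<phi> \<zeta> ^ d = 1"
        using that U.char_power[OF generator_in, of \<zeta> d] generator_in by (simp add: mu_def)
      moreover have "\<phi> \<zeta> \<noteq> 0"
        using U.char_eq_0_iff[OF generator_in, of \<zeta>] mu0[OF that] by simp
      ultimately show ?thesis
        by (simp add: char_pow_def j power_int_mult power_int_of_nat)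
    qed
    thus ?thesis
      using True by (simp add: val card_mu)
  next
    case False
    hence "char_pow \<phi>d m \<noteq> triv_char UNIV"
      by (simp add: phi_d_pow_eq_triv_iff)
    then obtain x where x: "x \<noteq> 0" "char_pow \<phi>d m x \<noteq> 1"
      using U.char_eqI[OF U.char_pow_in[OF phi_d_in, of m] U.triv_char_in] by (auto simp: triv_char_def)
    define \<omega> where "\<omega> = x ^ ((CARD('a) - 1) div d)"
    have \<omega>: "\<omega> \<in> mu d"
      using U.unit_power[of x] x(1) dvd by (simp add: mu_def \<omega>_def power_mult[symmetric])
    have \<omega>1: "char_pow \<phi> m \<omega> \<noteq> 1"
      using x(2) unfolding char_pow_def[of _ m] phi_d_apply \<omega>_def .
    have "(\<Sum>\<zeta>\<in>mu d. char_pow \<phi> m \<zeta>) = (\<Sum>\<zeta>\<in>mu d. char_pow \<phi> m (\<omega> * \<zeta>))"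
      by (rule sum.reindex_bij_witness[of _ "\<lambda>\<zeta>. \<omega> * \<zeta>" "\<lambda>\<zeta>. \<zeta> / \<omega>"])
         (use \<omega> mu0[OF \<omega>] in \<open>auto simp: mu_def power_mult_distrib power_divide\<close>)
    also have "\<dots> = char_pow \<phi> m \<omega> * (\<Sum>\<zeta>\<in>mu d. char_pow \<phi> m \<zeta>)"
      using U.char_mult_eq[OF pin] by (simp add: sum_distrib_left)
    finally have "(\<Sum>\<zeta>\<in>mu d. char_pow \<phi> m \<zeta>) = 0"
      using \<omega>1 by (metis mult_cancel_right mult_1)
    thus ?thesis
      using False by (simp add: val)
  qed
qed

lemma frobenius_power:
  assumes "x \<in> extensional {1..n}"
  shows "(frobenius n ^^ r) (x, y) = (\<lambda>i\<in>{1..n}. x i ^ (CARD('a) ^ r), (y :: 'a alg_closure) ^ (CARD('a) ^ r))"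
proof (induction r)
  case 0
  show ?case
    using assms by (auto simp: fun_eq_iff extensional_def)
next
  case (Suc r)
  thus ?case
    by (auto simp: frobenius_def fun_eq_iff power_mult[symmetric] mult.commute)
qed

text \<open>
  The fixed points of the twisted Frobenius are fibred over the points \<open>x\<close> of \<open>K ^ n\<close>. A fibre with
  \<open>P x \<noteq> 0\<close> is met by a single \<open>\<zeta>\<close>, at which \<open>\<phi>\<close> is the lifted character of \<open>P x\<close>; the fibre over a zero of \<open>P\<close> is met once by every \<open>\<zeta>\<close>,
  so that the full character sum over \<open>mu d\<close> appears.
\<close>

lemma twisted_count_superelliptic:
  fixes P :: "(nat \<Rightarrow> 'a alg_closure) \<Rightarrow> 'a alg_closure"
  assumes r: "r > 0" and P: "\<And>x. x \<in> {1..n} \<rightarrow>\<^sub>E ext_field r \<Longrightarrow> P x \<in> ext_field r"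
  shows "twisted_count (mu d) mu_act {(x, y) \<in> affine_space n. y ^ d = P x} (frobenius n)
      (char_pow (restrict \<phi> (mu d)) m) r =
    (\<Sum>x\<in>{1..n} \<rightarrow>\<^sub>E ext_field r. if P x = 0 then (if int d dvd m then 1 else 0)
       else char_pow (lift_char r \<phi>d) m (P x))"
proof -
  let ?V = "{(x, y) \<in> affine_space n. y ^ d = P x}"
  let ?X = "{1..n} \<rightarrow>\<^sub>E (ext_field r :: 'a alg_closure set)"
  let ?Q = "CARD('a) ^ r"
  define \<theta> where "\<theta> = char_pow (restrict \<phi> (mu d)) m"
  define Y where "Y = (\<lambda>(\<zeta> :: 'a) c. {y :: 'a alg_closure. y ^ d = c \<and> y ^ ?Q = to_ac \<zeta> * y})"
  interpret E: finite_subfield "ext_field r :: 'a alg_closure set"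
    using r by (rule finite_subfield_ext_field)
  have finX: "finite ?X"
    by (intro finite_PiE) auto
  have fixed: "{p \<in> ?V. (frobenius n ^^ r) p = mu_act \<zeta> p} = Sigma ?X (\<lambda>x. Y \<zeta> (P x))" for \<zeta>
  proof (intro equalityI subsetI)
    fix p assume "p \<in> {p \<in> ?V. (frobenius n ^^ r) p = mu_act \<zeta> p}"
    then obtain x y where p: "p = (x, y)" "x \<in> {1..n} \<rightarrow>\<^sub>E UNIV" "y ^ d = P x"
      "(frobenius n ^^ r) (x, y) = mu_act \<zeta> (x, y)"
      by (auto simp: affine_space_def)
    have ext: "x \<in> extensional {1..n}"
      using p(2) by (simp add: PiE_iff)
    have *: "(\<lambda>i\<in>{1..n}. x i ^ ?Q) = x" "y ^ ?Q = to_ac \<zeta> * y"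
      using p(4) unfolding frobenius_power[OF ext] mu_act_def by simp_all
    have "x i \<in> ext_field r" if "i \<in> {1..n}" for i
      using fun_cong[OF *(1), of i] that by (simp add: ext_field_def)
    thus "p \<in> Sigma ?X (\<lambda>x. Y \<zeta> (P x))"
      using p * ext by (auto simp: Y_def PiE_iff)
  next
    fix p assume "p \<in> Sigma ?X (\<lambda>x. Y \<zeta> (P x))"
    then obtain x y where p: "p = (x, y)" "x \<in> ?X" "y \<in> Y \<zeta> (P x)"
      by auto
    have ext: "x \<in> extensional {1..n}"
      using p(2) by (simp add: PiE_iff)
    have "(\<lambda>i\<in>{1..n}. x i ^ ?Q) = x"
      using p(2) ext by (auto simp: fun_eq_iff PiE_iff ext_field_def extensional_def)
    thus "p \<in> {p \<in> ?V. (frobenius n ^^ r) p = mu_act \<zeta> p}"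
      using p ext by (simp add: frobenius_power mu_act_def affine_space_def Y_def PiE_iff)
  qed
  have Y0: "Y \<zeta> 0 = {0}" for \<zeta>
    using d by (auto simp: Y_def power_0_left)
  have finY: "finite (Y \<zeta> c)" for \<zeta> c
  proof (cases "c = 0")
    case True
    thus ?thesis by (simp add: Y0)
  next
    case False
    thus ?thesis
      using card_power_eq_alg_closed(1)[OF False of_nat_index_nonzero] by (auto simp: Y_def)
  qed
  have "twisted_count (mu d) mu_act ?V (frobenius n) \<theta> r =
      1 / of_nat d * (\<Sum>\<zeta>\<in>mu d. \<theta> \<zeta> * of_nat (\<Sum>x\<in>?X. card (Y \<zeta> (P x))))"
    unfolding twisted_count_def card_mu fixed using finX finY by simp
  also have "\<dots> = 1 / of_nat d * (\<Sum>x\<in>?X. \<Sum>\<zeta>\<in>mu d. \<theta> \<zeta> * of_nat (card (Y \<zeta> (P x))))"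
    by (simp add: sum_distrib_left sum.swap[of _ _ "mu d"])
  also have "\<dots> = 1 / of_nat d * (\<Sum>x\<in>?X. of_nat d * (if P x = 0 then (if int d dvd m then 1 else 0)
       else char_pow (lift_char r \<phi>d) m (P x)))"
  proof (intro arg_cong2[of _ _ _ _ "(*)"] sum.cong refl)
    fix x assume x: "x \<in> ?X"
    show "(\<Sum>\<zeta>\<in>mu d. \<theta> \<zeta> * of_nat (card (Y \<zeta> (P x)))) =
        of_nat d * (if P x = 0 then (if int d dvd m then 1 else 0) else char_pow (lift_char r \<phi>d) m (P x))"
    proof (cases "P x = 0")
      case True
      thus ?thesis
        using mu_char_sum[of m] by (simp add: Y0 \<theta>_def[symmetric])
    next
      case False
      define \<omega> where "\<omega> = ext_norm r (P x) ^ ((CARD('a) - 1) div d)"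
      have "ext_norm r (P x) \<noteq> 0"
        using ext_norm_eq_0_iff[OF P[OF x] r] False by simp
      hence \<omega>: "\<omega> \<in> mu d"
        using U.unit_power[of "ext_norm r (P x)"] dvd by (simp add: mu_def \<omega>_def power_mult[symmetric])
      have fin: "finite (mu d :: 'a set)"
        by simp
      have "(\<Sum>\<zeta>\<in>mu d. \<theta> \<zeta> * of_nat (card (Y \<zeta> (P x)))) = (\<Sum>\<zeta>\<in>mu d. if \<zeta> = \<omega> then \<theta> \<zeta> * of_nat d else 0)"
        unfolding Y_def card_twisted_roots[OF P[OF x] False r] \<omega>_def by (intro sum.cong) auto
      also have "\<dots> = \<theta> \<omega> * of_nat d"
        using \<omega> fin by (simp add: sum.delta)
      also have "\<theta> \<omega> = char_pow (lift_char r \<phi>d) m (P x)"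
        using \<omega> phi_d_apply[of "ext_norm r (P x)"] P[OF x]
        by (simp add: \<theta>_def char_pow_def[of _ m] lift_char_def \<omega>_def)
      finally show ?thesis
        using False by (simp add: mult.commute)
    qed
  qed
  also have "\<dots> = (\<Sum>x\<in>?X. if P x = 0 then (if int d dvd m then 1 else 0) else char_pow (lift_char r \<phi>d) m (P x))"
    using d by (simp add: sum_distrib_left)
  finally show ?thesis
    unfolding \<theta>_def .
qed

proposition L_mu_superelliptic:
  fixes P :: "(nat \<Rightarrow> 'a alg_closure) \<Rightarrow> 'a alg_closure"
  assumes P: "\<And>r x. r > 0 \<Longrightarrow> x \<in> {1..n} \<rightarrow>\<^sub>E ext_field r \<Longrightarrow> P x \<in> ext_field r"
  shows "L_mu n d {(x, y) \<in> affine_space n. y ^ d = P x} \<phi> m =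
    (if int d dvd m then 1 / (1 - of_nat (CARD('a) ^ n) * fps_X)
     else exp_series (\<lambda>r. \<Sum>x\<in>{1..n} \<rightarrow>\<^sub>E ext_field r. char_pow (lift_char r \<phi>d) m (P x)))"
proof (cases "int d dvd m")
  case True
  have "twisted_count (mu d) mu_act {(x, y) \<in> affine_space n. y ^ d = P x} (frobenius n)
      (char_pow (restrict \<phi> (mu d)) m) r = of_nat (CARD('a) ^ n) ^ r" if "r \<ge> 1" for r
  proof -
    have r: "r > 0"
      using that by simp
    interpret E: finite_subfield "ext_field r :: 'a alg_closure set"
      using r by (rule finite_subfield_ext_field)
    have "char_pow (lift_char r \<phi>d) m = triv_char (ext_field r)"
      using lift_char_eq_triv_iff[OF U.char_pow_in[OF phi_d_in] r, of m] True
      by (simp add: lift_char_pow phi_d_pow_eq_triv_iff)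
    hence "(\<Sum>x\<in>{1..n} \<rightarrow>\<^sub>E ext_field r. if P x = 0 then (if int d dvd m then 1 else 0)
       else char_pow (lift_char r \<phi>d) m (P x)) = (\<Sum>x\<in>{1..n} \<rightarrow>\<^sub>E (ext_field r :: 'a alg_closure set). 1)"
      using True P[OF r] by (intro sum.cong) (auto simp: triv_char_def)
    also have "\<dots> = of_nat (CARD('a) ^ n) ^ r"
      by (simp add: card_PiE card_ext_field[OF r] power_mult[symmetric] mult.commute)
    finally show ?thesis
      using twisted_count_superelliptic[OF r P[OF r], where m = m] by simp
  qed
  hence "L_mu n d {(x, y) \<in> affine_space n. y ^ d = P x} \<phi> m = exp_series (\<lambda>r. of_nat (CARD('a) ^ n) ^ r)"
    unfolding L_mu_def artin_L_def by (intro exp_series_cong)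
  thus ?thesis
    using True exp_series_geometric[of "of_nat (CARD('a) ^ n)"]
    unfolding fps_of_nat by (simp del: of_nat_power)
next
  case False
  have "twisted_count (mu d) mu_act {(x, y) \<in> affine_space n. y ^ d = P x} (frobenius n)
      (char_pow (restrict \<phi> (mu d)) m) r =
      (\<Sum>x\<in>{1..n} \<rightarrow>\<^sub>E ext_field r. char_pow (lift_char r \<phi>d) m (P x))" if "r \<ge> 1" for r
  proof -
    have r: "r > 0"
      using that by simp
    interpret E: finite_subfield "ext_field r :: 'a alg_closure set"
      using r by (rule finite_subfield_ext_field)
    have "char_pow (lift_char r \<phi>d) m 0 = 0"
      using E.char_0[OF E.char_pow_in[OF lift_char_in[OF phi_d_in r]]] by simp
    thus ?thesis
      using twisted_count_superelliptic[OF r P[OF r], where m = m] False by (auto intro!: sum.cong)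
  qed
  thus ?thesis
    using False unfolding L_mu_def artin_L_def by (auto intro!: exp_series_cong)
qed

end

end

section \<open>The L-functions\<close>

lemma char_pow_mult: "char_pow \<theta> (j * k) = char_pow (char_pow \<theta> j) k"
  by (auto simp: char_pow_def fun_eq_iff power_int_mult)

lemma char_pow_uminus: "char_pow \<theta> (- k) = char_pow (char_pow \<theta> k) (- 1)"
  using char_pow_mult[of \<theta> k "- 1"] by simp

lemma char_pow_add: "char_pow \<theta> (j + k) = char_mult (char_pow \<theta> j) (char_pow \<theta> k)"
  by (auto simp: char_pow_def char_mult_def fun_eq_iff power_int_add)

lemma char_pow_nat: "k > 0 \<Longrightarrow> char_pow \<theta> (int k) x = \<theta> x ^ k"
  by (auto simp: char_pow_def power_int_of_nat)

context finite_subfield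
begin

lemma char_pow_sum:
  assumes \<theta>: "\<theta> \<in> mult_chars K" and I: "finite I"
  shows "char_prod K I (\<lambda>i. char_pow \<theta> (k i)) = char_pow \<theta> (\<Sum>i\<in>I. k i)"
proof
  fix x
  show "char_prod K I (\<lambda>i. char_pow \<theta> (k i)) x = char_pow \<theta> (\<Sum>i\<in>I. k i) x"
  proof (cases "x \<in> K - {0}")
    case True
    hence nz: "\<theta> x \<noteq> 0"
      using char_eq_0_iff[OF \<theta>] by simp
    have "(\<Prod>i\<in>I. \<theta> x powi k i) = \<theta> x powi (\<Sum>i\<in>I. k i)"
      using I nz by (induction I rule: finite_induct) (simp_all add: power_int_add)
    thus ?thesis
      using True nz by (simp add: char_prod_apply char_pow_def)
  next
    case False
    thus ?thesis
      using char_eq_0_iff[OF \<theta>, of x] by (auto simp: char_prod_def triv_char_def char_pow_def)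
  qed
qed

end

context finite_subfield_add_char
begin

text \<open>
  Positive exponents are needed here: the zeroth power of a character is the trivial character, which
  vanishes at 0, whereas \<open>0 ^ 0 = 1\<close>.
\<close>

lemma char_sum_A:
  assumes \<chi>: "\<chi> \<in> mult_chars K"
    and pos: "a > 0" "\<And>i. i \<in> {1..n} \<Longrightarrow> bs i > 0" "\<And>i. i \<in> {1..n} \<Longrightarrow> cs i > 0"
    and nt: "char_pow \<chi> (int a) \<noteq> triv_char K" "\<And>i. i \<in> {1..n} \<Longrightarrow> char_pow \<chi> (int (cs i)) \<noteq> triv_char K"
    and l: "\<And>i. i \<in> {1..n} \<Longrightarrow> l i \<in> K - {0}"
  shows "(\<Sum>x\<in>{1..n} \<rightarrow>\<^sub>E K. \<chi> ((1 - (\<Sum>i=1..n. l i * x i)) ^ a * (\<Prod>i=1..n. x i ^ bs i * (1 - x i) ^ cs i))) =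
    (\<Prod>i=1..n. - jacobi2 K (char_pow \<chi> (int (bs i))) (char_pow \<chi> (int (cs i)))) *
      lauricella_A K \<psi> n (char_pow \<chi> (- int a)) (\<lambda>i. char_pow \<chi> (int (bs i)))
        (\<lambda>i. char_pow \<chi> (int (bs i + cs i))) l"
proof -
  let ?I = "{1..n}"
  have "(\<Sum>x\<in>?I \<rightarrow>\<^sub>E K. \<chi> ((1 - (\<Sum>i\<in>?I. l i * x i)) ^ a * (\<Prod>i\<in>?I. x i ^ bs i * (1 - x i) ^ cs i))) =
    (\<Sum>x\<in>?I \<rightarrow>\<^sub>E K. char_pow \<chi> (int a) (1 - (\<Sum>i\<in>?I. l i * x i)) *
      (\<Prod>i\<in>?I. char_pow \<chi> (int (bs i)) (x i) * char_pow \<chi> (int (cs i)) (1 - x i)))"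
  proof (rule sum.cong[OF refl])
    fix x assume x: "x \<in> ?I \<rightarrow>\<^sub>E K"
    have xK: "x i \<in> K" "l i \<in> K" if "i \<in> ?I" for i
      using that x l by auto
    have s: "1 - (\<Sum>i\<in>?I. l i * x i) \<in> K"
      using xK by (intro diff_in one_in sum_in mult_in)
    have p: "(\<Prod>i\<in>?I. x i ^ bs i * (1 - x i) ^ cs i) \<in> K"
      using xK by (intro prod_in power_in diff_in one_in mult_in; simp)
    have P: "\<chi> (\<Prod>i\<in>?I. x i ^ bs i * (1 - x i) ^ cs i) = (\<Prod>i\<in>?I. \<chi> (x i ^ bs i * (1 - x i) ^ cs i))"
      using xK by (intro char_prod_eq[OF \<chi>] power_in diff_in one_in mult_in; simp)
    have "\<chi> ((1 - (\<Sum>i\<in>?I. l i * x i)) ^ a * (\<Prod>i\<in>?I. x i ^ bs i * (1 - x i) ^ cs i)) =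
      \<chi> (1 - (\<Sum>i\<in>?I. l i * x i)) ^ a * (\<Prod>i\<in>?I. \<chi> (x i ^ bs i * (1 - x i) ^ cs i))"
      unfolding P[symmetric] using s p by (simp add: char_mult_eq[OF \<chi>] char_power[OF \<chi>])
    also have "(\<Prod>i\<in>?I. \<chi> (x i ^ bs i * (1 - x i) ^ cs i)) =
        (\<Prod>i\<in>?I. char_pow \<chi> (int (bs i)) (x i) * char_pow \<chi> (int (cs i)) (1 - x i))"
      using xK pos by (intro prod.cong) (simp_all add: char_mult_eq[OF \<chi>] char_power[OF \<chi>] char_pow_nat)
    finally show "\<chi> ((1 - (\<Sum>i\<in>?I. l i * x i)) ^ a * (\<Prod>i\<in>?I. x i ^ bs i * (1 - x i) ^ cs i)) =
      char_pow \<chi> (int a) (1 - (\<Sum>i\<in>?I. l i * x i)) *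
      (\<Prod>i\<in>?I. char_pow \<chi> (int (bs i)) (x i) * char_pow \<chi> (int (cs i)) (1 - x i))"
      using pos(1) by (simp add: char_pow_nat)
  qed
  also have "\<dots> = (\<Prod>i=1..n. - jacobi2 K (char_pow \<chi> (int (bs i))) (char_pow \<chi> (int (cs i)))) *
      lauricella_A K \<psi> n (char_pow (char_pow \<chi> (int a)) (- 1)) (\<lambda>i. char_pow \<chi> (int (bs i)))
        (\<lambda>i. char_mult (char_pow \<chi> (int (bs i))) (char_pow \<chi> (int (cs i)))) l"
    using \<chi> nt l by (intro sum_eq_lauricella_A) auto
  finally show ?thesis
    by (simp add: char_pow_add[symmetric] char_pow_uminus[of _ "int a"])
qed

lemma char_sum_A_reciprocal:
  assumes \<chi>: "\<chi> \<in> mult_chars K"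
    and pos: "a > 0" "\<And>i. i \<in> {1..n} \<Longrightarrow> bs i > 0" "\<And>i. i \<in> {1..n} \<Longrightarrow> cs i > 0"
    and nt: "char_pow \<chi> (int a) \<noteq> triv_char K" "\<And>i. i \<in> {1..n} \<Longrightarrow> char_pow \<chi> (int (bs i)) \<noteq> triv_char K"
    and l: "\<And>i. i \<in> {1..n} \<Longrightarrow> l i \<in> K - {0}"
  shows "(\<Sum>x\<in>{1..n} \<rightarrow>\<^sub>E K. \<chi> ((\<Prod>i=1..n. (x i - l i) ^ bs i) * (\<Prod>i=1..n. x i ^ cs i) * (1 - (\<Sum>i=1..n. x i)) ^ a)) =
    (- 1) ^ n * jacobi K {0..n} (\<lambda>i. char_pow \<chi> (int (if i = 0 then a else bs i + cs i))) *
      lauricella_A K \<psi> n (char_pow \<chi> (- int (a + (\<Sum>i=1..n. bs i + cs i))))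
        (\<lambda>i. char_pow \<chi> (- int (bs i))) (\<lambda>i. char_pow \<chi> (- int (bs i + cs i))) l"
proof -
  let ?I = "{1..n}"
  have "(\<Sum>x\<in>?I \<rightarrow>\<^sub>E K. \<chi> ((\<Prod>i\<in>?I. (x i - l i) ^ bs i) * (\<Prod>i\<in>?I. x i ^ cs i) * (1 - (\<Sum>i\<in>?I. x i)) ^ a)) =
    (\<Sum>x\<in>?I \<rightarrow>\<^sub>E K. (\<Prod>i\<in>?I. char_pow \<chi> (int (bs i)) (x i - l i)) * (\<Prod>i\<in>?I. char_pow \<chi> (int (cs i)) (x i)) *
      char_pow \<chi> (int a) (1 - (\<Sum>i\<in>?I. x i)))"
  proof (rule sum.cong[OF refl])
    fix x assume x: "x \<in> ?I \<rightarrow>\<^sub>E K"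
    have xK: "x i \<in> K" "l i \<in> K" if "i \<in> ?I" for i
      using that x l by auto
    have s: "1 - (\<Sum>i\<in>?I. x i) \<in> K"
      using xK by (intro diff_in one_in sum_in)
    have p: "(\<Prod>i\<in>?I. (x i - l i) ^ bs i) \<in> K" "(\<Prod>i\<in>?I. x i ^ cs i) \<in> K"
      using xK by (intro prod_in power_in diff_in; simp)+
    have P: "\<chi> (\<Prod>i\<in>?I. (x i - l i) ^ bs i) = (\<Prod>i\<in>?I. \<chi> ((x i - l i) ^ bs i))"
      "\<chi> (\<Prod>i\<in>?I. x i ^ cs i) = (\<Prod>i\<in>?I. \<chi> (x i ^ cs i))"
      using xK by (intro char_prod_eq[OF \<chi>] power_in diff_in one_in mult_in; simp)+
    have "\<chi> ((\<Prod>i\<in>?I. (x i - l i) ^ bs i) * (\<Prod>i\<in>?I. x i ^ cs i) * (1 - (\<Sum>i\<in>?I. x i)) ^ a) =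
      (\<Prod>i\<in>?I. \<chi> ((x i - l i) ^ bs i)) * (\<Prod>i\<in>?I. \<chi> (x i ^ cs i)) * \<chi> (1 - (\<Sum>i\<in>?I. x i)) ^ a"
      unfolding P[symmetric] using s p by (simp add: char_mult_eq[OF \<chi>] char_power[OF \<chi>])
    also have "(\<Prod>i\<in>?I. \<chi> ((x i - l i) ^ bs i)) = (\<Prod>i\<in>?I. char_pow \<chi> (int (bs i)) (x i - l i))"
      using xK pos by (intro prod.cong) (simp_all add: char_power[OF \<chi>] char_pow_nat)
    also have "(\<Prod>i\<in>?I. \<chi> (x i ^ cs i)) = (\<Prod>i\<in>?I. char_pow \<chi> (int (cs i)) (x i))"
      using xK pos by (intro prod.cong) (simp_all add: char_power[OF \<chi>] char_pow_nat)
    finally show "\<chi> ((\<Prod>i\<in>?I. (x i - l i) ^ bs i) * (\<Prod>i\<in>?I. x i ^ cs i) * (1 - (\<Sum>i\<in>?I. x i)) ^ a) =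
      (\<Prod>i\<in>?I. char_pow \<chi> (int (bs i)) (x i - l i)) * (\<Prod>i\<in>?I. char_pow \<chi> (int (cs i)) (x i)) *
      char_pow \<chi> (int a) (1 - (\<Sum>i\<in>?I. x i))"
      using pos(1) by (simp add: char_pow_nat)
  qed
  also have "\<dots> = (- 1) ^ n * jacobi K {0..n} (\<lambda>i. if i = 0 then char_pow \<chi> (int a)
        else char_mult (char_pow \<chi> (int (bs i))) (char_pow \<chi> (int (cs i)))) *
      lauricella_A K \<psi> n (char_pow (char_mult (char_pow \<chi> (int a)) (char_prod K {1..n}
          (\<lambda>i. char_mult (char_pow \<chi> (int (bs i))) (char_pow \<chi> (int (cs i)))))) (- 1))
        (\<lambda>i. char_pow (char_pow \<chi> (int (bs i))) (- 1))
        (\<lambda>i. char_pow (char_mult (char_pow \<chi> (int (bs i))) (char_pow \<chi> (int (cs i)))) (- 1)) l"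
    using \<chi> nt l by (intro sum_eq_lauricella_A_reciprocal) auto
  also have "(\<lambda>i. if i = 0 then char_pow \<chi> (int a) else char_mult (char_pow \<chi> (int (bs i))) (char_pow \<chi> (int (cs i)))) =
      (\<lambda>i. char_pow \<chi> (int (if i = 0 then a else bs i + cs i)))"
    by (simp add: fun_eq_iff char_pow_add)
  also have "(\<lambda>i. char_pow (char_mult (char_pow \<chi> (int (bs i))) (char_pow \<chi> (int (cs i)))) (- 1)) =
      (\<lambda>i. char_pow \<chi> (- int (bs i + cs i)))"
    unfolding char_pow_add[symmetric] char_pow_uminus[symmetric] by simp
  also have "(\<lambda>i. char_pow (char_pow \<chi> (int (bs i))) (- 1)) = (\<lambda>i. char_pow \<chi> (- int (bs i)))"
    unfolding char_pow_uminus[symmetric] ..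
  also have "char_pow (char_mult (char_pow \<chi> (int a)) (char_prod K {1..n}
          (\<lambda>i. char_mult (char_pow \<chi> (int (bs i))) (char_pow \<chi> (int (cs i)))))) (- 1) =
      char_pow \<chi> (- int (a + (\<Sum>i=1..n. bs i + cs i)))"
    unfolding char_pow_add[symmetric] char_pow_sum[OF \<chi> finite_atLeastAtMost] char_pow_uminus[symmetric] by simp
  finally show ?thesis .
qed

lemma char_sum_B:
  assumes \<chi>: "\<chi> \<in> mult_chars K"
    and pos: "c > 0" "\<And>i. i \<in> {1..n} \<Longrightarrow> as i > 0" "\<And>i. i \<in> {1..n} \<Longrightarrow> bs i > 0"
    and nt: "char_pow \<chi> (int c) \<noteq> triv_char K" "\<And>i. i \<in> {1..n} \<Longrightarrow> char_pow \<chi> (int (as i)) \<noteq> triv_char K"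
    and l: "\<And>i. i \<in> {1..n} \<Longrightarrow> l i \<in> K - {0}"
  shows "(\<Sum>x\<in>{1..n} \<rightarrow>\<^sub>E K. \<chi> ((\<Prod>i=1..n. (1 - l i * x i) ^ as i) * (\<Prod>i=1..n. x i ^ bs i) * (1 - (\<Sum>i=1..n. x i)) ^ c)) =
    (- 1) ^ n * jacobi K {0..n} (\<lambda>i. char_pow \<chi> (int (if i = 0 then c else bs i))) *
      lauricella_B K \<psi> n (\<lambda>i. char_pow \<chi> (- int (as i))) (\<lambda>i. char_pow \<chi> (int (bs i)))
        (char_pow \<chi> (int ((\<Sum>i=1..n. bs i) + c))) l"
proof -
  let ?I = "{1..n}"
  have "(\<Sum>x\<in>?I \<rightarrow>\<^sub>E K. \<chi> ((\<Prod>i\<in>?I. (1 - l i * x i) ^ as i) * (\<Prod>i\<in>?I. x i ^ bs i) * (1 - (\<Sum>i\<in>?I. x i)) ^ c)) =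
    (\<Sum>x\<in>?I \<rightarrow>\<^sub>E K. (\<Prod>i\<in>?I. char_pow \<chi> (int (as i)) (1 - l i * x i)) * (\<Prod>i\<in>?I. char_pow \<chi> (int (bs i)) (x i)) *
      char_pow \<chi> (int c) (1 - (\<Sum>i\<in>?I. x i)))"
  proof (rule sum.cong[OF refl])
    fix x assume x: "x \<in> ?I \<rightarrow>\<^sub>E K"
    have xK: "x i \<in> K" "l i \<in> K" if "i \<in> ?I" for i
      using that x l by auto
    have s: "1 - (\<Sum>i\<in>?I. x i) \<in> K"
      using xK by (intro diff_in one_in sum_in)
    have p: "(\<Prod>i\<in>?I. (1 - l i * x i) ^ as i) \<in> K" "(\<Prod>i\<in>?I. x i ^ bs i) \<in> K"
      using xK by (intro prod_in power_in diff_in one_in mult_in; simp)+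
    have P: "\<chi> (\<Prod>i\<in>?I. (1 - l i * x i) ^ as i) = (\<Prod>i\<in>?I. \<chi> ((1 - l i * x i) ^ as i))"
      "\<chi> (\<Prod>i\<in>?I. x i ^ bs i) = (\<Prod>i\<in>?I. \<chi> (x i ^ bs i))"
      using xK by (intro char_prod_eq[OF \<chi>] power_in diff_in one_in mult_in; simp)+
    have "\<chi> ((\<Prod>i\<in>?I. (1 - l i * x i) ^ as i) * (\<Prod>i\<in>?I. x i ^ bs i) * (1 - (\<Sum>i\<in>?I. x i)) ^ c) =
      (\<Prod>i\<in>?I. \<chi> ((1 - l i * x i) ^ as i)) * (\<Prod>i\<in>?I. \<chi> (x i ^ bs i)) * \<chi> (1 - (\<Sum>i\<in>?I. x i)) ^ c"
      unfolding P[symmetric] using s p by (simp add: char_mult_eq[OF \<chi>] char_power[OF \<chi>])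
    also have "(\<Prod>i\<in>?I. \<chi> ((1 - l i * x i) ^ as i)) = (\<Prod>i\<in>?I. char_pow \<chi> (int (as i)) (1 - l i * x i))"
      using xK pos by (intro prod.cong) (simp_all add: char_power[OF \<chi>] char_pow_nat)
    also have "(\<Prod>i\<in>?I. \<chi> (x i ^ bs i)) = (\<Prod>i\<in>?I. char_pow \<chi> (int (bs i)) (x i))"
      using xK pos by (intro prod.cong) (simp_all add: char_power[OF \<chi>] char_pow_nat)
    finally show "\<chi> ((\<Prod>i\<in>?I. (1 - l i * x i) ^ as i) * (\<Prod>i\<in>?I. x i ^ bs i) * (1 - (\<Sum>i\<in>?I. x i)) ^ c) =
      (\<Prod>i\<in>?I. char_pow \<chi> (int (as i)) (1 - l i * x i)) * (\<Prod>i\<in>?I. char_pow \<chi> (int (bs i)) (x i)) *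
      char_pow \<chi> (int c) (1 - (\<Sum>i\<in>?I. x i))"
      using pos(1) by (simp add: char_pow_nat)
  qed
  also have "\<dots> = (- 1) ^ n * jacobi K {0..n} (\<lambda>i. if i = 0 then char_pow \<chi> (int c) else char_pow \<chi> (int (bs i))) *
      lauricella_B K \<psi> n (\<lambda>i. char_pow (char_pow \<chi> (int (as i))) (- 1)) (\<lambda>i. char_pow \<chi> (int (bs i)))
        (char_mult (char_pow \<chi> (int c)) (char_prod K {1..n} (\<lambda>i. char_pow \<chi> (int (bs i))))) l"
    using \<chi> nt l by (intro sum_eq_lauricella_B) auto
  also have "(\<lambda>i. if i = 0 then char_pow \<chi> (int c) else char_pow \<chi> (int (bs i))) =
      (\<lambda>i. char_pow \<chi> (int (if i = 0 then c else bs i)))"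
    by (simp add: fun_eq_iff)
  also have "(\<lambda>i. char_pow (char_pow \<chi> (int (as i))) (- 1)) = (\<lambda>i. char_pow \<chi> (- int (as i)))"
    unfolding char_pow_uminus[symmetric] ..
  also have "char_mult (char_pow \<chi> (int c)) (char_prod K {1..n} (\<lambda>i. char_pow \<chi> (int (bs i)))) =
      char_pow \<chi> (int ((\<Sum>i=1..n. bs i) + c))"
    unfolding char_pow_sum[OF \<chi> finite_atLeastAtMost] char_pow_add[symmetric] by (simp add: add.commute)
  finally show ?thesis .
qed

end

theorem corollary4p10:
  fixes \<phi> \<phi>d :: "'a::finite_field \<Rightarrow> qbar"
    and \<psi> :: "nat \<Rightarrow> 'a alg_closure \<Rightarrow> qbar"
    and n d a c :: nat
    and as bs cs :: "nat \<Rightarrow> nat"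
    and l :: "nat \<Rightarrow> 'a"
    and m :: int
  defines "\<phi>d \<equiv> char_pow \<phi> (int ((CARD('a) - 1) div d))"
  defines "\<Phi> \<equiv> (\<lambda>r k. char_pow (lift_char r \<phi>d) (m * k))"
  defines "f \<equiv> (\<lambda>r. lauricella_A (ext_field r) (\<psi> r) n
      (\<Phi> r (- int a))
      (\<lambda>i. \<Phi> r (int (bs i)))
      (\<lambda>i. \<Phi> r (int (bs i + cs i)))
      (\<lambda>i. to_ac (l i)))"
  defines "g \<equiv> (\<lambda>r. lauricella_A (ext_field r) (\<psi> r) n
      (\<Phi> r (- int (a + (\<Sum>i=1..n. bs i + cs i))))
      (\<lambda>i. \<Phi> r (- int (bs i)))
      (\<lambda>i. \<Phi> r (- int (bs i + cs i)))
      (\<lambda>i. to_ac (l i)))"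
  defines "h \<equiv> (\<lambda>r. lauricella_B (ext_field r) (\<psi> r) n
      (\<lambda>i. \<Phi> r (- int (as i)))
      (\<lambda>i. \<Phi> r (int (bs i)))
      (\<Phi> r (int ((\<Sum>i=1..n. bs i) + c)))
      (\<lambda>i. to_ac (l i)))"
  defines "J_A \<equiv> jacobi (UNIV :: 'a set) {0..n}
      (\<lambda>i. char_pow \<phi>d (m * int (if i = 0 then a else bs i + cs i)))"
  defines "J_B \<equiv> jacobi (UNIV :: 'a set) {0..n}
      (\<lambda>i. char_pow \<phi>d (m * int (if i = 0 then c else bs i)))"
  assumes "n > 0" and "d > 0" and "a > 0" and "c > 0"
    and "\<And>i. i \<in> {1..n} \<Longrightarrow> as i > 0 \<and> bs i > 0 \<and> cs i > 0"
    and "d dvd CARD('a) - 1"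
    and "\<And>i. i \<in> {1..n} \<Longrightarrow> l i \<noteq> 0"
    and "generates_mult_chars UNIV \<phi>"
    and "\<And>r. r \<ge> 1 \<Longrightarrow> nontrivial_add_char (ext_field r) (\<psi> r)"
  shows "(coprime d a \<and> (\<forall>i\<in>{1..n}. coprime d (cs i)) \<longrightarrow>
           L_mu n d (S1_A n d a bs cs l) \<phi> m =
             (if int d dvd m then 1 / (1 - of_nat (CARD('a) ^ n) * fps_X)
              else exp_series (\<lambda>r.
                (\<Prod>i=1..n. - (jacobi2 UNIV (char_pow \<phi>d (m * int (bs i)))
                                          (char_pow \<phi>d (m * int (cs i))) ^ r)) * f r))) \<and>
         (coprime d a \<and> (\<forall>i\<in>{1..n}. coprime d (bs i)) \<longrightarrow>
           L_mu n d (S2_A n d a bs cs l) \<phi> m =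
             (if int d dvd m then 1 / (1 - of_nat (CARD('a) ^ n) * fps_X)
              else exp_series (\<lambda>r. (- 1) ^ n * J_A ^ r * g r))) \<and>
         ((\<forall>i\<in>{1..n}. coprime d (as i)) \<and> coprime d c \<longrightarrow>
           L_mu n d (S_B n d as bs c l) \<phi> m =
             (if int d dvd m then 1 / (1 - of_nat (CARD('a) ^ n) * fps_X)
              else exp_series (\<lambda>r. (- 1) ^ n * J_B ^ r * h r)))"
proof -
  define \<chi> where "\<chi> = (\<lambda>r. char_pow (lift_char r \<phi>d) m)"
  define \<psi>0 :: "'a \<Rightarrow> qbar" where "\<psi>0 = (\<lambda>x. \<psi> 1 (to_ac x))"
  note pos = \<open>a > 0\<close> \<open>c > 0\<close> \<open>\<And>i. i \<in> {1..n} \<Longrightarrow> as i > 0 \<and> bs i > 0 \<and> cs i > 0\<close>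
  note d = \<open>d > 0\<close> \<open>d dvd CARD('a) - 1\<close>
  note \<phi> = \<open>generates_mult_chars UNIV \<phi>\<close> \<phi>d_def[THEN meta_eq_to_obj_eq]
  note \<phi>d = phi_d_in[OF d \<phi>]
  interpret U: finite_subfield "UNIV :: 'a set"
    by (rule finite_subfield_UNIV)
  \<comment> \<open>Only the existence of an additive character of the base field matters, and degree 1 provides one.\<close>
  have \<psi>0: "nontrivial_add_char UNIV \<psi>0"
  proof -
    have "nontrivial_add_char (range to_ac) (\<psi> 1)"
      using \<open>\<And>r. r \<ge> 1 \<Longrightarrow> nontrivial_add_char (ext_field r) (\<psi> r)\<close>[of 1]
      by (simp only: ext_field_1)
    thus ?thesis
      by (auto simp: nontrivial_add_char_def \<psi>0_def)
  qed
  have \<chi>: "\<chi> r \<in> mult_chars (ext_field r)"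
    and locale_r: "finite_subfield_add_char (ext_field r) (\<psi> r)" if "r \<ge> 1" for r
  proof -
    have r: "r > 0"
      using that by simp
    show "\<chi> r \<in> mult_chars (ext_field r)"
      unfolding \<chi>_def
      by (intro finite_subfield.char_pow_in finite_subfield_ext_field lift_char_in \<phi>d r)
    show "finite_subfield_add_char (ext_field r) (\<psi> r)"
      using that assms by (intro finite_subfield_add_char.intro finite_subfield_ext_field r
          finite_subfield_add_char_axioms.intro) auto
  qed
  have \<Phi>_eq: "\<Phi> r k = char_pow (\<chi> r) k" for r k
    by (simp add: \<Phi>_def \<chi>_def char_pow_mult)
  have lift: "lift_char r (char_pow \<phi>d (m * k)) = char_pow (\<chi> r) k" for r k
    by (simp add: \<chi>_def char_pow_mult lift_char_pow)
  \<comment> \<open>The order of the base character is d, so coprimality keeps its powers non-trivial.\<close>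
  have base_nt: "char_pow \<phi>d (m * int k) \<noteq> triv_char UNIV" if "coprime d k" "\<not> int d dvd m" for k
    using that by (simp add: phi_d_pow_eq_triv_iff[OF d \<phi>] coprime_dvd_mult_left_iff)
  have nt: "char_pow (\<chi> r) (int k) \<noteq> triv_char (ext_field r)"
    if "coprime d k" "\<not> int d dvd m" "r \<ge> 1" for k r
    using base_nt[OF that(1,2)] lift_char_eq_triv_iff[OF U.char_pow_in[OF \<phi>d], of r "m * int k"] that(3)
    by (simp add: lift)
  have unit: "to_ac (l i) \<in> ext_field r - {0}" if "i \<in> {1..n}" for i r
    using that assms by simp
  have part1: "L_mu n d (S1_A n d a bs cs l) \<phi> m =
      (if int d dvd m then 1 / (1 - of_nat (CARD('a) ^ n) * fps_X)
       else exp_series (\<lambda>r. (\<Prod>i=1..n. - (jacobi2 UNIV (char_pow \<phi>d (m * int (bs i)))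
                                          (char_pow \<phi>d (m * int (cs i))) ^ r)) * f r))"
    if cop: "coprime d a" "\<forall>i\<in>{1..n}. coprime d (cs i)"
  proof -
    let ?P = "\<lambda>x. (1 - (\<Sum>i=1..n. to_ac (l i) * x i)) ^ a * (\<Prod>i=1..n. x i ^ bs i * (1 - x i) ^ cs i)"
    have P: "?P x \<in> ext_field r" if "r > 0" "x \<in> {1..n} \<rightarrow>\<^sub>E ext_field r" for r x
    proof -
      interpret E: finite_subfield "ext_field r :: 'a alg_closure set"
        using that(1) by (rule finite_subfield_ext_field)
      show ?thesis
        using that(2) by (intro E.mult_in E.power_in E.diff_in E.one_in E.sum_in E.prod_in) auto
    qed
    have "(\<Sum>x\<in>{1..n} \<rightarrow>\<^sub>E ext_field r. \<chi> r (?P x)) =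
      (\<Prod>i=1..n. - (jacobi2 UNIV (char_pow \<phi>d (m * int (bs i))) (char_pow \<phi>d (m * int (cs i))) ^ r)) * f r"
      if m: "\<not> int d dvd m" and r: "r \<ge> 1" for r
    proof -
      interpret E: finite_subfield_add_char "ext_field r" "\<psi> r"
        using r by (rule locale_r)
      have "jacobi2 UNIV (char_pow \<phi>d (m * int (bs i))) (char_pow \<phi>d (m * int (cs i))) ^ r =
          jacobi2 (ext_field r) (char_pow (\<chi> r) (int (bs i))) (char_pow (\<chi> r) (int (cs i)))"
        if i: "i \<in> {1..n}" for i
      proof -
        let ?\<eta> = "\<lambda>j::nat. if j = 0 then char_pow \<phi>d (m * int (bs i)) else char_pow \<phi>d (m * int (cs i))"
        have "jacobi (ext_field r) {0, 1} (\<lambda>j. lift_char r (?\<eta> j)) = jacobi UNIV {0, 1} ?\<eta> ^ r"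
          using base_nt[OF _ m, of "cs i"] cop i \<phi>d
          by (intro jacobi_lift[OF \<psi>0 r]) auto
        thus ?thesis
          by (simp add: jacobi2_def if_distrib[of "lift_char r"] lift cong: if_cong)
      qed
      thus ?thesis
        using E.char_sum_A[OF \<chi>[OF r], of a n bs cs "\<lambda>i. to_ac (l i)"] pos unit nt[OF _ m r] cop
        by (simp add: f_def \<Phi>_eq)
    qed
    hence "exp_series (\<lambda>r. \<Sum>x\<in>{1..n} \<rightarrow>\<^sub>E ext_field r. \<chi> r (?P x)) = exp_series (\<lambda>r. (\<Prod>i=1..n. - (jacobi2 UNIV (char_pow \<phi>d (m * int (bs i)))
        (char_pow \<phi>d (m * int (cs i))) ^ r)) * f r)"
      if "\<not> int d dvd m"
      using that by (intro exp_series_cong)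
    moreover have "L_mu n d (S1_A n d a bs cs l) \<phi> m = (if int d dvd m then 1 / (1 - of_nat (CARD('a) ^ n) * fps_X)
       else exp_series (\<lambda>r. \<Sum>x\<in>{1..n} \<rightarrow>\<^sub>E ext_field r. \<chi> r (?P x)))"
      unfolding S1_A_def \<chi>_def by (rule L_mu_superelliptic[OF d \<phi> P])
    ultimately show ?thesis
      by (cases "int d dvd m") (simp_all only: if_False if_True simp_thms)
  qed
  have part2: "L_mu n d (S2_A n d a bs cs l) \<phi> m =
      (if int d dvd m then 1 / (1 - of_nat (CARD('a) ^ n) * fps_X)
       else exp_series (\<lambda>r. (- 1) ^ n * J_A ^ r * g r))"
    if cop: "coprime d a" "\<forall>i\<in>{1..n}. coprime d (bs i)"
  proof -
    let ?P = "\<lambda>x. (\<Prod>i=1..n. (x i - to_ac (l i)) ^ bs i) * (\<Prod>i=1..n. x i ^ cs i) * (1 - (\<Sum>i=1..n. x i)) ^ a"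
    have P: "?P x \<in> ext_field r" if "r > 0" "x \<in> {1..n} \<rightarrow>\<^sub>E ext_field r" for r x
    proof -
      interpret E: finite_subfield "ext_field r :: 'a alg_closure set"
        using that(1) by (rule finite_subfield_ext_field)
      show ?thesis
        using that(2) by (intro E.mult_in E.power_in E.diff_in E.one_in E.sum_in E.prod_in) auto
    qed
    have "(\<Sum>x\<in>{1..n} \<rightarrow>\<^sub>E ext_field r. \<chi> r (?P x)) = (- 1) ^ n * J_A ^ r * g r"
      if m: "\<not> int d dvd m" and r: "r \<ge> 1" for r
    proof -
      interpret E: finite_subfield_add_char "ext_field r" "\<psi> r"
        using r by (rule locale_r)
      have "jacobi (ext_field r) {0..n} (\<lambda>i. lift_char r (char_pow \<phi>d (m * int (if i = 0 then a else bs i + cs i)))) =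
          J_A ^ r"
        unfolding J_A_def using base_nt[OF cop(1) m] \<phi>d
        by (intro jacobi_lift[OF \<psi>0 r]) (auto intro!: bexI[of _ 0])
      thus ?thesis
        using E.char_sum_A_reciprocal[OF \<chi>[OF r], of a n bs cs "\<lambda>i. to_ac (l i)"] pos unit nt[OF _ m r] cop
        by (simp add: g_def \<Phi>_eq lift)
    qed
    hence "exp_series (\<lambda>r. \<Sum>x\<in>{1..n} \<rightarrow>\<^sub>E ext_field r. \<chi> r (?P x)) = exp_series (\<lambda>r. (- 1) ^ n * J_A ^ r * g r)"
      if "\<not> int d dvd m"
      using that by (intro exp_series_cong)
    moreover have "L_mu n d (S2_A n d a bs cs l) \<phi> m = (if int d dvd m then 1 / (1 - of_nat (CARD('a) ^ n) * fps_X)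
       else exp_series (\<lambda>r. \<Sum>x\<in>{1..n} \<rightarrow>\<^sub>E ext_field r. \<chi> r (?P x)))"
      unfolding S2_A_def \<chi>_def by (rule L_mu_superelliptic[OF d \<phi> P])
    ultimately show ?thesis
      by (cases "int d dvd m") (simp_all only: if_False if_True simp_thms)
  qed
  have part3: "L_mu n d (S_B n d as bs c l) \<phi> m =
      (if int d dvd m then 1 / (1 - of_nat (CARD('a) ^ n) * fps_X)
       else exp_series (\<lambda>r. (- 1) ^ n * J_B ^ r * h r))"
    if cop: "\<forall>i\<in>{1..n}. coprime d (as i)" "coprime d c"
  proof -
    let ?P = "\<lambda>x. (\<Prod>i=1..n. (1 - to_ac (l i) * x i) ^ as i) * (\<Prod>i=1..n. x i ^ bs i) * (1 - (\<Sum>i=1..n. x i)) ^ c"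
    have P: "?P x \<in> ext_field r" if "r > 0" "x \<in> {1..n} \<rightarrow>\<^sub>E ext_field r" for r x
    proof -
      interpret E: finite_subfield "ext_field r :: 'a alg_closure set"
        using that(1) by (rule finite_subfield_ext_field)
      show ?thesis
        using that(2) by (intro E.mult_in E.power_in E.diff_in E.one_in E.sum_in E.prod_in) auto
    qed
    have "(\<Sum>x\<in>{1..n} \<rightarrow>\<^sub>E ext_field r. \<chi> r (?P x)) = (- 1) ^ n * J_B ^ r * h r"
      if m: "\<not> int d dvd m" and r: "r \<ge> 1" for r
    proof -
      interpret E: finite_subfield_add_char "ext_field r" "\<psi> r"
        using r by (rule locale_r)
      have "jacobi (ext_field r) {0..n} (\<lambda>i. lift_char r (char_pow \<phi>d (m * int (if i = 0 then c else bs i)))) =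
          J_B ^ r"
        unfolding J_B_def using base_nt[OF cop(2) m] \<phi>d
        by (intro jacobi_lift[OF \<psi>0 r]) (auto intro!: bexI[of _ 0])
      thus ?thesis
        using E.char_sum_B[OF \<chi>[OF r], of c n as bs "\<lambda>i. to_ac (l i)"] pos unit nt[OF _ m r] cop
        by (simp add: h_def \<Phi>_eq lift)
    qed
    hence "exp_series (\<lambda>r. \<Sum>x\<in>{1..n} \<rightarrow>\<^sub>E ext_field r. \<chi> r (?P x)) = exp_series (\<lambda>r. (- 1) ^ n * J_B ^ r * h r)"
      if "\<not> int d dvd m"
      using that by (intro exp_series_cong)
    moreover have "L_mu n d (S_B n d as bs c l) \<phi> m = (if int d dvd m then 1 / (1 - of_nat (CARD('a) ^ n) * fps_X)
       else exp_series (\<lambda>r. \<Sum>x\<in>{1..n} \<rightarrow>\<^sub>E ext_field r. \<chi> r (?P x)))"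
      unfolding S_B_def \<chi>_def by (rule L_mu_superelliptic[OF d \<phi> P])
    ultimately show ?thesis
      by (cases "int d dvd m") (simp_all only: if_False if_True simp_thms)
  qed
  show ?thesis
    using part1 part2 part3 by blast
qed

end
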